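(* Let $K$ be an algebraically closed field of characteristic $0$, and let $\nu_4(G_{4,8})\subset\mathbb{P}^{69}$ be the Plücker-embedded Grassmannian of $4$-dimensional subspaces of $K^8$, which has dimension $16$. Then its third secant variety $[\nu_4(G_{4,8})]^3$ has dimension $49$, whereas its expected dimension is $50$; that is, $[\nu_4(G_{4,8})]^3$ is defective with defectiveness $1$.
   Context: $G_{k,n+1}$ is the Grassmannian of $k$-dimensional linear subspaces of $K^{n+1}$, and $\nu_k:G_{k,n+1}\to \mathbb{P}(\wedge^kK^{n+1})\simeq\mathbb{P}^{\binom{n+1}{k}-1}$ is the Plücker embedding $\langle v_1,\dots,v_k\rangle\mapsto [v_1\wedge\cdots\wedge v_k]$. For a closed irreducible projective variety $X\subseteq\mathbb{P}^N$, the $s$-th (higher) secant variety $X^s$ is the closure of the union of all linear spaces spanned by $s$ points of $X$. Its expected dimension is $\min\{N,\ s\dim X+s-1\}$; $X^s$ is called defective if $\dim X^s$ is strictly smaller than this, and the defectiveness is the difference $\min\{N,\ s\dim X+s-1\}-\dim X^s$. *)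

theory Defs
  imports "HOL-Analysis.Analysis" "HOL-Computational_Algebra.Polynomial"
begin

section \<open>Projective space and the Zariski topology\<close>

text \<open>
  The points of the projective space of \<open>K\<^sup>m\<close> are the one-dimensional subspaces of \<open>K\<^sup>m\<close>;
  the point \<open>[v]\<close> of a nonzero vector \<open>v\<close> is \<open>vec.span {v}\<close>.
\<close>

definition grassmannian :: "nat \<Rightarrow> ('a::field^'n) set set" where
  "grassmannian k = {W. vec.subspace W \<and> vec.dim W = k}"

abbreviation proj_space :: "('a::field^'n) set set" where
  "proj_space \<equiv> grassmannian 1"

definition form :: "nat \<Rightarrow> ('a::field^'n \<Rightarrow> 'a) \<Rightarrow> bool" where
  "form d f \<longleftrightarrow> (\<exists>c :: ('n \<Rightarrow> nat) \<Rightarrow> 'a. \<forall>x.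
     f x = (\<Sum>m | (\<Sum>i\<in>UNIV. m i) = d. c m * (\<Prod>i\<in>UNIV. x $ i ^ m i)))"

text \<open>
  Not a totalised sum: there are only finitely many exponent vectors of a given degree.
\<close>

lemma finite_exponents: "finite {m :: 'n::finite \<Rightarrow> nat. (\<Sum>i\<in>UNIV. m i) = d}"
proof (rule finite_subset)
  show "{m :: 'n \<Rightarrow> nat. (\<Sum>i\<in>UNIV. m i) = d} \<subseteq> UNIV \<rightarrow>\<^sub>E {..d}"
    by (auto intro: member_le_sum)
  show "finite (UNIV \<rightarrow>\<^sub>E {..d} :: ('n \<Rightarrow> nat) set)"
    by (intro finite_PiE) auto
qed

definition proj_zeros :: "('a::field^'n \<Rightarrow> 'a) set \<Rightarrow> ('a^'n) set set" where
  "proj_zeros F = {L \<in> proj_space. \<forall>f\<in>F. \<forall>x\<in>L. f x = 0}"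

definition zariski :: "('a::field^'n) set topology" where
  "zariski = topology (\<lambda>U. \<exists>F. (\<forall>f\<in>F. \<exists>d. form d f) \<and> U = proj_space - proj_zeros F)"

lemma form_mult:
  fixes f g :: "'a::field^'n \<Rightarrow> 'a"
  assumes "form d f" "form e g"
  shows "form (d + e) (\<lambda>x. f x * g x)"
proof -
  define M where "M = (\<lambda>d. {m :: 'n \<Rightarrow> nat. (\<Sum>i\<in>UNIV. m i) = d})"
  define mon where "mon = (\<lambda>m (x::'a^'n). \<Prod>i\<in>UNIV. x $ i ^ m i)"
  obtain a where a: "\<And>x. f x = (\<Sum>m\<in>M d. a m * mon m x)"
    using assms(1) by (auto simp: form_def M_def mon_def)
  obtain b where b: "\<And>x. g x = (\<Sum>m\<in>M e. b m * mon m x)"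
    using assms(2) by (auto simp: form_def M_def mon_def)
  have fin: "finite (M d)" for d unfolding M_def by (rule finite_exponents)
  define s where "s = (\<lambda>(p :: 'n \<Rightarrow> nat, q :: 'n \<Rightarrow> nat). \<lambda>i. p i + q i)"
  define c where "c = (\<lambda>m. \<Sum>(p,q) | (p,q) \<in> M d \<times> M e \<and> s (p,q) = m. a p * b q)"
  have s: "s ` (M d \<times> M e) \<subseteq> M (d + e)"
    by (auto simp: s_def M_def sum.distrib)
  have mon: "mon p x * mon q x = mon (s (p,q)) x" for p q x
    by (simp add: mon_def s_def power_add prod.distrib)
  have "f x * g x = (\<Sum>m\<in>M (d+e). c m * mon m x)" for x
  proof -
    have "f x * g x = (\<Sum>z\<in>M d \<times> M e. case z of (p,q) \<Rightarrow> a p * b q * mon (s (p,q)) x)"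
      unfolding a b sum_product sum.cartesian_product
      by (intro sum.cong) (auto simp: mon[symmetric])
    also have "\<dots> = (\<Sum>m\<in>M (d+e). \<Sum>z | z \<in> M d \<times> M e \<and> s z = m.
                      case z of (p,q) \<Rightarrow> a p * b q * mon (s (p,q)) x)"
      by (rule sum.group[symmetric]) (use fin s in auto)
    also have "\<dots> = (\<Sum>m\<in>M (d+e). c m * mon m x)"
      unfolding c_def sum_distrib_right
      by (intro sum.cong) auto
    finally show ?thesis .
  qed
  then show ?thesis
    unfolding form_def M_def mon_def by blast
qed

lemma istopology_zariski:
  "istopology (\<lambda>U :: ('a::field^'n) set set.
     \<exists>F. (\<forall>f\<in>F. \<exists>d. form d f) \<and> U = proj_space - proj_zeros F)"
  unfolding istopology_def
proof safe
  fix F G :: "('a^'n \<Rightarrow> 'a) set"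
  assume F: "\<forall>f\<in>F. \<exists>d. form d f" and G: "\<forall>f\<in>G. \<exists>d. form d f"
  let ?H = "{\<lambda>x. f x * g x | f g. f \<in> F \<and> g \<in> G}"
  have line: "\<exists>c. y = c *s x"
    if "L \<in> proj_space" "x \<in> L" "x \<noteq> 0" "y \<in> L" for L :: "('a^'n) set" and x y
  proof -
    have "L \<subseteq> vec.span {x}"
      using that by (intro vec.card_ge_dim_independent) (auto simp: grassmannian_def)
    then show ?thesis using that by (auto simp: vec.span_singleton)
  qed
  have scale: "f (c *s x) = c ^ d * f x" if df: "form d f" for d f c and x :: "'a^'n"
  proof -
    obtain a where a: "\<And>x. f x = (\<Sum>m | (\<Sum>i\<in>UNIV. m i) = d. a m * (\<Prod>i\<in>UNIV. x $ i ^ m i))"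
      using df unfolding form_def by blast
    show ?thesis unfolding a sum_distrib_left
      by (intro sum.cong)
        (auto simp: power_mult_distrib prod.distrib power_sum[symmetric])
  qed
  have zero: "(\<forall>y\<in>L. f y = 0) \<longleftrightarrow> f x = 0"
    if L: "L \<in> proj_space" "x \<in> L" "x \<noteq> 0" and f: "\<exists>d. form d f" for L and x :: "'a^'n" and f
    using line[OF L] scale f L by (metis mult_zero_right)
  have ex: "\<exists>x\<in>L. x \<noteq> 0" if "L \<in> proj_space" for L :: "('a^'n) set"
    using that vec.dim_eq_0[of L] by (auto simp: grassmannian_def)
  have H: "\<forall>f\<in>?H. \<exists>d. form d f"
    using F G form_mult by blast
  have sub: "proj_zeros A \<subseteq> proj_space" for A :: "('a^'n \<Rightarrow> 'a) set"
    by (auto simp: proj_zeros_def)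
  have pt: "L \<in> proj_zeros ?H \<longleftrightarrow> L \<in> proj_zeros F \<or> L \<in> proj_zeros G" if L: "L \<in> proj_space" for L
  proof -
    obtain x where x: "x \<in> L" "x \<noteq> 0" using ex[OF L] by blast
    have "L \<in> proj_zeros A \<longleftrightarrow> (\<forall>f\<in>A. f x = 0)" if "\<forall>f\<in>A. \<exists>d. form d f" for A
      using zero[OF L x] that L by (auto simp: proj_zeros_def)
    note Z = this[OF F] this[OF G] this[OF H]
    have "(\<forall>h\<in>?H. h x = 0) \<longleftrightarrow> (\<forall>f\<in>F. \<forall>g\<in>G. f x * g x = 0)"
    proof -
      have "?H = (\<lambda>(f, g) x. f x * g x) ` (F \<times> G)" by auto
      then show ?thesis by simp
    qed
    also have "\<dots> \<longleftrightarrow> (\<forall>f\<in>F. f x = 0) \<or> (\<forall>g\<in>G. g x = 0)" by auto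
    finally show ?thesis by (simp only: Z)
  qed
  have "proj_zeros ?H = proj_zeros F \<union> proj_zeros G"
  proof (rule set_eqI)
    fix L
    show "L \<in> proj_zeros ?H \<longleftrightarrow> L \<in> proj_zeros F \<union> proj_zeros G"
    proof (cases "L \<in> proj_space")
      case True
      then show ?thesis using pt[OF True] by (simp only: Un_iff)
    next
      case False
      then have "L \<notin> proj_zeros A" for A using sub[of A] by (rule contra_subsetD[rotated])
      then show ?thesis by (simp only: Un_iff simp_thms)
    qed
  qed
  then have "(proj_space - proj_zeros F) \<inter> (proj_space - proj_zeros G) = proj_space - proj_zeros ?H"
    by (simp only: Diff_Un)
  with H show "\<exists>Fa. (\<forall>f\<in>Fa. \<exists>d. form d f) \<and>
      (proj_space - proj_zeros F) \<inter> (proj_space - proj_zeros G) = proj_space - proj_zeros Fa"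
    by (intro exI[of _ ?H] conjI)
next
  fix \<K> :: "('a^'n) set set set"
  assume "\<forall>K\<in>\<K>. \<exists>F. (\<forall>f\<in>F. \<exists>d. form d f) \<and> K = proj_space - proj_zeros F"
  then obtain F where F: "\<And>K. K \<in> \<K> \<Longrightarrow> (\<forall>f\<in>F K. \<exists>d. form d f) \<and> K = proj_space - proj_zeros (F K)"
    by metis
  have "\<Union>\<K> = (\<Union>K\<in>\<K>. proj_space - proj_zeros (F K))" using F by auto
  also have "\<dots> = proj_space - proj_zeros (\<Union>K\<in>\<K>. F K)"
    by (auto simp: proj_zeros_def)
  finally have "\<Union>\<K> = proj_space - proj_zeros (\<Union>K\<in>\<K>. F K)" .
  moreover have "\<forall>f\<in>(\<Union>K\<in>\<K>. F K). \<exists>d. form d f"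
  proof
    fix f assume "f \<in> (\<Union>K\<in>\<K>. F K)"
    then obtain K where "K \<in> \<K>" "f \<in> F K" by (rule UN_E)
    then show "\<exists>d. form d f" using F[of K] by metis
  qed
  ultimately show "\<exists>F. (\<forall>f\<in>F. \<exists>d. form d f) \<and> \<Union>\<K> = proj_space - proj_zeros F"
    by (intro exI[of _ "\<Union>K\<in>\<K>. F K"] conjI)
qed

lemma openin_zariski:
  "openin zariski U \<longleftrightarrow> (\<exists>F. (\<forall>f\<in>F. \<exists>d. form d f) \<and> U = proj_space - proj_zeros F)"
  unfolding zariski_def by (subst topology_inverse'[OF istopology_zariski]) simp

lemma topspace_zariski: "topspace zariski = proj_space"
proof (rule antisym)
  show "topspace zariski \<subseteq> proj_space"
    using openin_topspace[of zariski] unfolding openin_zariski by blast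
  have "form 0 (\<lambda>x :: 'a^'n. 1)"
  proof -
    have "{m :: 'n \<Rightarrow> nat. (\<Sum>i\<in>UNIV. m i) = 0} = {\<lambda>_. 0}" by auto
    then show ?thesis unfolding form_def by (intro exI[of _ "\<lambda>_. 1"]) simp
  qed
  moreover have "proj_zeros {\<lambda>x :: 'a^'n. 1 :: 'a} = {}"
    by (auto simp: proj_zeros_def grassmannian_def dest: vec.subspace_0)
  ultimately have "openin zariski (proj_space :: ('a^'n) set set)"
    unfolding openin_zariski by (intro exI[of _ "{\<lambda>x :: 'a^'n. 1 :: 'a}"]) auto
  then show "(proj_space :: ('a^'n) set set) \<subseteq> topspace zariski"
    by (rule openin_subset)
qed

lemma closedin_zariski:
  "closedin zariski Z \<longleftrightarrow> (\<exists>F. (\<forall>f\<in>F. \<exists>d. form d f) \<and> Z = proj_zeros F)"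
proof
  assume Z: "closedin zariski Z"
  then obtain F where "\<forall>f\<in>F. \<exists>d. form d f" "proj_space - Z = proj_space - proj_zeros F"
    by (auto simp only: closedin_def topspace_zariski openin_zariski)
  moreover have "Z \<subseteq> proj_space" "proj_zeros F \<subseteq> proj_space"
    using closedin_subset[OF Z] by (auto simp: topspace_zariski proj_zeros_def)
  ultimately have "Z = proj_zeros F" by (metis double_diff order_refl)
  with \<open>\<forall>f\<in>F. \<exists>d. form d f\<close> show "\<exists>F. (\<forall>f\<in>F. \<exists>d. form d f) \<and> Z = proj_zeros F"
    by (intro exI[of _ F] conjI)
next
  assume "\<exists>F. (\<forall>f\<in>F. \<exists>d. form d f) \<and> Z = proj_zeros F"
  then obtain F where F: "\<forall>f\<in>F. \<exists>d. form d f" "Z = proj_zeros F" by (elim exE conjE)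
  then have "openin zariski (proj_space - Z)"
    unfolding openin_zariski by (intro exI[of _ F] conjI) simp_all
  moreover have "Z \<subseteq> proj_space" using F by (auto simp: proj_zeros_def)
  ultimately show "closedin zariski Z" by (simp only: closedin_def topspace_zariski simp_thms)
qed

section \<open>Dimension and secant varieties\<close>

definition irreducible_in :: "'p topology \<Rightarrow> 'p set \<Rightarrow> bool" where
  "irreducible_in T S \<longleftrightarrow> S \<subseteq> topspace T \<and> S \<noteq> {} \<and>
     (\<forall>A B. closedin T A \<and> closedin T B \<and> S \<subseteq> A \<union> B \<longrightarrow> S \<subseteq> A \<or> S \<subseteq> B)"

definition krull_dim :: "'p topology \<Rightarrow> enat" where
  "krull_dim T = Sup {enat n | n. \<exists>Z :: nat \<Rightarrow> 'p set.
     (\<forall>i\<le>n. closedin T (Z i) \<and> irreducible_in T (Z i)) \<and> (\<forall>i<n. Z i \<subset> Z (Suc i))}"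

definition variety_dim :: "('a::field^'n) set set \<Rightarrow> enat" where
  "variety_dim X = krull_dim (subtopology zariski X)"

definition linear_hull :: "('a::field^'n) set set \<Rightarrow> ('a^'n) set set" where
  "linear_hull P = {L \<in> proj_space. L \<subseteq> vec.span (\<Union>P)}"

definition secant_variety :: "nat \<Rightarrow> ('a::field^'n) set set \<Rightarrow> ('a^'n) set set" where
  "secant_variety s X = zariski closure_of (\<Union>p \<in> {..<s} \<rightarrow> X. linear_hull (p ` {..<s}))"

definition expected_secant_dim :: "nat \<Rightarrow> ('a::field^'n) set set \<Rightarrow> enat" where
  "expected_secant_dim s (X :: ('a^'n) set set) =
     min (enat (CARD('n) - 1)) (enat s * variety_dim X + enat s - 1)"

definition secant_defective :: "nat \<Rightarrow> ('a::field^'n) set set \<Rightarrow> bool" where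
  "secant_defective s X \<longleftrightarrow> variety_dim (secant_variety s X) < expected_secant_dim s X"

definition secant_defectiveness :: "nat \<Rightarrow> ('a::field^'n) set set \<Rightarrow> enat" where
  "secant_defectiveness s X = expected_secant_dim s X - variety_dim (secant_variety s X)"

section \<open>The Pluecker embedding of \<open>G\<^sub>4\<^sub>,\<^sub>8\<close>\<close>

lemma strict_mono_range_inject:
  fixes f g :: "'k::{finite,linorder} \<Rightarrow> 'b::linorder"
  assumes "strict_mono f" "strict_mono g" "range f = range g"
  shows "f = g"
proof -
  let ?l = "sorted_list_of_set (UNIV :: 'k set)"
  have "sorted (map h ?l) \<and> distinct (map h ?l)" if h: "strict_mono h" for h :: "'k \<Rightarrow> 'b"
  proof
    show "distinct (map h ?l)"
      using strict_mono_imp_inj_on[OF h, of UNIV] by (simp add: distinct_map)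
    have "sorted_wrt (\<lambda>x y. h x \<le> h y) ?l"
      using strict_mono_less_eq[OF h] by (simp add: sorted_sorted_list_of_set)
    then show "sorted (map h ?l)" by (simp only: sorted_map)
  qed
  moreover have "set (map f ?l) = set (map g ?l)" using assms(3) by simp
  ultimately have "map f ?l = map g ?l"
    using assms(1,2) by (intro sorted_distinct_set_unique) blast+
  then have "f x = g x" for x by (simp only: map_eq_conv) simp
  then show ?thesis by blast
qed

lemma ex_strict_mono_range:
  fixes J :: "'b::{finite,linorder} set"
  assumes "card J = CARD('k::{finite,linorder})"
  shows "\<exists>f :: 'k \<Rightarrow> 'b. strict_mono f \<and> range f = J"
proof -
  define r where "r = (\<lambda>a :: 'k. card {b. b < a})"
  have r: "r a < card J" for a
    unfolding r_def assms by (rule psubset_card_mono) auto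
  have mono: "r a < r b" if "a < b" for a b
    unfolding r_def using that by (intro psubset_card_mono) auto
  define f where "f = (\<lambda>a. sorted_list_of_set J ! r a)"
  have f: "strict_mono f"
  proof (rule strict_monoI)
    fix a b :: 'k assume "a < b"
    with r[of b] mono[of a b] show "f a < f b"
      unfolding f_def
      by (intro sorted_wrt_nth_less[OF strict_sorted_list_of_set]) simp_all
  qed
  have "range f \<subseteq> J"
  proof
    fix y assume "y \<in> range f"
    then obtain a where "y = sorted_list_of_set J ! r a" by (auto simp: f_def)
    then have "y \<in> set (sorted_list_of_set J)" using r[of a] by (metis nth_mem length_sorted_list_of_set)
    then show "y \<in> J" by simp
  qed
  moreover have "card (range f) = card J"
    using f by (simp add: card_image strict_mono_imp_inj_on assms)
  ultimately have "range f = J" by (intro card_subset_eq) auto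
  with f show ?thesis by blast
qed

text \<open>
  \<open>quad\<close> indexes the standard basis \<open>e\<^sub>I = e\<^bsub>I 0\<^esub> \<and> \<dots> \<and> e\<^bsub>I 3\<^esub>\<close> of the fourth exterior power
  of \<open>K\<^sup>8\<close>, so that \<open>K ^ quad\<close> is this exterior power. In this basis the coordinates of
  \<open>v\<^sub>0 \<and> \<dots> \<and> v\<^sub>3\<close>, where \<open>v\<^sub>i\<close> is the \<open>i\<close>-th row of \<open>v\<close>, are the maximal minors of \<open>v\<close>.
\<close>

typedef quad = "{I :: 4 \<Rightarrow> 8. strict_mono I}"
  morphisms quad_fun Quad
proof -
  have "\<exists>f :: 4 \<Rightarrow> 8. strict_mono f \<and> range f = J" if "card J = 4" for J
    using ex_strict_mono_range[where 'k=4, of J] that by simp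
  moreover obtain J :: "8 set" where "card J = 4"
    using obtain_subset_with_card_n[of 4 "UNIV :: 8 set"] by auto
  ultimately show ?thesis by blast
qed

lemma bij_betw_quad: "bij_betw (\<lambda>I. range (quad_fun I)) UNIV {J :: 8 set. card J = 4}"
  unfolding bij_betw_def
proof
  show "inj (\<lambda>I. range (quad_fun I))"
  proof (rule injI)
    fix I J assume "range (quad_fun I) = range (quad_fun J)"
    then have "quad_fun I = quad_fun J"
      using strict_mono_range_inject[of "quad_fun I" "quad_fun J"] quad_fun[of I] quad_fun[of J]
      by simp
    then show "I = J" by (simp add: quad_fun_inject)
  qed
  have "card (range (quad_fun I)) = 4" for I
    using quad_fun[of I] by (simp add: card_image strict_mono_imp_inj_on)
  moreover have "J \<in> range (\<lambda>I. range (quad_fun I))" if "card J = 4" for J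
  proof -
    obtain f :: "4 \<Rightarrow> 8" where "strict_mono f" "range f = J"
      using ex_strict_mono_range[where 'k=4, of J] \<open>card J = 4\<close> by auto
    then have "J = range (quad_fun (Quad f))" by (simp add: Quad_inverse)
    then show ?thesis by blast
  qed
  ultimately show "range (\<lambda>I. range (quad_fun I)) = {J. card J = 4}" by blast
qed

instance quad :: finite
  by standard (use bij_betw_finite[OF bij_betw_quad] in simp)

lemma card_quad: "CARD(quad) = 70"
proof -
  have "CARD(quad) = card {J :: 8 set. card J = 4}"
    using bij_betw_quad by (rule bij_betw_same_card)
  also have "\<dots> = 8 choose 4"
    using n_subsets[of "UNIV :: 8 set" 4] by simp
  also have "\<dots> = 70" by (simp add: numeral_eq_Suc)
  finally show ?thesis .
qed

definition wedge :: "'a::field^8^4 \<Rightarrow> 'a^quad" where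
  "wedge v = (\<chi> I. det (\<chi> i j. v $ i $ quad_fun I j))"

definition plucker :: "('a::field^8) set \<Rightarrow> ('a^quad) set" where
  "plucker W = (THE L. \<exists>v :: 'a^8^4. vec.span (rows v) = W \<and> L = vec.span {wedge v})"

lemma in_span_rows:
  fixes v :: "'a::field^'n^'m"
  assumes "y \<in> vec.span (rows v)"
  shows "\<exists>x. y = x v* v"
proof -
  have "vec.subspace (range (\<lambda>x. x v* v))"
  proof (rule vec.subspaceI)
    show "0 \<in> range (\<lambda>x. x v* v)"
      by (rule rev_image_eqI[of 0]) (simp_all add: vector_matrix_mult_def vec_eq_iff)
    fix y z assume "y \<in> range (\<lambda>x. x v* v)" "z \<in> range (\<lambda>x. x v* v)"
    then obtain a b where "y = a v* v" "z = b v* v" by blast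
    then have "y + z = (a + b) v* v"
      by (simp add: vector_matrix_mult_def vec_eq_iff sum.distrib distrib_right)
    then show "y + z \<in> range (\<lambda>x. x v* v)" by blast
  next
    fix c y assume "y \<in> range (\<lambda>x. x v* v)"
    then obtain a where "y = a v* v" by blast
    then have "c *s y = (c *s a) v* v"
      by (simp add: vector_matrix_mult_def vec_eq_iff sum_distrib_left ac_simps)
    then show "c *s y \<in> range (\<lambda>x. x v* v)" by blast
  qed
  moreover have "rows v \<subseteq> range (\<lambda>x. x v* v)"
  proof
    fix y assume "y \<in> rows v"
    then obtain i where "y = row i v" by (auto simp: rows_def)
    then have "y = axis i 1 v* v"
      by (simp add: row_def vector_matrix_mult_def vec_eq_iff axis_def of_bool_def[symmetric])
    then show "y \<in> range (\<lambda>x. x v* v)" by blast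
  qed
  ultimately show ?thesis using assms vec.span_minimal by blast
qed

lemma wedge_matrix_mult: "wedge (A ** v) = det A *s wedge v"
proof -
  have "(\<chi> i j. (A ** v) $ i $ quad_fun I j) = A ** (\<chi> i j. v $ i $ quad_fun I j)" for I
    by (simp add: matrix_matrix_mult_def vec_eq_iff)
  then show ?thesis by (simp add: wedge_def vec_eq_iff det_mul)
qed

text \<open>The description in \<open>plucker\<close> determines the line uniquely:\<close>

lemma plucker_span_rows:
  fixes v :: "'a::field^8^4"
  shows "plucker (vec.span (rows v)) = vec.span {wedge v}"
proof -
  have sub: "vec.span {wedge w} \<subseteq> vec.span {wedge v}"
    if "vec.span (rows w) \<subseteq> vec.span (rows v)" for v w :: "'a^8^4"
  proof -
    have "\<exists>x. row i w = x v* v" for i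
      using that by (intro in_span_rows) (auto simp: rows_def intro: vec.span_base)
    then obtain A where A: "\<And>i. row i w = A i v* v" by metis
    have "w = (\<chi> i. A i) ** v"
      using A by (simp add: vec_eq_iff row_def matrix_matrix_mult_def vector_matrix_mult_def mult.commute)
    then show ?thesis
      by (metis wedge_matrix_mult vec.span_base vec.span_scale singletonI vec.span_minimal
          vec.subspace_span empty_subsetI insert_subset)
  qed
  show ?thesis unfolding plucker_def
    by (rule the_equality) (use sub in \<open>blast\<close>)+
qed

lemma grassmannian_rows:
  fixes W :: "('a::field^8) set"
  assumes "W \<in> grassmannian 4"
  obtains v :: "'a^8^4" where "vec.span (rows v) = W"
proof -
  obtain B where B: "B \<subseteq> W" "vec.independent B" "W \<subseteq> vec.span B" "card B = 4"
    using assms vec.basis_exists[of W] by (metis (mono_tags, lifting) grassmannian_def mem_Collect_eq)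
  then have "card B = CARD(4)" by simp
  moreover have "finite B" using B(4) by (intro card_ge_0_finite) simp
  ultimately obtain g :: "4 \<Rightarrow> 'a^8" where "bij_betw g UNIV B"
    by (metis finite finite_same_card_bij)
  then have "rows (\<chi> i. g i) = B"
    by (auto simp: rows_def row_def bij_betw_def vec_lambda_eta)
  moreover have "vec.span B = W"
    using assms B by (intro vec.span_subspace) (auto simp: grassmannian_def)
  ultimately show ?thesis using that by metis
qed

lemma independent_range_scalars:
  fixes g :: "'k::finite \<Rightarrow> 'a::field^'n"
  assumes "inj g" "vec.independent (range g)" "(\<Sum>i\<in>UNIV. c i *s g i) = 0"
  shows "c i = 0"
proof -
  have "(\<Sum>x\<in>range g. c (inv g x) *s x) = 0"
    using assms(1,3) by (simp add: sum.reindex)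
  then have "c (inv g (g i)) = 0"
    using assms(2)[unfolded vec.independent_explicit, THEN conjunct2,
        rule_format, of "\<lambda>x. c (inv g x)"] by blast
  then show ?thesis using assms(1) by simp
qed

lemma wedge_nonzero:
  fixes v :: "'a::field^8^4"
  assumes "vec.dim (rows v) = 4"
  shows "wedge v \<noteq> 0"
proof -
  have rows: "rows v = range (\<lambda>i. row i v)" by (auto simp: rows_def)
  have "card (rows v) \<le> 4"
    using card_image_le[of "UNIV :: 4 set" "\<lambda>i. row i v"] by (simp add: rows)
  moreover have "4 \<le> card (rows v)"
    using assms vec.dim_le_card'[of "rows v"] by (simp add: rows)
  ultimately have card: "card (rows v) = 4" by simp
  then have inj: "inj (\<lambda>i. row i v)"
    unfolding rows by (intro eq_card_imp_inj_on) simp_all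
  have "vec.independent (rows v)"
    using assms card
    by (intro vec.card_le_dim_spanning[of _ "rows v"]) (auto simp: vec.span_superset rows)
  then have "\<exists>B. v ** B = mat 1"
    using independent_range_scalars[OF inj] by (simp add: matrix_right_invertible_independent_rows rows)
  then have "vec.span (columns v) = UNIV"
    by (simp add: matrix_right_invertible_span_columns)
  then have "vec.dim (columns v) = 4"
    using vec.dim_span[of "columns v"] by (simp add: vec.dim_UNIV vec.dimension_def card_cart_basis)
  then obtain B where B: "B \<subseteq> columns v" "vec.independent B" "card B = 4"
    using vec.basis_exists[of "columns v"] by metis
  moreover have "columns v = range (\<lambda>j. column j v)" by (auto simp: columns_def)
  ultimately obtain J where J: "inj_on (\<lambda>j. column j v) J" "B = (\<lambda>j. column j v) ` J"
    using subset_image_inj[of B "\<lambda>j. column j v" UNIV] by auto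
  then have "card J = CARD(4)" using B(3) by (simp add: card_image)
  then obtain f :: "4 \<Rightarrow> 8" where f: "strict_mono f" "range f = J"
    using ex_strict_mono_range by blast
  define M where "M = (\<chi> i j. v $ i $ f j)"
  have col: "column j M = column (f j) v" for j by (simp add: M_def column_def)
  have inj_col: "inj (\<lambda>j. column j M)"
    using comp_inj_on[of f UNIV "\<lambda>j. column j v"] J(1) f strict_mono_imp_inj_on[OF f(1), of UNIV]
    by (simp add: col o_def)
  have "columns M = B"
    unfolding columns_def col using J(2) f(2) by blast
  then have "vec.independent (columns M)" using B(2) by simp
  moreover have "columns M = range (\<lambda>j. column j M)" by (auto simp: columns_def)
  ultimately have "\<forall>c. (\<Sum>i\<in>UNIV. c i *s column i M) = 0 \<longrightarrow> (\<forall>i. c i = 0)"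
    using independent_range_scalars[OF inj_col] by simp
  then have "det M \<noteq> 0"
    by (simp only: matrix_left_invertible_independent_columns[symmetric] invertible_left_inverse[symmetric]
        invertible_det_nz simp_thms)
  moreover have "wedge v $ Quad f = det M"
    using f by (simp add: wedge_def M_def Quad_inverse)
  ultimately show ?thesis by auto
qed

lemma plucker_in_proj_space:
  fixes W :: "('a::field^8) set"
  assumes "W \<in> grassmannian 4"
  shows "plucker W \<in> proj_space"
proof -
  obtain v :: "'a^8^4" where v: "vec.span (rows v) = W"
    by (rule grassmannian_rows[OF assms])
  then have "vec.dim (rows v) = 4" using assms by (auto simp: grassmannian_def)
  then have "vec.dim {wedge v} = 1"
    by (simp add: vec.dim_eq_card_independent wedge_nonzero)
  then show ?thesis
    by (simp add: grassmannian_def v[symmetric] plucker_span_rows)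
qed

end

(*
  Dimensions are compared with numbers of parameters by counting forms. A chain of n + 1 irreducible
  closed sets yields at least (B + 1)^n linearly independent forms of degree E B on the largest one,
  while forms pulled back along a dense polynomial parametrization with M variables lie in a space of
  dimension O(B^M); hence n <= M. Conversely, if linear forms recover all M parameters to first order
  at a point, the closures of the images of the coordinate subspaces form a strict chain of length M.

  Three general 4-spaces of K^8 have the form K^4 (x) l for lines l of K^2, after a choice of an
  isomorphism of K^8 with K^4 (x) K^2; so their Pluecker points lie on a rational normal quartic
  spanning a P^4. A general point of this P^4 lies in a one-parameter family of planes spanned by three
  points of the quartic, whence the defect. For the upper bound this extra freedom is spent on making
  one coefficient of the corresponding binary quartic vanish.
*)
theory Submission
  imports Defs
begin

text \<open>Dimension here is the Krull dimension of a topological space, so both bounds have to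
  speak about chains of closed sets; numbers of forms of a fixed degree turn chains into
  inequalities. Genericity is always handled in the same way. The given configuration is joined by a
  line to a good one. A form along this line is a polynomial in one variable, and it is zero
  wherever an auxiliary polynomial, nonzero at the good end, does not vanish; hence it is zero at
  the given end too. Thus the upper bound for the secant variety becomes the claim that a form
  vanishing on the parametrized family vanishes on every sum of three wedges. The number 49 arises
  twice. Above: 30 entries of a 4 by 8 matrix with two entries normalised, 16 entries of a second
  matrix whose left block is the identity, and 3 coefficients. Below: three 4 by 4 matrices and one
  coefficient, near two complementary coordinate subspaces and their diagonal. The naive count is 3
  * 16 + 2; the lower bound gives up one parameter by holding a coefficient at -1.\<close>

section \<open>Linear relations by counting\<close>

text \<open>Gaussian elimination on the equations indexed by \<open>B\<close>: a pivot
  \<open>a0\<close> solves equation \<open>b\<close> for one unknown, and the reduced system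
  \<open>?M\<close> has one equation and one unknown fewer.\<close>

lemma nontrivial_relation:
  fixes M :: "'i \<Rightarrow> 'j \<Rightarrow> 'a::field"
  assumes "finite B" "finite A" "card B < card A"
  shows "\<exists>c. (\<exists>a\<in>A. c a \<noteq> 0) \<and> (\<forall>b\<in>B. (\<Sum>a\<in>A. c a * M a b) = 0)"
  using assms
proof (induction B arbitrary: A M rule: finite_induct)
  case empty
  then obtain a where "a \<in> A" by fastforce
  then show ?case by (intro exI[of _ "\<lambda>_. 1"]) auto
next
  case (insert b B)
  show ?case
  proof (cases "\<forall>a\<in>A. M a b = 0")
    case True
    have "card B < card A" using insert by simp
    from insert.IH[OF \<open>finite A\<close> this, of M] True show ?thesis by auto
  next
    case False
    then obtain a0 where a0: "a0 \<in> A" "M a0 b \<noteq> 0" by blast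
    let ?A = "A - {a0}"
    let ?M = "\<lambda>a b'. M a b' - M a b / M a0 b * M a0 b'"
    have "card B < card ?A" using insert a0 by simp
    then obtain c where c: "\<exists>a\<in>?A. c a \<noteq> 0" "\<forall>b'\<in>B. (\<Sum>a\<in>?A. c a * ?M a b') = 0"
      using insert.IH[of ?A ?M] insert.prems by blast
    define c0 where "c0 = - (\<Sum>a\<in>?A. c a * (M a b / M a0 b))"
    let ?c = "c(a0 := c0)"
    have split: "(\<Sum>a\<in>A. ?c a * M a b') = c0 * M a0 b' + (\<Sum>a\<in>?A. c a * M a b')" for b'
    proof -
      have "(\<Sum>a\<in>A. ?c a * M a b') = ?c a0 * M a0 b' + (\<Sum>a\<in>?A. ?c a * M a b')"
        using a0 insert.prems by (simp add: sum.remove)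
      also have "(\<Sum>a\<in>?A. ?c a * M a b') = (\<Sum>a\<in>?A. c a * M a b')"
        by (intro sum.cong) auto
      finally show ?thesis by simp
    qed
    also have "c0 * M a0 b' + (\<Sum>a\<in>?A. c a * M a b') = (\<Sum>a\<in>?A. c a * ?M a b')" for b'
      unfolding c0_def
      by (simp add: sum_subtractf sum_distrib_right right_diff_distrib mult.assoc)
    finally have eq: "(\<Sum>a\<in>A. ?c a * M a b') = (\<Sum>a\<in>?A. c a * ?M a b')" for b' .
    have "(\<Sum>a\<in>A. ?c a * M a b) = 0" unfolding eq using a0 by simp
    with eq c have "\<forall>b'\<in>insert b B. (\<Sum>a\<in>A. ?c a * M a b') = 0" by simp
    moreover have "\<exists>a\<in>A. ?c a \<noteq> 0" using c(1) by auto
    ultimately show ?thesis by blast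
  qed
qed

text \<open>A polynomial in \<open>B\<close> of degree \<open>n\<close> outgrows one of degree
  \<open>M\<close>. The witness \<open>(K + 1) ^ M\<close> works because \<open>K * B + 1\<close> is
  at most \<open>(K + 1) * (B + 1)\<close>. This is the numerical core of both dimension
  bounds.\<close>

lemma exists_power_gap:
  fixes K M n :: nat
  assumes "M < n"
  shows "\<exists>B. (K * B + 1) ^ M < (B + 1) ^ n"
proof
  let ?B = "(K + 1) ^ M"
  have "(K * ?B + 1) ^ M \<le> ((K + 1) * (?B + 1)) ^ M"
    by (intro power_mono) auto
  also have "\<dots> = ?B * (?B + 1) ^ M" by (simp only: power_mult_distrib)
  also have "\<dots> < (?B + 1) * (?B + 1) ^ M" by (intro mult_strict_right_mono) auto
  also have "\<dots> = (?B + 1) ^ Suc M" by simp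
  also have "\<dots> \<le> (?B + 1) ^ n" using assms by (intro power_increasing) auto
  finally show "(K * ?B + 1) ^ M < (?B + 1) ^ n" .
qed

section \<open>Polynomial functions\<close>

text \<open>The bound \<open>e\<close> is on the degree in each variable, not on the total degree:
  it still adds up under products, and the number of coefficients is exactly
  \<open>(e + 1) ^ card J\<close>.\<close>

definition polyfun :: "'i set \<Rightarrow> nat \<Rightarrow> (('i \<Rightarrow> 'a::field) \<Rightarrow> 'a) \<Rightarrow> bool" where
  "polyfun J e f \<longleftrightarrow> (\<exists>c. \<forall>x. f x = (\<Sum>m\<in>J \<rightarrow>\<^sub>E {..e}. c m * (\<Prod>j\<in>J. x j ^ m j)))"

lemma polyfun_mono:
  assumes "finite J" "polyfun J e f" "e \<le> e'"
  shows "polyfun J e' f"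
proof -
  obtain c where c: "\<And>x. f x = (\<Sum>m\<in>J \<rightarrow>\<^sub>E {..e}. c m * (\<Prod>j\<in>J. x j ^ m j))"
    using assms(2) by (auto simp: polyfun_def)
  let ?c = "\<lambda>m. if m \<in> J \<rightarrow>\<^sub>E {..e} then c m else 0"
  have "f x = (\<Sum>m\<in>J \<rightarrow>\<^sub>E {..e'}. ?c m * (\<Prod>j\<in>J. x j ^ m j))" for x
    unfolding c
  proof (rule sum.mono_neutral_cong_left)
    show "J \<rightarrow>\<^sub>E {..e} \<subseteq> J \<rightarrow>\<^sub>E {..e'}" using assms(3) by (intro PiE_mono) auto
    show "finite (J \<rightarrow>\<^sub>E {..e'})" using assms(1) by (intro finite_PiE) auto
  qed auto
  then show ?thesis unfolding polyfun_def by (intro exI[of _ ?c]) simp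
qed

lemma polyfun_const: "finite J \<Longrightarrow> polyfun J e (\<lambda>x. k)"
proof (rule polyfun_mono[of J 0])
  have *: "J \<rightarrow>\<^sub>E {..0::nat} = {\<lambda>j\<in>J. 0}"
    by (auto simp: PiE_iff extensional_def fun_eq_iff restrict_def)
  show "polyfun J 0 (\<lambda>x. k)"
    unfolding polyfun_def * by (intro exI[of _ "\<lambda>_. k"]) simp
qed auto

lemma polyfun_var:
  assumes J: "finite J" "i \<in> J"
  shows "polyfun J 1 (\<lambda>x. x i)"
proof -
  let ?m = "\<lambda>j\<in>J. if j = i then 1 else 0 :: nat"
  have m: "?m \<in> J \<rightarrow>\<^sub>E {..1}" by auto
  have fin: "finite (J \<rightarrow>\<^sub>E {..1::nat})" using J by (intro finite_PiE) auto
  have "x i = (\<Sum>m\<in>J \<rightarrow>\<^sub>E {..1}. (if m = ?m then 1 else 0) * (\<Prod>j\<in>J. x j ^ m j))"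
    for x :: "'a \<Rightarrow> 'b"
  proof -
    have "(\<Sum>m\<in>J \<rightarrow>\<^sub>E {..1}. (if m = ?m then 1 else 0) * (\<Prod>j\<in>J. x j ^ m j)) =
          (\<Sum>m\<in>J \<rightarrow>\<^sub>E {..1}. if m = ?m then (\<Prod>j\<in>J. x j ^ m j) else 0)"
      by (intro sum.cong) auto
    also have "\<dots> = (\<Prod>j\<in>J. x j ^ ?m j)"
      by (subst sum.delta'[OF fin] | subst sum.delta[OF fin])+ (use m in simp)
    also have "\<dots> = (\<Prod>j\<in>J. if j = i then x j else 1)" by (intro prod.cong) auto
    also have "\<dots> = x i" using J by simp
    finally show ?thesis by simp
  qed
  then show ?thesis
    unfolding polyfun_def by (intro exI[of _ "\<lambda>m. if m = ?m then 1 else 0"]) simp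
qed

lemma polyfun_add:
  assumes "polyfun J e f" "polyfun J e g"
  shows "polyfun J e (\<lambda>x. f x + g x)"
proof -
  obtain a where a: "\<And>x. f x = (\<Sum>m\<in>J \<rightarrow>\<^sub>E {..e}. a m * (\<Prod>j\<in>J. x j ^ m j))"
    using assms(1) by (auto simp: polyfun_def)
  obtain b where b: "\<And>x. g x = (\<Sum>m\<in>J \<rightarrow>\<^sub>E {..e}. b m * (\<Prod>j\<in>J. x j ^ m j))"
    using assms(2) by (auto simp: polyfun_def)
  from a b have "f x + g x = (\<Sum>m\<in>J \<rightarrow>\<^sub>E {..e}. (a m + b m) * (\<Prod>j\<in>J. x j ^ m j))" for x
    by (simp add: sum.distrib distrib_right)
  then show ?thesis unfolding polyfun_def by (intro exI[of _ "\<lambda>m. a m + b m"]) simp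
qed

lemma polyfun_mult:
  assumes J: "finite J" and f: "polyfun J d f" and g: "polyfun J e g"
  shows "polyfun J (d + e) (\<lambda>x. f x * g x)"
proof -
  define M where "M = (\<lambda>d::nat. J \<rightarrow>\<^sub>E {..d})"
  define mon where "mon = (\<lambda>m (x::'a \<Rightarrow> 'b). \<Prod>i\<in>J. x i ^ m i)"
  obtain a where a: "\<And>x. f x = (\<Sum>m\<in>M d. a m * mon m x)"
    using f by (auto simp: polyfun_def M_def mon_def)
  obtain b where b: "\<And>x. g x = (\<Sum>m\<in>M e. b m * mon m x)"
    using g by (auto simp: polyfun_def M_def mon_def)
  have fin: "finite (M d)" for d unfolding M_def using J by (intro finite_PiE) auto
  define s where "s = (\<lambda>(p :: 'a \<Rightarrow> nat, q :: 'a \<Rightarrow> nat). \<lambda>i\<in>J. p i + q i)"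
  define c where "c = (\<lambda>m. \<Sum>(p,q) | (p,q) \<in> M d \<times> M e \<and> s (p,q) = m. a p * b q)"
  have s: "s ` (M d \<times> M e) \<subseteq> M (d + e)"
  proof
    fix m assume "m \<in> s ` (M d \<times> M e)"
    then obtain p q where "m = s (p, q)" "p \<in> M d" "q \<in> M e" by blast
    then show "m \<in> M (d + e)" by (simp add: s_def M_def PiE_iff add_mono)
  qed
  have mon: "mon p x * mon q x = mon (s (p,q)) x" for p q x
    by (simp add: mon_def s_def power_add prod.distrib)
  have "f x * g x = (\<Sum>m\<in>M (d+e). c m * mon m x)" for x
  proof -
    have "f x * g x = (\<Sum>z\<in>M d \<times> M e. case z of (p,q) \<Rightarrow> a p * b q * mon (s (p,q)) x)"
      unfolding a b sum_product sum.cartesian_product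
      by (intro sum.cong) (auto simp: mon[symmetric])
    also have "\<dots> = (\<Sum>m\<in>M (d+e). \<Sum>z | z \<in> M d \<times> M e \<and> s z = m.
                      case z of (p,q) \<Rightarrow> a p * b q * mon (s (p,q)) x)"
      by (rule sum.group[symmetric]) (use fin s in auto)
    also have "\<dots> = (\<Sum>m\<in>M (d+e). c m * mon m x)"
      unfolding c_def sum_distrib_right by (intro sum.cong) auto
    finally show ?thesis .
  qed
  then show ?thesis unfolding polyfun_def M_def mon_def by blast
qed

lemma polyfun_cmult: "finite J \<Longrightarrow> polyfun J e f \<Longrightarrow> polyfun J e (\<lambda>x. k * f x)"
  using polyfun_mult[of J 0 "\<lambda>_. k" e f] by (simp add: polyfun_const)

lemma polyfun_sum:
  assumes "finite J" "\<And>i. i \<in> A \<Longrightarrow> polyfun J e (f i)"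
  shows "polyfun J e (\<lambda>x. \<Sum>i\<in>A. f i x)"
  using assms(2)
  by (induction A rule: infinite_finite_induct) (auto intro!: polyfun_add polyfun_const assms(1))

lemma polyfun_power: "finite J \<Longrightarrow> polyfun J e f \<Longrightarrow> polyfun J (n * e) (\<lambda>x. f x ^ n)"
  by (induction n) (auto intro: polyfun_const polyfun_mult)

lemma polyfun_prod:
  assumes "finite J" "finite A" "\<And>i. i \<in> A \<Longrightarrow> polyfun J (e i) (f i)"
  shows "polyfun J (\<Sum>i\<in>A. e i) (\<lambda>x. \<Prod>i\<in>A. f i x)"
  using assms(2,3)
  by (induction A rule: finite_induct) (auto intro!: polyfun_mult polyfun_const assms(1))

lemma polyfun_form:
  fixes \<psi> :: "('i \<Rightarrow> 'a::field) \<Rightarrow> 'a^'n"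
  assumes J: "finite J" and \<psi>: "\<And>i. polyfun J e (\<lambda>x. \<psi> x $ i)" and f: "form d f"
  shows "polyfun J (d * e) (\<lambda>x. f (\<psi> x))"
proof -
  obtain c where c: "\<And>x. f x = (\<Sum>m | (\<Sum>i\<in>UNIV. m i) = d. c m * (\<Prod>i\<in>UNIV. x $ i ^ m i))"
    using f unfolding form_def by blast
  have "polyfun J (d * e) (\<lambda>x. \<Prod>i\<in>UNIV. \<psi> x $ i ^ m i)" if "(\<Sum>i\<in>UNIV. m i) = d" for m
  proof -
    have "polyfun J (\<Sum>i\<in>UNIV. m i * e) (\<lambda>x. \<Prod>i\<in>UNIV. \<psi> x $ i ^ m i)"
      by (intro polyfun_prod polyfun_power J \<psi>) auto
    then show ?thesis using that by (simp add: sum_distrib_right[symmetric])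
  qed
  then show ?thesis unfolding c by (intro polyfun_sum polyfun_cmult J) auto
qed

definition poly_on :: "'i set \<Rightarrow> (('i \<Rightarrow> 'a::field) \<Rightarrow> 'a) \<Rightarrow> bool" where
  "poly_on J f \<longleftrightarrow> (\<exists>e. polyfun J e f)"

lemma poly_on_const [intro, simp]: "finite J \<Longrightarrow> poly_on J (\<lambda>x. k)"
  unfolding poly_on_def by (rule exI[of _ 0]) (rule polyfun_const)

lemma poly_on_var [intro]: "finite J \<Longrightarrow> i \<in> J \<Longrightarrow> poly_on J (\<lambda>x. x i)"
  unfolding poly_on_def by (rule exI[of _ 1]) (rule polyfun_var)

lemma poly_on_add [intro]:
  "finite J \<Longrightarrow> poly_on J f \<Longrightarrow> poly_on J g \<Longrightarrow> poly_on J (\<lambda>x. f x + g x)"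
  unfolding poly_on_def
proof (elim exE)
  fix d e assume J: "finite J" and "polyfun J d f" "polyfun J e g"
  then have "polyfun J (max d e) f" "polyfun J (max d e) g"
    by (auto intro: polyfun_mono[OF J, of d] polyfun_mono[OF J, of e])
  then show "\<exists>e. polyfun J e (\<lambda>x. f x + g x)" by (intro exI polyfun_add)
qed

lemma poly_on_mult [intro]:
  "finite J \<Longrightarrow> poly_on J f \<Longrightarrow> poly_on J g \<Longrightarrow> poly_on J (\<lambda>x. f x * g x)"
  unfolding poly_on_def by (elim exE, rule exI, rule polyfun_mult)

lemma poly_on_diff [intro]:
  assumes "finite J" "poly_on J f" "poly_on J g"
  shows "poly_on J (\<lambda>x. f x - g x)"
  using poly_on_add[OF assms(1,2) poly_on_mult[OF assms(1) poly_on_const[OF assms(1)] assms(3)], of "-1"]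
  by simp

lemma poly_on_sum [intro]:
  assumes "finite J" "\<And>i. i \<in> A \<Longrightarrow> poly_on J (f i)"
  shows "poly_on J (\<lambda>x. \<Sum>i\<in>A. f i x)"
  using assms(2)
  by (induction A rule: infinite_finite_induct) (auto intro!: poly_on_add assms(1))

lemma poly_on_prod [intro]:
  assumes "finite J" "\<And>i. i \<in> A \<Longrightarrow> poly_on J (f i)"
  shows "poly_on J (\<lambda>x. \<Prod>i\<in>A. f i x)"
  using assms(2)
  by (induction A rule: infinite_finite_induct) (auto intro!: poly_on_mult assms(1))

lemma poly_on_det [intro]:
  fixes A :: "('i \<Rightarrow> 'a::field) \<Rightarrow> 'a^'n^'n"
  assumes "finite J" "\<And>i j. poly_on J (\<lambda>x. A x $ i $ j)"
  shows "poly_on J (\<lambda>x. det (A x))"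
  unfolding det_def by (intro poly_on_sum poly_on_mult poly_on_prod poly_on_const assms)

lemma poly_on_uniform_degree:
  fixes \<psi> :: "('i \<Rightarrow> 'a::field) \<Rightarrow> 'a^'n"
  assumes "finite J" "\<And>i. poly_on J (\<lambda>x. \<psi> x $ i)"
  obtains e where "\<And>i. polyfun J e (\<lambda>x. \<psi> x $ i)"
proof -
  obtain e where "\<And>i. polyfun J (e i) (\<lambda>x. \<psi> x $ i)"
    using assms(2) unfolding poly_on_def by metis
  then have "polyfun J (Max (range e)) (\<lambda>x. \<psi> x $ i)" for i
    by (rule polyfun_mono[OF assms(1)]) simp
  then show ?thesis by (rule that)
qed

text \<open>Induction on the variables: with all but \<open>x j\<close> fixed, the sum is a
  polynomial in \<open>x j\<close> that is zero on an infinite field, so each of its coefficients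
  \<open>g k x\<close>, which do not involve \<open>x j\<close>, is zero for all
  \<open>x\<close>.\<close>

lemma polyfun_zero_coeffs:
  fixes c :: "('i \<Rightarrow> nat) \<Rightarrow> 'a::field_char_0"
  assumes "finite J" "\<And>x. (\<Sum>m\<in>J \<rightarrow>\<^sub>E {..e}. c m * (\<Prod>j\<in>J. x j ^ m j)) = 0"
    and "m \<in> J \<rightarrow>\<^sub>E {..e}"
  shows "c m = 0"
  using assms
proof (induction J arbitrary: c m rule: finite_induct)
  case empty
  then show ?case by simp
next
  case (insert j J)
  have fin: "finite (J \<rightarrow>\<^sub>E {..e})" using insert by (intro finite_PiE) auto
  define g where "g = (\<lambda>k x. \<Sum>m\<in>J \<rightarrow>\<^sub>E {..e}. c (m(j := k)) * (\<Prod>i\<in>J. x i ^ m i))"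
  have split: "(\<Sum>m\<in>insert j J \<rightarrow>\<^sub>E {..e}. c m * (\<Prod>i\<in>insert j J. x i ^ m i)) =
      (\<Sum>k\<le>e. g k x * x j ^ k)" for x
  proof -
    have inj: "inj_on (\<lambda>(y, g). g(j := y)) ({..e} \<times> (J \<rightarrow>\<^sub>E {..e}))"
      using inj_combinator[OF \<open>j \<notin> J\<close>, of "\<lambda>_. {..e}"] by (simp add: case_prod_unfold)
    have "(\<Sum>m\<in>insert j J \<rightarrow>\<^sub>E {..e}. c m * (\<Prod>i\<in>insert j J. x i ^ m i)) =
      (\<Sum>(k, m)\<in>{..e} \<times> (J \<rightarrow>\<^sub>E {..e}). c (m(j := k)) * (\<Prod>i\<in>insert j J. x i ^ (m(j := k)) i))"
      unfolding PiE_insert_eq by (subst sum.reindex[OF inj]) (simp add: case_prod_unfold)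
    also have "\<dots> = (\<Sum>k\<le>e. \<Sum>m\<in>J \<rightarrow>\<^sub>E {..e}. c (m(j := k)) * (\<Prod>i\<in>insert j J. x i ^ (m(j := k)) i))"
      by (simp add: sum.cartesian_product)
    also have "\<dots> = (\<Sum>k\<le>e. g k x * x j ^ k)"
    proof (intro sum.cong refl)
      fix k
      have "(\<Prod>i\<in>J. x i ^ (m(j := k)) i) = (\<Prod>i\<in>J. x i ^ m i)" for m
        using insert.hyps by (intro prod.cong) auto
      then show "(\<Sum>m\<in>J \<rightarrow>\<^sub>E {..e}. c (m(j := k)) * (\<Prod>i\<in>insert j J. x i ^ (m(j := k)) i)) = g k x * x j ^ k"
        using insert.hyps by (simp add: g_def sum_distrib_left ac_simps)
    qed
    finally show ?thesis .
  qed
  have g0: "g k x = 0" if "k \<le> e" for k x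
  proof -
    have g_upd: "g k (x(j := t)) = g k x" for k t
      unfolding g_def using insert.hyps by (intro sum.cong arg_cong2[where f = "(*)"] prod.cong) auto
    have "(\<Sum>k\<le>e. g k x * t ^ k) = 0" for t
      using split[of "x(j := t)"] insert.prems(1)[of "x(j := t)"] by (simp add: g_upd del: fun_upd_apply) (simp)
    then have "poly (\<Sum>k\<le>e. monom (g k x) k) t = 0" for t
      by (simp add: poly_sum poly_monom)
    then have "(\<Sum>k\<le>e. monom (g k x) k) = 0" by (simp add: poly_all_0_iff_0[symmetric])
    then have "coeff (\<Sum>k\<le>e. monom (g k x) k) k = 0" by simp
    then show ?thesis using that by (simp add: coeff_sum)
  qed
  \<comment> \<open>Exponent vectors take the value \<open>undefined\<close> outside their index
    set, so \<open>m(j := undefined)\<close> is the restriction of \<open>m\<close> to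
    \<open>J\<close>.\<close>
  have m: "m = (m(j := undefined))(j := m j)" "m j \<le> e" "m(j := undefined) \<in> J \<rightarrow>\<^sub>E {..e}"
    using insert.prems(2) insert.hyps by (auto simp: PiE_iff extensional_def)
  have "c ((m(j := undefined))(j := m j)) = 0"
    by (rule insert.IH[of "\<lambda>m'. c (m'(j := m j))", OF g0[OF m(2), unfolded g_def] m(3)])
  then show ?case by (simp only: m(1)[symmetric])
qed

section \<open>Polynomial functions of one variable and genericity along a line\<close>

definition upoly :: "('a::field \<Rightarrow> 'a) \<Rightarrow> bool" where
  "upoly f \<longleftrightarrow> (\<exists>p. \<forall>t. f t = poly p t)"

lemma upoly_const [intro, simp]: "upoly (\<lambda>t. c)"
  unfolding upoly_def by (intro exI[of _ "[:c:]"]) simp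

lemma upoly_id [intro, simp]: "upoly (\<lambda>t. t)"
  unfolding upoly_def by (intro exI[of _ "[:0, 1:]"]) simp

lemma upoly_add [intro]: "upoly f \<Longrightarrow> upoly g \<Longrightarrow> upoly (\<lambda>t. f t + g t)"
  unfolding upoly_def by (metis poly_add)

lemma upoly_diff [intro]: "upoly f \<Longrightarrow> upoly g \<Longrightarrow> upoly (\<lambda>t. f t - g t)"
  unfolding upoly_def by (metis poly_diff)

lemma upoly_mult [intro]: "upoly f \<Longrightarrow> upoly g \<Longrightarrow> upoly (\<lambda>t. f t * g t)"
  unfolding upoly_def by (metis poly_mult)

lemma upoly_power [intro]: "upoly f \<Longrightarrow> upoly (\<lambda>t. f t ^ n)"
  by (induction n) (auto intro: upoly_mult)

lemma upoly_sum [intro]: "(\<And>i. i \<in> A \<Longrightarrow> upoly (f i)) \<Longrightarrow> upoly (\<lambda>t. \<Sum>i\<in>A. f i t)"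
  by (induction A rule: infinite_finite_induct) (auto intro!: upoly_add)

lemma upoly_prod [intro]: "(\<And>i. i \<in> A \<Longrightarrow> upoly (f i)) \<Longrightarrow> upoly (\<lambda>t. \<Prod>i\<in>A. f i t)"
  by (induction A rule: infinite_finite_induct) (auto intro!: upoly_mult)

lemma upoly_det [intro]:
  fixes A :: "'a::field \<Rightarrow> 'a^'n^'n"
  assumes "\<And>i j. upoly (\<lambda>t. A t $ i $ j)"
  shows "upoly (\<lambda>t. det (A t))"
  unfolding det_def by (intro upoly_sum upoly_mult upoly_prod upoly_const assms)

lemma upoly_poly_on:
  assumes "poly_on J f" "\<And>j. j \<in> J \<Longrightarrow> upoly (\<lambda>t. \<gamma> t j)"
  shows "upoly (\<lambda>t. f (\<gamma> t))"
proof -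
  obtain e c where c: "\<And>x. f x = (\<Sum>m\<in>J \<rightarrow>\<^sub>E {..e}. c m * (\<Prod>j\<in>J. x j ^ m j))"
    using assms(1) by (auto simp: polyfun_def poly_on_def)
  show ?thesis unfolding c by (intro upoly_sum upoly_mult upoly_prod upoly_power upoly_const assms)
qed

lemma upoly_form:
  assumes "form d f" "\<And>i. upoly (\<lambda>t. \<gamma> t $ i)"
  shows "upoly (\<lambda>t. f (\<gamma> t))"
proof -
  obtain c where c: "\<And>x. f x = (\<Sum>m | (\<Sum>i\<in>UNIV. m i) = d. c m * (\<Prod>i\<in>UNIV. x $ i ^ m i))"
    using assms(1) unfolding form_def by blast
  show ?thesis unfolding c by (intro upoly_sum upoly_mult upoly_prod upoly_power upoly_const assms)
qed

lemma upoly_eq_0: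
  fixes f :: "'a::field \<Rightarrow> 'a"
  assumes "upoly f" "infinite {t. f t = 0}"
  shows "f t = 0"
proof -
  obtain p where p: "\<And>t. f t = poly p t" using assms(1) by (auto simp: upoly_def)
  then have "p = 0" using assms(2) poly_roots_finite[of p] by auto
  then show ?thesis by (simp add: p)
qed

text \<open>The genericity device. \<open>h\<close> has only finitely many roots since
  \<open>h s\<close> is nonzero, so \<open>f\<close> has infinitely many. Typically
  \<open>t = 0\<close> is the given configuration, \<open>s = 1\<close> a good one, and
  \<open>h t\<close> nonzero is the condition under which a normal form exists.\<close>

lemma upoly_eq_0_mult:
  fixes f h :: "'a::field_char_0 \<Rightarrow> 'a"
  assumes "upoly f" "upoly h" "h s \<noteq> 0" "\<And>t. h t \<noteq> 0 \<Longrightarrow> f t = 0"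
  shows "f t = 0"
proof (rule upoly_eq_0[OF assms(1)])
  have "finite {t. h t = 0}" using upoly_eq_0[OF assms(2), of s] assms(3) by blast
  then have "infinite (UNIV - {t. h t = 0})"
    using infinite_UNIV_char_0[where 'a='a] by (intro Diff_infinite_finite)
  then show "infinite {t. f t = 0}"
    by (rule contrapos_nn) (erule finite_subset[rotated], use assms(4) in auto)
qed

section \<open>Forms\<close>

lemma form_scale:
  assumes "form d f"
  shows "f (c *s x) = c ^ d * f x"
proof -
  obtain a where a: "\<And>x. f x = (\<Sum>m | (\<Sum>i\<in>UNIV. m i) = d. a m * (\<Prod>i\<in>UNIV. x $ i ^ m i))"
    using assms unfolding form_def by blast
  show ?thesis unfolding a sum_distrib_left
    by (intro sum.cong) (auto simp: power_mult_distrib prod.distrib power_sum[symmetric])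
qed

lemma form_zero: "form d (\<lambda>x. 0)"
  unfolding form_def by (intro exI[of _ "\<lambda>_. 0"]) simp

lemma form_one: "form 0 (\<lambda>x :: 'a::field^'n. 1)"
proof -
  have "{m :: 'n \<Rightarrow> nat. (\<Sum>i\<in>UNIV. m i) = 0} = {\<lambda>_. 0}" by auto
  then show ?thesis unfolding form_def by (intro exI[of _ "\<lambda>_. 1"]) simp
qed

lemma form_add:
  assumes "form d f" "form d g"
  shows "form d (\<lambda>x. f x + g x)"
proof -
  obtain a where a: "\<And>x. f x = (\<Sum>m | (\<Sum>i\<in>UNIV. m i) = d. a m * (\<Prod>i\<in>UNIV. x $ i ^ m i))"
    using assms(1) unfolding form_def by blast
  obtain b where b: "\<And>x. g x = (\<Sum>m | (\<Sum>i\<in>UNIV. m i) = d. b m * (\<Prod>i\<in>UNIV. x $ i ^ m i))"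
    using assms(2) unfolding form_def by blast
  show ?thesis unfolding form_def a b
    by (intro exI[of _ "\<lambda>m. a m + b m"]) (simp add: sum.distrib distrib_right)
qed

lemma form_cmult:
  assumes "form d f"
  shows "form d (\<lambda>x. k * f x)"
proof -
  obtain a where a: "\<And>x. f x = (\<Sum>m | (\<Sum>i\<in>UNIV. m i) = d. a m * (\<Prod>i\<in>UNIV. x $ i ^ m i))"
    using assms(1) unfolding form_def by blast
  show ?thesis unfolding form_def a
    by (intro exI[of _ "\<lambda>m. k * a m"]) (simp add: sum_distrib_left mult.assoc)
qed

lemma form_sum: "(\<And>i. i \<in> A \<Longrightarrow> form d (f i)) \<Longrightarrow> form d (\<lambda>x. \<Sum>i\<in>A. f i x)"
  by (induction A rule: infinite_finite_induct) (auto intro!: form_add form_zero)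

lemma form_power: "form d f \<Longrightarrow> form (n * d) (\<lambda>x. f x ^ n)"
  by (induction n) (auto intro: form_one form_mult)

lemma form_prod:
  assumes "finite A" "\<And>i. i \<in> A \<Longrightarrow> form (d i) (f i)"
  shows "form (\<Sum>i\<in>A. d i) (\<lambda>x. \<Prod>i\<in>A. f i x)"
  using assms by (induction A rule: finite_induct) (auto intro!: form_one form_mult)

lemma form_coordinate: "form 1 (\<lambda>x :: 'a::field^'n. x $ i)"
proof -
  let ?m = "\<lambda>j. if j = i then 1 else 0 :: nat"
  have fin: "finite {m :: 'n \<Rightarrow> nat. (\<Sum>i\<in>UNIV. m i) = 1}" by (rule finite_exponents)
  have m: "?m \<in> {m. (\<Sum>i\<in>UNIV. m i) = 1}" by simp
  have "(\<Sum>m | (\<Sum>i\<in>UNIV. m i) = 1. (if m = ?m then 1 else 0) * (\<Prod>j\<in>UNIV. x $ j ^ m j)) = x $ i"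
    for x :: "'a^'n"
  proof -
    have "(\<Sum>m | (\<Sum>i\<in>UNIV. m i) = 1. (if m = ?m then 1 else 0) * (\<Prod>j\<in>UNIV. x $ j ^ m j)) =
      (\<Sum>m | (\<Sum>i\<in>UNIV. m i) = 1. if m = ?m then (\<Prod>j\<in>UNIV. x $ j ^ m j) else 0)"
      by (intro sum.cong) auto
    also have "\<dots> = (\<Prod>j\<in>UNIV. x $ j ^ ?m j)"
      by (subst sum.delta[OF fin]) (use m in simp)
    also have "\<dots> = (\<Prod>j\<in>UNIV. if j = i then x $ j else 1)" by (intro prod.cong) auto
    also have "\<dots> = x $ i" by simp
    finally show ?thesis .
  qed
  then show ?thesis unfolding form_def by (intro exI[of _ "\<lambda>m. if m = ?m then 1 else 0"]) simp
qed

section \<open>Points and vanishing\<close>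

lemma proj_space_iff: "L \<in> proj_space \<longleftrightarrow> (\<exists>x. x \<noteq> 0 \<and> L = vec.span {x})"
proof
  assume "L \<in> proj_space"
  then have L: "vec.subspace L" "vec.dim L = 1" by (auto simp: grassmannian_def)
  obtain B where B: "B \<subseteq> L" "vec.independent B" "L \<subseteq> vec.span B" "card B = 1"
    using vec.basis_exists[of L] L by metis
  then obtain x where x: "B = {x}" by (auto simp: card_1_singleton_iff)
  then have "x \<noteq> 0" using B(2) vec.dependent_zero[of B] by auto
  moreover have "L = vec.span {x}" using B L x vec.span_minimal[of "{x}" L] by blast
  ultimately show "\<exists>x. x \<noteq> 0 \<and> L = vec.span {x}" by blast
next
  assume "\<exists>x. x \<noteq> 0 \<and> L = vec.span {x}"
  then show "L \<in> proj_space"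
    by (auto simp: grassmannian_def vec.dim_eq_card_independent)
qed

definition vanishes :: "('a::field^'n \<Rightarrow> 'a) \<Rightarrow> ('a^'n) set set \<Rightarrow> bool" where
  "vanishes f S \<longleftrightarrow> (\<forall>L\<in>S. \<forall>x\<in>L. f x = 0)"

lemma vanishes_mono: "vanishes f T \<Longrightarrow> S \<subseteq> T \<Longrightarrow> vanishes f S"
  unfolding vanishes_def by blast

lemma form_zero_on_line:
  assumes "form d f"
  shows "(\<forall>y\<in>vec.span {x}. f y = 0) \<longleftrightarrow> f x = 0"
  using form_scale[OF assms] vec.span_base[of x "{x}"] by (auto simp: vec.span_singleton)

lemma in_proj_zeros_iff: "L \<in> proj_zeros F \<longleftrightarrow> L \<in> proj_space \<and> (\<forall>f\<in>F. vanishes f {L})"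
  by (auto simp: proj_zeros_def vanishes_def)

lemma closedin_sub_zariski_iff:
  assumes "X \<subseteq> proj_space"
  shows "closedin (subtopology zariski X) Z \<longleftrightarrow>
    (\<exists>F. (\<forall>f\<in>F. \<exists>d. form d f) \<and> Z = {L\<in>X. \<forall>f\<in>F. vanishes f {L}})"
proof -
  have *: "proj_zeros F \<inter> X = {L\<in>X. \<forall>f\<in>F. vanishes f {L}}" for F
    using assms by (auto simp only: in_proj_zeros_iff)
  show ?thesis
    unfolding closedin_subtopology closedin_zariski *[symmetric] by blast
qed

text \<open>The zero sets of \<open>f\<close> and \<open>g\<close> are closed and cover
  \<open>Z\<close>: by homogeneity, vanishing on a line can be tested at one spanning vector, where
  one of the two factors must be zero.\<close>

lemma irreducible_no_zero_divisors:
  assumes X: "X \<subseteq> proj_space" and Z: "irreducible_in (subtopology zariski X) Z"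
    and f: "form d f" and g: "form e g" and van: "vanishes (\<lambda>x. f x * g x) Z"
  shows "vanishes f Z \<or> vanishes g Z"
proof -
  have ZX: "Z \<subseteq> X" using Z by (auto simp: irreducible_in_def)
  define A where "A = (\<lambda>f. {L\<in>X. \<forall>f\<in>{f}. vanishes f {L}})"
  have closed: "closedin (subtopology zariski X) (A f)" if "form d f" for d f
    unfolding A_def closedin_sub_zariski_iff[OF X] using that by blast
  have "L \<in> A f \<union> A g" if L: "L \<in> Z" for L
  proof -
    obtain x where x: "L = vec.span {x}" using L ZX X proj_space_iff by blast
    then have "f x * g x = 0" using van L vec.span_base[of x "{x}"] by (auto simp: vanishes_def)
    then have "f x = 0 \<or> g x = 0" by simp
    then show ?thesis
      using form_zero_on_line[OF f, of x] form_zero_on_line[OF g, of x] L ZX x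
      by (auto simp: A_def vanishes_def)
  qed
  then have "Z \<subseteq> A f \<union> A g" by blast
  then have "Z \<subseteq> A f \<or> Z \<subseteq> A g"
    using Z closed[OF f] closed[OF g] by (auto simp: irreducible_in_def)
  then show ?thesis by (auto simp: A_def vanishes_def)
qed

lemma irreducible_power_cancel:
  assumes X: "X \<subseteq> proj_space" and Z: "irreducible_in (subtopology zariski X) Z"
    and f: "form d f" and g: "form e g" and van: "vanishes (\<lambda>x. f x ^ n * g x) Z"
    and "\<not> vanishes f Z"
  shows "vanishes g Z"
  using irreducible_no_zero_divisors[OF X Z form_power[OF f] g van] \<open>\<not> vanishes f Z\<close>
  by (auto simp: vanishes_def)

section \<open>Chains of irreducible sets and the upper bound for the dimension\<close>

text \<open>Linear independence of the first \<open>N\<close> members of \<open>G\<close> as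
  functions on the cone over \<open>Z\<close>, that is, modulo the functions vanishing
  there.\<close>

definition independent_on :: "('a::field^'n) set set \<Rightarrow> nat \<Rightarrow> (nat \<Rightarrow> 'a^'n \<Rightarrow> 'a) \<Rightarrow> bool" where
  "independent_on Z N G \<longleftrightarrow>
    (\<forall>c. vanishes (\<lambda>x. \<Sum>k<N. c k * G k x) Z \<longrightarrow> (\<forall>k<N. c k = 0))"

lemma independent_onD:
  "independent_on Z N G \<Longrightarrow> vanishes (\<lambda>x. \<Sum>k<N. c k * G k x) Z \<Longrightarrow> k < N \<Longrightarrow> c k = 0"
  unfolding independent_on_def by (elim allE[of _ c] impE) auto

lemma separating_form:
  assumes X: "X \<subseteq> proj_space" and "closedin (subtopology zariski X) Y" "Z \<subseteq> X" "Y \<subset> Z"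
  obtains d f where "form d f" "vanishes f Y" "\<not> vanishes f Z"
proof -
  obtain F where F: "\<forall>f\<in>F. \<exists>d. form d f" "Y = {L\<in>X. \<forall>f\<in>F. vanishes f {L}}"
    using assms(2) unfolding closedin_sub_zariski_iff[OF X] by blast
  obtain L where "L \<in> Z" "L \<notin> Y" using \<open>Y \<subset> Z\<close> by blast
  then obtain f where f: "f \<in> F" "\<not> vanishes f {L}" using F assms by blast
  have "vanishes f Y" using F(2) f(1) by (auto simp: vanishes_def)
  moreover have "\<not> vanishes f Z" using f(2) \<open>L \<in> Z\<close> by (auto simp: vanishes_def)
  ultimately show ?thesis using F(1) f(1) that by blast
qed

lemma nonvanishing_coordinate:
  assumes "Z \<subseteq> proj_space" "Z \<noteq> {}"
  obtains i where "\<not> vanishes (\<lambda>x. x $ i) Z"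
proof -
  obtain L x where "L \<in> Z" "x \<noteq> 0" "L = vec.span {x}" using assms proj_space_iff by blast
  moreover from this obtain i where "x $ i \<noteq> 0" by (auto simp: vec_eq_iff)
  ultimately show ?thesis using that vec.span_base[of x "{x}"] by (auto simp: vanishes_def)
qed

text \<open>
  Multiplying independent forms on \<open>Z n\<close> by the powers of a form that vanishes on \<open>Z n\<close> but not on
  the irreducible \<open>Z (n + 1)\<close> gives independent forms on \<open>Z (n + 1)\<close>; powers of a coordinate
  equalise the degrees.
\<close>

lemma chain_independent_forms:
  fixes X :: "('a::field^'n) set set"
  assumes X: "X \<subseteq> proj_space"
    and Z: "\<And>i. i \<le> n \<Longrightarrow> closedin (subtopology zariski X) (Z i)"
      "\<And>i. i \<le> n \<Longrightarrow> irreducible_in (subtopology zariski X) (Z i)"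
    and chain: "\<And>i. i < n \<Longrightarrow> Z i \<subset> Z (Suc i)"
  shows "\<exists>E. \<forall>B. \<exists>G. (\<forall>k. form (E * B) (G k)) \<and> independent_on (Z n) ((B + 1) ^ n) G"
  using Z chain
proof (induction n)
  case 0
  have Z0: "Z 0 \<subseteq> X" "Z 0 \<noteq> {}" using 0(2)[of 0] by (auto simp: irreducible_in_def)
  then obtain i where i: "\<not> vanishes (\<lambda>x. x $ i) (Z 0)"
    using nonvanishing_coordinate X by (metis subset_trans)
  show ?case
  proof (intro exI[of _ 1] allI)
    fix B
    have "form (1 * B) (\<lambda>x :: 'a^'n. x $ i ^ B)"
      using form_power[OF form_coordinate, of B] by simp
    moreover have "independent_on (Z 0) ((B + 1) ^ 0) (\<lambda>k x. x $ i ^ B)"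
      using i by (auto simp: vanishes_def independent_on_def)
    ultimately show "\<exists>G. (\<forall>k. form (1 * B) (G k)) \<and> independent_on (Z 0) ((B + 1) ^ 0) G"
      by (intro exI[of _ "\<lambda>k x. x $ i ^ B"]) simp
  qed
next
  case (Suc n)
  obtain E where E: "\<And>B. \<exists>G. (\<forall>k. form (E * B) (G k)) \<and> independent_on (Z n) ((B + 1) ^ n) G"
    using Suc.IH[OF Suc.prems(1)[OF le_SucI] Suc.prems(2)[OF le_SucI] Suc.prems(3)[OF less_SucI]]
    by auto
  have irr: "irreducible_in (subtopology zariski X) (Z n)"
    "irreducible_in (subtopology zariski X) (Z (Suc n))" using Suc.prems(2) by auto
  then have ZX: "Z n \<subseteq> X" "Z n \<noteq> {}" "Z (Suc n) \<subseteq> X" by (auto simp: irreducible_in_def)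
  have sub: "Z n \<subset> Z (Suc n)" using Suc.prems(3) by simp
  obtain d f where f: "form d f" "vanishes f (Z n)" "\<not> vanishes f (Z (Suc n))"
    using separating_form[OF X Suc.prems(1) ZX(3) sub] by auto
  obtain i where i: "\<not> vanishes (\<lambda>x. x $ i) (Z n)"
    using nonvanishing_coordinate[of "Z n"] X ZX by (metis subset_trans)
  define h where "h = (\<lambda>x :: 'a^'n. x $ i ^ d)"
  have h: "form d h" "\<not> vanishes h (Z n)"
    unfolding h_def using form_power[OF form_coordinate, of d] i by (auto simp: vanishes_def)
  show ?case
  proof (intro exI[of _ "d + E"] allI)
    fix B
    obtain G where G: "\<And>k. form (E * B) (G k)"
      "independent_on (Z n) ((B + 1) ^ n) G"
      using E[of B] by blast
    let ?R = "(B + 1) ^ n"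
    \<comment> \<open>The index \<open>k\<close> encodes the pair of
      \<open>q = k div (B + 1)\<close> and \<open>r = k mod (B + 1)\<close>. The factor
      \<open>h ^ (B - r)\<close> compensates for \<open>f ^ r\<close>, so that all products have the
      same degree.\<close>
    define G' where "G' = (\<lambda>k x. f x ^ (k mod (B + 1)) * h x ^ (B - k mod (B + 1)) * G (k div (B + 1)) x)"
    have "form ((d + E) * B) (G' k)" for k
    proof -
      let ?r = "k mod (B + 1)"
      have "?r \<le> B" using mod_less_divisor[of "B + 1" k] by simp
      then have "?r * d + (B - ?r) * d = B * d" by (simp add: distrib_right[symmetric])
      then have eq: "(d + E) * B = ?r * d + (B - ?r) * d + E * B" by (simp add: algebra_simps)
      show ?thesis unfolding G'_def eq by (intro form_mult form_power f h G)
    qed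
    moreover have "\<forall>k<(B + 1) ^ Suc n. c k = 0"
      if van: "vanishes (\<lambda>x. \<Sum>k<(B + 1) ^ Suc n. c k * G' k x) (Z (Suc n))" for c
    proof -
      define S where "S = (\<lambda>r x. \<Sum>q<?R. c (q * (B + 1) + r) * G q x)"
      have S: "form (E * B) (S r)" for r
        unfolding S_def by (intro form_sum form_cmult G)
      have expand: "(\<Sum>k<(B + 1) ^ Suc n. c k * G' k x) = (\<Sum>r<B + 1. f x ^ r * h x ^ (B - r) * S r x)" for x
      proof -
        have "(\<Sum>k<(B + 1) ^ Suc n. c k * G' k x) = (\<Sum>k<?R * (B + 1). c k * G' k x)"
          by (simp add: mult.commute)
        also have "\<dots> = (\<Sum>q<?R. \<Sum>k = q * (B + 1)..<q * (B + 1) + (B + 1). c k * G' k x)"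
          by (rule sum.nat_group[symmetric])
        also have "\<dots> = (\<Sum>q<?R. \<Sum>r<B + 1. c (q * (B + 1) + r) * (f x ^ r * h x ^ (B - r) * G q x))"
        proof (rule sum.cong[OF refl])
          fix q
          have "(\<Sum>k = q * (B + 1)..<q * (B + 1) + (B + 1). c k * G' k x) =
              (\<Sum>r<B + 1. c (q * (B + 1) + r) * G' (q * (B + 1) + r) x)"
            using sum.shift_bounds_nat_ivl[of "\<lambda>k. c k * G' k x" 0 "q * (B + 1)" "B + 1"]
            by (simp add: atLeast0LessThan add.commute)
          also have "\<dots> = (\<Sum>r<B + 1. c (q * (B + 1) + r) * (f x ^ r * h x ^ (B - r) * G q x))"
          proof (intro sum.cong refl)
            fix r assume "r \<in> {..<B + 1}"
            then have "(q * (B + 1) + r) mod (B + 1) = r" "(q * (B + 1) + r) div (B + 1) = q"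
              by (auto simp: mod_mult_self3 div_mult_self3 simp del: mult_Suc_right)
            then show "c (q * (B + 1) + r) * G' (q * (B + 1) + r) x =
               c (q * (B + 1) + r) * (f x ^ r * h x ^ (B - r) * G q x)"
              by (simp only: G'_def)
          qed
          finally show "(\<Sum>k = q * (B + 1)..<q * (B + 1) + (B + 1). c k * G' k x) =
             (\<Sum>r<B + 1. c (q * (B + 1) + r) * (f x ^ r * h x ^ (B - r) * G q x))" .
        qed
        also have "\<dots> = (\<Sum>r<B + 1. f x ^ r * h x ^ (B - r) * S r x)"
          unfolding S_def sum_distrib_left by (subst sum.swap) (intro sum.cong refl, simp)
        finally show ?thesis .
      qed
      \<comment> \<open>Once the blocks below \<open>r\<close> are known to be zero, the relation is
        \<open>f ^ r * H\<close>. On the larger set \<open>f ^ r\<close> cancels; on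
        \<open>Z n\<close>, where \<open>f\<close> is zero, \<open>H\<close> reduces to
        \<open>h ^ (B - r) * S r\<close>. There \<open>h\<close> cancels as well, and the
        independence of \<open>G\<close> applies to \<open>S r\<close>.\<close>
      have zero: "\<forall>q<?R. c (q * (B + 1) + r) = 0" if "r \<le> B" for r
        using that
      proof (induction r rule: less_induct)
        case (less r)
        define H where "H = (\<lambda>x. \<Sum>r'\<in>{r..<B + 1}. f x ^ (r' - r) * h x ^ (B - r') * S r' x)"
        have "form ((B - r) * d + E * B) (\<lambda>x. f x ^ (r' - r) * h x ^ (B - r') * S r' x)"
          if "r' \<in> {r..<B + 1}" for r'
        proof -
          have "B - r = (r' - r) + (B - r')" using that by auto
          then have eq: "(B - r) * d + E * B = (r' - r) * d + (B - r') * d + E * B"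
            by (simp only: distrib_right)
          show ?thesis unfolding eq by (intro form_mult form_power f h S)
        qed
        then have H: "form ((B - r) * d + E * B) H" unfolding H_def by (rule form_sum)
        have "(\<Sum>k<(B + 1) ^ Suc n. c k * G' k x) = f x ^ r * H x" for x
        proof -
          have "S r' x = 0" if "r' < r" for r'
            using less.IH[of r'] less.prems that by (simp add: S_def)
          then have "(\<Sum>r'<B + 1. f x ^ r' * h x ^ (B - r') * S r' x) =
              (\<Sum>r'\<in>{r..<B + 1}. f x ^ r' * h x ^ (B - r') * S r' x)"
            using less.prems by (intro sum.mono_neutral_right) auto
          also have "\<dots> = f x ^ r * H x"
            unfolding H_def sum_distrib_left
            by (intro sum.cong refl) (simp add: mult.assoc[symmetric] power_add[symmetric])
          finally show ?thesis unfolding expand .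
        qed
        then have "vanishes (\<lambda>x. f x ^ r * H x) (Z (Suc n))" using van by simp
        from irreducible_power_cancel[OF X irr(2) f(1) H this f(3)]
        have "vanishes H (Z n)" using sub vanishes_mono by blast
        moreover have "H x = h x ^ (B - r) * S r x" if "f x = 0" for x
        proof -
          have "H x = (\<Sum>r'\<in>{r}. f x ^ (r' - r) * h x ^ (B - r') * S r' x)"
            unfolding H_def using that less.prems by (intro sum.mono_neutral_right) auto
          then show ?thesis by simp
        qed
        ultimately have "vanishes (\<lambda>x. h x ^ (B - r) * S r x) (Z n)"
          using f(2) by (auto simp: vanishes_def)
        from irreducible_power_cancel[OF X irr(1) h(1) S this h(2)]
        show ?case using G(2) unfolding S_def independent_on_def by fast
      qed
      show ?thesis
      proof (intro allI impI)
        fix k assume "k < (B + 1) ^ Suc n"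
        then have "k div (B + 1) < ?R" by (simp add: less_mult_imp_div_less mult.commute)
        moreover have "k mod (B + 1) \<le> B" using mod_less_divisor[of "B + 1" k] by simp
        ultimately have "c (k div (B + 1) * (B + 1) + k mod (B + 1)) = 0" using zero by blast
        then show "c k = 0" by (simp only: div_mult_mod_eq)
      qed
    qed
    ultimately show "\<exists>G. (\<forall>k. form ((d + E) * B) (G k)) \<and>
      independent_on (Z (Suc n)) ((B + 1) ^ Suc n) G"
      unfolding independent_on_def by (intro exI[of _ G'] conjI allI impI) simp_all
  qed
qed

text \<open>The hypothesis \<open>dense\<close> only transports vanishing from the image of
  \<open>\<psi>\<close> to \<open>X\<close>. Thus the parametrization may pass through the zero
  vector and may leave \<open>X\<close>.\<close>

theorem krull_dim_le_parameters:
  fixes X :: "('a::field^'n) set set" and \<psi> :: "('i \<Rightarrow> 'a) \<Rightarrow> 'a^'n"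
  assumes X: "X \<subseteq> proj_space" and J: "finite J" and \<psi>: "\<And>i. poly_on J (\<lambda>x. \<psi> x $ i)"
    and dense: "\<And>d f. form d f \<Longrightarrow> (\<And>x. f (\<psi> x) = 0) \<Longrightarrow> vanishes f X"
  shows "krull_dim (subtopology zariski X) \<le> enat (card J)"
proof -
  have "n \<le> card J"
    if Z: "\<And>i. i \<le> n \<Longrightarrow> closedin (subtopology zariski X) (Z i)"
      "\<And>i. i \<le> n \<Longrightarrow> irreducible_in (subtopology zariski X) (Z i)"
      and chain: "\<And>i. i < n \<Longrightarrow> Z i \<subset> Z (Suc i)" for n Z
  proof (rule ccontr)
    assume "\<not> n \<le> card J"
    then have n: "card J < n" by simp
    obtain e where e: "\<And>i. polyfun J e (\<lambda>x. \<psi> x $ i)"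
      using poly_on_uniform_degree[OF J \<psi>] by blast
    obtain E where E: "\<And>B. \<exists>G. (\<forall>k. form (E * B) (G k)) \<and> independent_on (Z n) ((B + 1) ^ n) G"
      using chain_independent_forms[of X n Z, OF X Z chain] by blast
    \<comment> \<open>On the left stands the number of monomials available to the pulled back forms,
      whose degree in each variable is at most \<open>E * B * e\<close>; on the right, the number of
      independent forms.\<close>
    obtain B where B: "(E * e * B + 1) ^ card J < (B + 1) ^ n"
      using exists_power_gap[OF n] by blast
    obtain G where G: "\<And>k. form (E * B) (G k)"
      "independent_on (Z n) ((B + 1) ^ n) G"
      using E[of B] by blast
    let ?D = "E * B * e"
    have "\<exists>M. \<forall>x. G k (\<psi> x) = (\<Sum>m\<in>J \<rightarrow>\<^sub>E {..?D}. M m * (\<Prod>j\<in>J. x j ^ m j))" for k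
      using polyfun_form[OF J e G(1)] unfolding polyfun_def .
    then obtain M where M: "\<And>k x. G k (\<psi> x) = (\<Sum>m\<in>J \<rightarrow>\<^sub>E {..?D}. M k m * (\<Prod>j\<in>J. x j ^ m j))"
      by metis
    have fin: "finite (J \<rightarrow>\<^sub>E {..?D})" using J by (intro finite_PiE) auto
    have "card (J \<rightarrow>\<^sub>E {..?D}) < card {..<(B + 1) ^ n}"
      using B J by (simp add: card_PiE ac_simps)
    then obtain c where c: "\<exists>k<(B + 1) ^ n. c k \<noteq> 0"
      "\<And>m. m \<in> J \<rightarrow>\<^sub>E {..?D} \<Longrightarrow> (\<Sum>k<(B + 1) ^ n. c k * M k m) = 0"
      using nontrivial_relation[OF fin, of "{..<(B + 1) ^ n}" M] by auto
    have "(\<Sum>k<(B + 1) ^ n. c k * G k (\<psi> x)) = 0" for x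
    proof -
      have "(\<Sum>k<(B + 1) ^ n. c k * G k (\<psi> x)) =
          (\<Sum>m\<in>J \<rightarrow>\<^sub>E {..?D}. (\<Sum>k<(B + 1) ^ n. c k * M k m) * (\<Prod>j\<in>J. x j ^ m j))"
        unfolding M sum_distrib_left sum_distrib_right
        by (subst sum.swap) (simp add: mult.assoc)
      then show ?thesis using c(2) by simp
    qed
    moreover have "form (E * B) (\<lambda>x. \<Sum>k<(B + 1) ^ n. c k * G k x)"
      by (intro form_sum form_cmult G)
    ultimately have "vanishes (\<lambda>x. \<Sum>k<(B + 1) ^ n. c k * G k x) X" using dense by blast
    moreover have "Z n \<subseteq> X" using Z(2)[of n] by (auto simp: irreducible_in_def)
    ultimately have "vanishes (\<lambda>x. \<Sum>k<(B + 1) ^ n. c k * G k x) (Z n)" by (rule vanishes_mono)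
    from independent_onD[OF G(2) this] show False using c(1) by blast
  qed
  then show ?thesis
    unfolding krull_dim_def by (intro Sup_least) (auto; metis)
qed

section \<open>Closures of images and the lower bound for the dimension\<close>

lemma poly_on_power [intro]: "finite J \<Longrightarrow> poly_on J f \<Longrightarrow> poly_on J (\<lambda>x. f x ^ n)"
  by (induction n) (auto intro: poly_on_mult)

lemma poly_on_comp:
  assumes K: "finite K" and f: "poly_on J f" and \<sigma>: "\<And>j. j \<in> J \<Longrightarrow> poly_on K (\<lambda>x. \<sigma> x j)"
  shows "poly_on K (\<lambda>x. f (\<sigma> x))"
proof -
  obtain e c where c: "\<And>x. f x = (\<Sum>m\<in>J \<rightarrow>\<^sub>E {..e}. c m * (\<Prod>j\<in>J. x j ^ m j))"
    using f by (auto simp: polyfun_def poly_on_def)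
  show ?thesis unfolding c
    by (intro poly_on_sum poly_on_mult poly_on_prod poly_on_power poly_on_const K \<sigma>)
qed

lemma poly_on_form:
  fixes \<psi> :: "('i \<Rightarrow> 'a::field) \<Rightarrow> 'a^'n"
  assumes J: "finite J" and \<psi>: "\<And>i. poly_on J (\<lambda>x. \<psi> x $ i)" and f: "form d f"
  shows "poly_on J (\<lambda>x. f (\<psi> x))"
proof -
  obtain e where "\<And>i. polyfun J e (\<lambda>x. \<psi> x $ i)" using poly_on_uniform_degree[OF J \<psi>] by blast
  then show ?thesis using polyfun_form[OF J _ f] unfolding poly_on_def by blast
qed

text \<open>The Zariski closure in \<open>S\<close> of the points spanned by the vectors
  \<open>\<psi> x\<close>, expressed directly by the forms that vanish along
  \<open>\<psi>\<close>.\<close>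

definition image_closure :: "('a::field^'n) set set \<Rightarrow> ('x \<Rightarrow> 'a^'n) \<Rightarrow> ('a^'n) set set" where
  "image_closure S \<psi> = {L\<in>S. \<forall>f. (\<exists>d. form d f) \<and> (\<forall>x. f (\<psi> x) = 0) \<longrightarrow> vanishes f {L}}"

lemma closedin_image_closure:
  assumes "S \<subseteq> proj_space"
  shows "closedin (subtopology zariski S) (image_closure S \<psi>)"
  unfolding closedin_sub_zariski_iff[OF assms] image_closure_def
  by (intro exI[of _ "{f. (\<exists>d. form d f) \<and> (\<forall>x. f (\<psi> x) = 0)}"]) auto

lemma image_in_closure:
  assumes "\<And>x. vec.span {\<psi> x} \<in> S"
  shows "vec.span {\<psi> x} \<in> image_closure S \<psi>"
  unfolding image_closure_def vanishes_def using assms form_zero_on_line by fastforce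

lemma vanishes_image_closure:
  assumes "\<And>x. vec.span {\<psi> x} \<in> S" "form d f"
  shows "vanishes f (image_closure S \<psi>) \<longleftrightarrow> (\<forall>x. f (\<psi> x) = 0)"
proof
  assume "vanishes f (image_closure S \<psi>)"
  then show "\<forall>x. f (\<psi> x) = 0"
    using image_in_closure[of \<psi> S, OF assms(1)] form_zero_on_line[OF assms(2)]
    unfolding vanishes_def by blast
next
  assume "\<forall>x. f (\<psi> x) = 0"
  then show "vanishes f (image_closure S \<psi>)"
    using assms(2) unfolding image_closure_def vanishes_def by blast
qed

text \<open>An affine space is irreducible, and so is its image. If the closed sets \<open>A\<close>
  and \<open>B\<close> covered the image without either containing it, forms \<open>f\<close> and
  \<open>g\<close> would witness this at parameters \<open>x\<close> and \<open>y\<close>. On the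
  line through \<open>x\<close> and \<open>y\<close> the product of the two pulled back polynomials
  is zero, yet neither factor is.\<close>

lemma irreducible_image_closure:
  fixes \<psi> :: "('i \<Rightarrow> 'a::field_char_0) \<Rightarrow> 'a^'n"
  assumes S: "S \<subseteq> proj_space" and J: "finite J"
    and \<psi>: "\<And>i. poly_on J (\<lambda>x. \<psi> x $ i)" and in_S: "\<And>x. vec.span {\<psi> x} \<in> S"
  shows "irreducible_in (subtopology zariski S) (image_closure S \<psi>)"
proof -
  let ?Z = "image_closure S \<psi>"
  have witness: "\<exists>d f. form d f \<and> vanishes f A \<and> (\<exists>x. f (\<psi> x) \<noteq> 0)"
    if "closedin (subtopology zariski S) A" "\<not> ?Z \<subseteq> A" for A
  proof -
    obtain F where F: "\<forall>f\<in>F. \<exists>d. form d f" "A = {L\<in>S. \<forall>f\<in>F. vanishes f {L}}"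
      using \<open>closedin (subtopology zariski S) A\<close> unfolding closedin_sub_zariski_iff[OF S] by blast
    obtain L where "L \<in> ?Z" "L \<notin> A" using \<open>\<not> ?Z \<subseteq> A\<close> by blast
    then obtain f where f: "f \<in> F" "\<not> vanishes f {L}" using F by (auto simp: image_closure_def)
    moreover obtain d where d: "form d f" using f F by blast
    ultimately have "\<not> vanishes f ?Z" using \<open>L \<in> ?Z\<close> by (auto simp: vanishes_def)
    then have "\<exists>x. f (\<psi> x) \<noteq> 0" using vanishes_image_closure[of \<psi> S _ f, OF in_S d] by blast
    moreover have "vanishes f A" using F f by (auto simp: vanishes_def)
    ultimately show ?thesis using d by blast
  qed
  show ?thesis unfolding irreducible_in_def
  proof (intro conjI allI impI)
    show "?Z \<subseteq> topspace (subtopology zariski S)"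
      using S by (auto simp: topspace_zariski image_closure_def)
    show "?Z \<noteq> {}" using image_in_closure[of \<psi> S, OF in_S] by blast
    fix A B
    assume AB: "closedin (subtopology zariski S) A \<and> closedin (subtopology zariski S) B \<and> ?Z \<subseteq> A \<union> B"
    show "?Z \<subseteq> A \<or> ?Z \<subseteq> B"
    proof (rule ccontr)
      assume neg: "\<not> (?Z \<subseteq> A \<or> ?Z \<subseteq> B)"
      obtain d f x where f: "form d f" "vanishes f A" "f (\<psi> x) \<noteq> 0" using witness AB neg by blast
      obtain e g y where g: "form e g" "vanishes g B" "g (\<psi> y) \<noteq> 0" using witness AB neg by blast
      define z where "z = (\<lambda>t i. x i + t * (y i - x i))"
      have up: "upoly (\<lambda>t. f (\<psi> (z t)))" if "form d f" for d f
        by (rule upoly_poly_on[OF poly_on_form[OF J \<psi> that]]) (auto simp: z_def intro!: upoly_add upoly_mult)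
      have "f (\<psi> (z t)) * g (\<psi> (z t)) = 0" for t
      proof -
        have "vec.span {\<psi> (z t)} \<in> A \<union> B" using AB image_in_closure[of \<psi> S, OF in_S] by blast
        then show ?thesis
          using f(2) g(2) vec.span_base[of "\<psi> (z t)" "{\<psi> (z t)}"] by (auto simp: vanishes_def)
      qed
      moreover have "z 0 = x" "z 1 = y" by (auto simp: z_def)
      ultimately have "f (\<psi> (z 0)) = 0"
        using upoly_eq_0_mult[OF up[OF f(1)] up[OF g(1)], of 1] g(3) by auto
      then show False using f(3) \<open>z 0 = x\<close> by simp
    qed
  qed
qed

lemma image_closure_mono: "range \<phi> \<subseteq> range \<psi> \<Longrightarrow> image_closure S \<phi> \<subseteq> image_closure S \<psi>"
  unfolding image_closure_def
  by (rule Collect_mono) (metis (no_types, lifting) rangeI rangeE subsetD)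

text \<open>
  The terms of lowest degree of a relation between the \<open>q j\<close> would be a relation between the
  parameters themselves.
\<close>

lemma independent_first_order:
  fixes \<psi> :: "('i \<Rightarrow> 'a::field_char_0) \<Rightarrow> 'a^'n"
  assumes K: "finite K"
    and jet: "\<And>v j. j \<in> K \<Longrightarrow> (\<And>i. i \<notin> K \<Longrightarrow> v i = 0) \<Longrightarrow>
      \<exists>p. (\<forall>t. q j (\<psi> (\<lambda>i. t * v i)) = poly p t) \<and> coeff p 0 = 0 \<and> coeff p 1 = v j"
    and zero: "\<And>x. (\<And>i. i \<notin> K \<Longrightarrow> x i = 0) \<Longrightarrow>
      (\<Sum>a\<in>K \<rightarrow>\<^sub>E {..B}. c a * (\<Prod>j\<in>K. q j (\<psi> x) ^ a j)) = 0"
    and a: "a \<in> K \<rightarrow>\<^sub>E {..B}"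
  shows "c a = 0"
  using a
proof (induction "\<Sum>j\<in>K. a j" arbitrary: a rule: less_induct)
  case less
  let ?A = "K \<rightarrow>\<^sub>E {..B}"
  define s where "s = (\<Sum>j\<in>K. a j)"
  have fin: "finite ?A" using K by (intro finite_PiE) auto
  define c' where "c' = (\<lambda>b. if (\<Sum>j\<in>K. b j) = s then c b else 0)"
  have "(\<Sum>b\<in>?A. c' b * (\<Prod>j\<in>K. x j ^ b j)) = 0" for x
  proof -
    define v where "v = (\<lambda>i. if i \<in> K then x i else 0)"
    have "\<exists>p. (\<forall>t. q j (\<psi> (\<lambda>i. t * v i)) = t * poly p t) \<and> poly p 0 = v j" if j: "j \<in> K" for j
    proof -
      obtain p where p: "\<forall>t. q j (\<psi> (\<lambda>i. t * v i)) = poly p t" "coeff p 0 = 0" "coeff p 1 = v j"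
        using jet[OF j, of v] by (auto simp: v_def)
      obtain a0 p' where p': "p = pCons a0 p'" by (cases p)
      then have "a0 = 0" "poly p' 0 = v j" using p by (auto simp: poly_0_coeff_0)
      then show ?thesis using p p' by (intro exI[of _ p']) simp
    qed
    then obtain r where r: "\<And>j t. j \<in> K \<Longrightarrow> q j (\<psi> (\<lambda>i. t * v i)) = t * poly (r j) t"
      "\<And>j. j \<in> K \<Longrightarrow> poly (r j) 0 = v j" by metis
    \<comment> \<open>\<open>R\<close> is the relation along the line \<open>t * v\<close>, divided
      by \<open>t ^ s\<close>; the terms of total degree below \<open>s\<close> have zero
      coefficients by induction. Its value at 0 is the part of degree \<open>s\<close>, evaluated at
      \<open>v\<close>.\<close>
    define R where "R = (\<Sum>b\<in>?A. if (\<Sum>j\<in>K. b j) < s then 0 else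
        [:c b:] * monom 1 ((\<Sum>j\<in>K. b j) - s) * (\<Prod>j\<in>K. r j ^ b j))"
    have "poly R t = 0" if "t \<noteq> 0" for t
    proof -
      have "t ^ s * poly R t = (\<Sum>b\<in>?A. c b * (\<Prod>j\<in>K. q j (\<psi> (\<lambda>i. t * v i)) ^ b j))"
        unfolding R_def poly_sum sum_distrib_left
      proof (intro sum.cong refl)
        fix b assume b: "b \<in> ?A"
        have prod: "(\<Prod>j\<in>K. q j (\<psi> (\<lambda>i. t * v i)) ^ b j) = t ^ (\<Sum>j\<in>K. b j) * (\<Prod>j\<in>K. poly (r j) t ^ b j)"
          by (simp add: r(1) power_mult_distrib prod.distrib power_sum)
        show "t ^ s * poly (if (\<Sum>j\<in>K. b j) < s then 0 else
            [:c b:] * monom 1 ((\<Sum>j\<in>K. b j) - s) * (\<Prod>j\<in>K. r j ^ b j)) t =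
          c b * (\<Prod>j\<in>K. q j (\<psi> (\<lambda>i. t * v i)) ^ b j)"
        proof (cases "(\<Sum>j\<in>K. b j) < s")
          case True
          then have "c b = 0" using less.hyps[of b] b by (simp add: s_def)
          then show ?thesis using True by simp
        next
          case False
          then have "t ^ (\<Sum>j\<in>K. b j) = t ^ s * t ^ ((\<Sum>j\<in>K. b j) - s)"
            by (simp add: power_add[symmetric])
          then show ?thesis using False by (simp add: prod poly_monom poly_prod)
        qed
      qed
      also have "\<dots> = 0" by (rule zero) (simp add: v_def)
      finally show ?thesis using that by simp
    qed
    then have "UNIV - {0} \<subseteq> {t. poly R t = 0}" by auto
    moreover have "infinite (UNIV - {0 :: 'a})" using infinite_UNIV_char_0 by (rule infinite_remove)
    ultimately have "R = 0" using poly_roots_finite[of R] finite_subset by blast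
    then have "0 = poly R 0" by simp
    also have "\<dots> = (\<Sum>b\<in>?A. c' b * (\<Prod>j\<in>K. x j ^ b j))"
      unfolding R_def poly_sum
    proof (intro sum.cong refl)
      fix b
      have "(\<Prod>j\<in>K. poly (r j) 0 ^ b j) = (\<Prod>j\<in>K. x j ^ b j)"
        using r(2) by (intro prod.cong) (auto simp: v_def)
      then show "poly (if (\<Sum>j\<in>K. b j) < s then 0 else
            [:c b:] * monom 1 ((\<Sum>j\<in>K. b j) - s) * (\<Prod>j\<in>K. r j ^ b j)) 0 =
          c' b * (\<Prod>j\<in>K. x j ^ b j)"
        by (auto simp: c'_def poly_monom poly_prod power_0_left)
    qed
    finally show ?thesis by simp
  qed
  from polyfun_zero_coeffs[OF K this less.prems] show ?case by (simp add: c'_def s_def)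
qed

text \<open>\<open>Z k\<close> is the closure of the image when only the first \<open>k\<close>
  parameters may be nonzero. Strictness is again a count: the monomials in \<open>k + 1\<close> of
  the forms \<open>q j\<close> with exponents up to \<open>B\<close> outnumber the coefficients of
  their pullbacks in \<open>k\<close> parameters. Some nontrivial combination therefore vanishes on
  \<open>Z k\<close>, but not on \<open>Z (Suc k)\<close>, where it would contradict
  \<open>independent_first_order\<close>.\<close>

theorem krull_dim_ge_parameters:
  fixes S :: "('a::field_char_0^'n) set set" and \<psi> :: "('i \<Rightarrow> 'a) \<Rightarrow> 'a^'n"
  assumes S: "S \<subseteq> proj_space" and J: "finite J"
    and \<psi>: "\<And>i. poly_on J (\<lambda>x. \<psi> x $ i)" and in_S: "\<And>x. vec.span {\<psi> x} \<in> S"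
    and one: "\<And>x. \<psi> x $ i0 = 1" and q: "\<And>j. j \<in> J \<Longrightarrow> form 1 (q j)"
    and jet: "\<And>v j. j \<in> J \<Longrightarrow>
      \<exists>p. (\<forall>t. q j (\<psi> (\<lambda>i. t * v i)) = poly p t) \<and> coeff p 0 = 0 \<and> coeff p 1 = v j"
  shows "enat (card J) \<le> krull_dim (subtopology zariski S)"
proof -
  obtain h where h: "bij_betw h {..<card J} J"
    using ex_bij_betw_nat_finite[OF J] by (auto simp: atLeast0LessThan)
  define K where "K = (\<lambda>k. h ` {..<k})"
  have K: "finite (K k)" for k by (simp add: K_def)
  have KJ: "K k \<subseteq> J" if "k \<le> card J" for k
    using h that unfolding K_def bij_betw_def by auto
  have cardK: "card (K k) = k" if "k \<le> card J" for k
    unfolding K_def using h that by (subst card_image) (auto simp: bij_betw_def elim: inj_on_subset)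
  define rs where "rs = (\<lambda>k (x :: 'i \<Rightarrow> 'a) i. if i \<in> K k then x i else 0)"
  define \<phi> where "\<phi> = (\<lambda>k x. \<psi> (rs k x))"
  have \<phi>: "poly_on (K k) (\<lambda>x. \<phi> k x $ i)" for k i
    unfolding \<phi>_def
  proof (rule poly_on_comp[OF K \<psi>])
    fix j show "poly_on (K k) (\<lambda>x. rs k x j)"
      using K by (cases "j \<in> K k") (auto simp: rs_def)
  qed
  have \<phi>S: "vec.span {\<phi> k x} \<in> S" for k x unfolding \<phi>_def by (rule in_S)
  define Z where "Z = (\<lambda>k. image_closure S (\<phi> k))"
  have "rs (Suc k) (rs k x) = rs k x" for k x by (auto simp: rs_def K_def fun_eq_iff)
  then have "range (\<phi> k) \<subseteq> range (\<phi> (Suc k))" for k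
    by (auto simp: \<phi>_def) (metis rangeI)
  then have mono: "Z k \<subseteq> Z (Suc k)" for k unfolding Z_def by (rule image_closure_mono)
  have "Z k \<subset> Z (Suc k)" if k: "k < card J" for k
  proof -
    let ?K = "K (Suc k)"
    obtain e where e: "\<And>i. polyfun (K k) e (\<lambda>x. \<phi> k x $ i)"
      using poly_on_uniform_degree[OF K \<phi>] by blast
    obtain B where B: "(Suc k * e * B + 1) ^ k < (B + 1) ^ Suc k"
      using exists_power_gap[of k "Suc k"] by blast
    let ?E = "Suc k * B" let ?A = "?K \<rightarrow>\<^sub>E {..B}" let ?P = "K k \<rightarrow>\<^sub>E {..?E * e}"
    have finA: "finite ?A" "finite ?P" using K by (auto intro: finite_PiE)
    \<comment> \<open>A power of the coordinate \<open>i0\<close>, which is constantly 1 along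
      \<open>\<psi>\<close>, homogenises all monomials to the degree \<open>Suc k * B\<close>
      without changing their pullbacks.\<close>
    define G where "G = (\<lambda>a (x::'a^'n). x $ i0 ^ (?E - (\<Sum>j\<in>?K. a j)) * (\<Prod>j\<in>?K. q j x ^ a j))"
    have G: "form ?E (G a)" if "a \<in> ?A" for a
    proof -
      have "(\<Sum>j\<in>?K. a j) \<le> (\<Sum>j\<in>?K. B)" using that by (intro sum_mono) (auto simp: PiE_iff)
      then have le: "(\<Sum>j\<in>?K. a j) \<le> ?E" using cardK[of "Suc k"] k by simp
      have "form ((?E - (\<Sum>j\<in>?K. a j)) * 1 + (\<Sum>j\<in>?K. a j * 1)) (G a)"
        unfolding G_def using KJ[of "Suc k"] k
        by (intro form_mult form_power form_coordinate form_prod K q) auto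
      then show ?thesis using le by simp
    qed
    have "\<forall>a\<in>?A. \<exists>M. \<forall>x. G a (\<phi> k x) = (\<Sum>m\<in>?P. M m * (\<Prod>j\<in>K k. x j ^ m j))"
      using polyfun_form[OF K e G] unfolding polyfun_def by blast
    from bchoice[OF this] obtain M
      where M: "\<And>a x. a \<in> ?A \<Longrightarrow> G a (\<phi> k x) = (\<Sum>m\<in>?P. M a m * (\<Prod>j\<in>K k. x j ^ m j))"
      by blast
    have "card ?P = (Suc k * e * B + 1) ^ k"
      using K cardK[of k] k by (simp add: card_PiE algebra_simps)
    moreover have "card ?A = (B + 1) ^ Suc k" using K cardK[of "Suc k"] k by (simp add: card_PiE)
    ultimately have "card ?P < card ?A" using B by simp
    then obtain c where c: "\<exists>a\<in>?A. c a \<noteq> 0" "\<And>m. m \<in> ?P \<Longrightarrow> (\<Sum>a\<in>?A. c a * M a m) = 0"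
      using nontrivial_relation[OF finA(2,1), of M] by auto
    define F where "F = (\<lambda>x. \<Sum>a\<in>?A. c a * G a x)"
    have F: "form ?E F" unfolding F_def by (intro form_sum form_cmult G)
    have "F (\<phi> k x) = 0" for x
    proof -
      have "F (\<phi> k x) = (\<Sum>m\<in>?P. (\<Sum>a\<in>?A. c a * M a m) * (\<Prod>j\<in>K k. x j ^ m j))"
        unfolding F_def sum_distrib_right
        by (subst sum.swap) (simp add: M mult.assoc sum_distrib_left)
      then show ?thesis using c(2) by simp
    qed
    then have "vanishes F (Z k)"
      unfolding Z_def using vanishes_image_closure[of "\<phi> k" S _ F, OF \<phi>S F] by simp
    moreover have "\<not> vanishes F (Z (Suc k))"
    proof
      assume "vanishes F (Z (Suc k))"
      then have van: "F (\<phi> (Suc k) x) = 0" for x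
        unfolding Z_def using vanishes_image_closure[of "\<phi> (Suc k)" S _ F, OF \<phi>S F] by simp
      have "c a = 0" if "a \<in> ?A" for a
      proof (rule independent_first_order[where K = ?K and q = q and \<psi> = \<psi> and B = B and c = c, OF K _ _ that])
        show "\<exists>p. (\<forall>t. q j (\<psi> (\<lambda>i. t * v i)) = poly p t) \<and> coeff p 0 = 0 \<and> coeff p 1 = v j"
          if "j \<in> ?K" for v j using jet[of j v] KJ[of "Suc k"] k that by auto
        show "(\<Sum>a\<in>?A. c a * (\<Prod>j\<in>?K. q j (\<psi> x) ^ a j)) = 0" if "\<And>i. i \<notin> ?K \<Longrightarrow> x i = 0" for x
        proof -
          have "rs (Suc k) x = x" using that by (auto simp: rs_def fun_eq_iff)
          then show ?thesis using van[of x] by (simp add: F_def G_def \<phi>_def one)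
        qed
      qed
      then show False using c(1) by blast
    qed
    ultimately have "Z k \<noteq> Z (Suc k)" by metis
    with mono[of k] show ?thesis by (rule psubsetI)
  qed
  moreover have "closedin (subtopology zariski S) (Z k)" "irreducible_in (subtopology zariski S) (Z k)" for k
    unfolding Z_def
    by (rule closedin_image_closure[OF S], rule irreducible_image_closure[OF S K \<phi> \<phi>S])
  ultimately show ?thesis
    unfolding krull_dim_def by (intro Sup_upper CollectI exI[of _ "card J"] conjI refl exI[of _ Z]) auto
qed

section \<open>Four-by-eight matrices in blocks\<close>

definition lo :: "4 \<Rightarrow> 8" where
  "lo j = (if j = 0 then 0 else if j = 1 then 1 else if j = 2 then 2 else 3)"

definition hi :: "4 \<Rightarrow> 8" where
  "hi j = (if j = 0 then 4 else if j = 1 then 5 else if j = 2 then 6 else 7)"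

lemma exhaust_4_zero: "j = 0 \<or> j = 1 \<or> j = 2 \<or> j = 3" for j :: 4
  using exhaust_4[of j] by auto

lemma lo_hi_inject [simp]: "lo i = lo j \<longleftrightarrow> i = j" "hi i = hi j \<longleftrightarrow> i = j"
  using exhaust_4_zero[of i] exhaust_4_zero[of j] by (elim disjE; simp add: lo_def hi_def)+

lemma lo_hi_distinct [simp]: "lo i \<noteq> hi j" "hi j \<noteq> lo i"
  using exhaust_4_zero[of i] exhaust_4_zero[of j] by (elim disjE; simp add: lo_def hi_def)+

lemma bij_lo_hi: "bij (case_sum lo hi)"
proof -
  have inj: "inj (case_sum lo hi)" by (auto simp: inj_def split: sum.splits)
  moreover have "surj (case_sum lo hi)"
  proof (rule card_subset_eq[OF finite])
    show "card (range (case_sum lo hi)) = card (UNIV :: 8 set)"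
      using card_image[OF inj] by (simp add: card_UNIV_sum)
  qed simp
  ultimately show ?thesis by (simp add: bij_def)
qed

definition block :: "8 \<Rightarrow> 4 + 4" where
  "block = inv (case_sum lo hi)"

lemma block_lo [simp]: "block (lo j) = Inl j" and block_hi [simp]: "block (hi j) = Inr j"
  using inv_f_f[OF bij_is_inj[OF bij_lo_hi], of "Inl j"] inv_f_f[OF bij_is_inj[OF bij_lo_hi], of "Inr j"]
  by (simp_all add: block_def)

lemma lo_hi_cases: obtains j where "k = lo j" | j where "k = hi j"
proof -
  obtain s where "k = case_sum lo hi s" using bij_lo_hi by (metis bij_pointE)
  then show ?thesis using that by (cases s) auto
qed

lemma sum_lo_hi: "(\<Sum>k\<in>UNIV. f k) = (\<Sum>j\<in>UNIV. f (lo j)) + (\<Sum>j\<in>UNIV. f (hi j))"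
proof -
  have "(\<Sum>k\<in>UNIV. f k) = (\<Sum>s\<in>UNIV. f (case_sum lo hi s))"
    by (rule sum.reindex_bij_betw[OF bij_lo_hi, symmetric])
  also have "\<dots> = (\<Sum>s\<in>UNIV <+> UNIV. f (case_sum lo hi s))" by (simp add: UNIV_Plus_UNIV)
  also have "\<dots> = (\<Sum>j\<in>UNIV. f (lo j)) + (\<Sum>j\<in>UNIV. f (hi j))"
    by (subst sum.Plus) simp_all
  finally show ?thesis .
qed

definition lpart :: "'a^8^4 \<Rightarrow> 'a^4^4" where "lpart V = (\<chi> i j. V $ i $ lo j)"
definition rpart :: "'a^8^4 \<Rightarrow> 'a^4^4" where "rpart V = (\<chi> i j. V $ i $ hi j)"
definition join :: "'a^4^4 \<Rightarrow> 'a^4^4 \<Rightarrow> 'a^8^4" where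
  "join A B = (\<chi> i k. case block k of Inl j \<Rightarrow> A $ i $ j | Inr j \<Rightarrow> B $ i $ j)"
definition stack :: "'a^8^4 \<Rightarrow> 'a^8^4 \<Rightarrow> 'a^8^8" where
  "stack V W = (\<chi> r. case block r of Inl i \<Rightarrow> V $ i | Inr i \<Rightarrow> W $ i)"

lemma join_lo_hi [simp]: "join A B $ i $ lo j = A $ i $ j" "join A B $ i $ hi j = B $ i $ j"
  by (simp_all add: join_def)

lemma stack_lo_hi [simp]: "stack V W $ lo i = V $ i" "stack V W $ hi i = W $ i"
  by (simp_all add: stack_def)

lemma eq_blocks_iff: "V = W \<longleftrightarrow> lpart V = lpart W \<and> rpart V = rpart W"
  unfolding lpart_def rpart_def by (auto simp: vec_eq_iff) (metis lo_hi_cases)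

lemma lpart_join [simp]: "lpart (join A B) = A" and rpart_join [simp]: "rpart (join A B) = B"
  by (simp_all add: lpart_def rpart_def vec_eq_iff)

lemma join_parts [simp]: "join (lpart V) (rpart V) = V"
  by (simp add: eq_blocks_iff)

lemma lpart_mult: "lpart (P ** V) = P ** lpart V" and rpart_mult: "rpart (P ** V) = P ** rpart V"
  for V :: "'a::semiring_1^8^4"
  by (simp_all add: lpart_def rpart_def matrix_matrix_mult_def vec_eq_iff)

text \<open>When the rows of \<open>V\<close> and \<open>W\<close> together form a basis,
  \<open>P\<close> and \<open>Q\<close> are the coordinates of four vectors in that basis.\<close>

lemma join_mult_stack: "join P Q ** stack V W = P ** V + Q ** W" for P :: "'a::semiring_1^4^4"
  by (simp add: matrix_matrix_mult_def vec_eq_iff sum_lo_hi)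

lemma stack_base: "stack (join (mat 1) 0) (join 0 (mat 1)) = (mat 1 :: 'a::semiring_1^8^8)"
proof -
  have "stack (join (mat 1) 0) (join 0 (mat 1)) $ r $ k = (mat 1 :: 'a^8^8) $ r $ k" for r k
    by (rule lo_hi_cases[of r]; rule lo_hi_cases[of k]) (simp_all add: mat_def)
  then show ?thesis by (simp add: vec_eq_iff)
qed

definition smult_mat :: "'a::times \<Rightarrow> 'a^8^4 \<Rightarrow> 'a^8^4" where
  "smult_mat c V = (\<chi> i k. c * V $ i $ k)"

lemma smult_mat_nth [simp]: "smult_mat c V $ i $ k = c * V $ i $ k"
  by (simp add: smult_mat_def)

lemma mult_smult_mat: "P ** smult_mat c V = smult_mat c (P ** V)" for V :: "'a::comm_semiring_1^8^4"
  by (simp add: matrix_matrix_mult_def vec_eq_iff sum_distrib_left ac_simps)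

lemma wedge_smult_mat: "wedge (smult_mat c V) = c ^ 4 *s wedge V"
proof -
  have "(\<chi> i j. c * V $ i $ quad_fun I j) = (\<chi> i. c *s (\<chi> i j. V $ i $ quad_fun I j) $ i)" for I
    by (simp add: vec_eq_iff)
  then have "det (\<chi> i j. c * V $ i $ quad_fun I j) = c ^ 4 * det (\<chi> i j. V $ i $ quad_fun I j)" for I
    using det_rows_mul[of "\<lambda>_. c" "\<lambda>i. (\<chi> i j. V $ i $ quad_fun I j) $ i"] by (simp add: vec_lambda_eta)
  then show ?thesis by (simp add: wedge_def vec_eq_iff)
qed

text \<open>Scaling a single row absorbs the factor \<open>c\<close>. This is why secant points can
  be treated as sums of three wedges without coefficients.\<close>

lemma smult_wedge:
  fixes V :: "'a::field^8^4"
  shows "\<exists>W. c *s wedge V = wedge W"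
proof -
  let ?A = "(\<chi> i j. if i = j then (if i = 0 then c else 1) else 0) :: 'a^4^4"
  have "det ?A = (\<Prod>i\<in>UNIV. ?A $ i $ i)" by (rule det_diagonal) simp
  also have "\<dots> = c" by (simp add: prod.delta)
  finally show ?thesis
    using wedge_matrix_mult[of ?A V] by (intro exI[of _ "?A ** V"]) simp
qed

lemma upoly_wedge:
  assumes "\<And>i k. upoly (\<lambda>t. V t $ i $ k)"
  shows "upoly (\<lambda>t. wedge (V t) $ I)"
  using assms by (auto simp: wedge_def)

lemma poly_on_wedge:
  assumes "finite J" "\<And>i k. poly_on J (\<lambda>x. V x $ i $ k)"
  shows "poly_on J (\<lambda>x. wedge (V x) $ I)"
  using assms by (auto simp: wedge_def)

text \<open>Row reduction into the standard affine chart of the Grassmannian, in which a 4-space is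
  the graph of a matrix \<open>A\<close>.\<close>

lemma wedge_normalize:
  fixes V :: "'a::field^8^4"
  assumes "det (lpart V) \<noteq> 0"
  shows "\<exists>A. wedge V = det (lpart V) *s wedge (join (mat 1) A)"
proof -
  obtain B where B: "lpart V ** B = mat 1"
    using assms by (auto simp: invertible_det_nz[symmetric] invertible_def)
  have "V = lpart V ** join (mat 1) (B ** rpart V)"
    by (simp add: eq_blocks_iff lpart_mult rpart_mult matrix_mul_assoc B)
  then show ?thesis by (metis wedge_matrix_mult)
qed

text \<open>An identity block reads off the coefficients of any linear combination of the rows, so
  the rows are distinct and independent.\<close>

lemma span_rows_in_grassmannian:
  fixes V :: "'a::field^8^4"
  assumes "lpart V = mat 1 \<or> rpart V = mat 1"
  shows "vec.span (rows V) \<in> grassmannian 4"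
proof -
  have coeffs: "c i = 0" if "(\<Sum>i\<in>UNIV. c i *s row i V) = 0" for c i
  proof -
    have "(\<Sum>l\<in>UNIV. c l * V $ l $ k) = 0" for k
      using arg_cong[OF that, of "\<lambda>x. x $ k"] by (simp add: row_def)
    from this[of "lo i"] this[of "hi i"]
    have *: "(\<Sum>l\<in>UNIV. c l * lpart V $ l $ i) = 0" "(\<Sum>l\<in>UNIV. c l * rpart V $ l $ i) = 0"
      by (simp_all add: lpart_def rpart_def)
    have "(\<Sum>l\<in>UNIV. c l * (mat 1 :: 'a^4^4) $ l $ i) = c i"
      by (simp add: mat_def if_distrib[of "\<lambda>x. _ * x"] cong: if_cong)
    then show ?thesis using * assms by auto
  qed
  have inj: "inj (\<lambda>i. row i V)"
  proof (rule injI, rule ccontr)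
    fix i l assume eq: "row i V = row l V" and "i \<noteq> l"
    let ?c = "\<lambda>j. if j = i then 1 else if j = l then - 1 else 0 :: 'a"
    have "(\<Sum>j\<in>UNIV. ?c j *s row j V) = (\<Sum>j\<in>{i, l}. ?c j *s row j V)"
      by (rule sum.mono_neutral_right) auto
    also have "\<dots> = 0" using \<open>i \<noteq> l\<close> eq by simp
    finally show False using coeffs[of ?c i] by simp
  qed
  have rows: "rows V = range (\<lambda>i. row i V)" by (auto simp: rows_def)
  have "vec.independent (rows V)"
  proof (rule vec.independent_if_scalars_zero)
    fix f x assume "(\<Sum>x\<in>rows V. f x *s x) = 0" "x \<in> rows V"
    then show "f x = 0" using coeffs[of "\<lambda>i. f (row i V)"] inj by (auto simp: rows sum.reindex)
  qed (simp add: rows)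
  moreover have "card (rows V) = 4" unfolding rows using inj by (simp add: card_image)
  ultimately show ?thesis by (simp add: grassmannian_def vec.dim_eq_card_independent)
qed

lemma wedge_in_plucker:
  fixes V :: "'a::field^8^4"
  assumes "lpart V = mat 1 \<or> rpart V = mat 1"
  shows "vec.span {wedge V} \<in> plucker ` grassmannian 4"
  using span_rows_in_grassmannian[OF assms] plucker_span_rows[of V] by (metis imageI)

lemma plucker_cases:
  assumes "L \<in> plucker ` grassmannian 4"
  obtains V where "L = vec.span {wedge V}"
  using assms by (metis grassmannian_rows imageE plucker_span_rows)

lemma plucker_subset: "plucker ` grassmannian 4 \<subseteq> proj_space"
  using plucker_in_proj_space by blast

section \<open>Dimension of the Grassmannian: upper bound\<close>

text \<open>The chart is dense: on the line \<open>C\<close> from \<open>V\<close> to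
  \<open>join (mat 1) 0\<close> the determinant of the left block is a polynomial with value 1 at
  the end.\<close>

lemma form_zero_on_all_wedges:
  fixes f :: "'a::field_char_0^quad \<Rightarrow> 'a"
  assumes f: "form d f" and zero: "\<And>A. f (wedge (join (mat 1) A)) = 0"
  shows "f (wedge V) = 0"
proof -
  define C where "C = (\<lambda>t. \<chi> i k. V $ i $ k + t * (join (mat 1) 0 $ i $ k - V $ i $ k))"
  have C: "upoly (\<lambda>t. C t $ i $ k)" for i k unfolding C_def by (auto intro!: upoly_add upoly_mult)
  have ends: "C 0 = V" "C 1 = join (mat 1) 0" by (simp_all add: C_def vec_eq_iff)
  have "f (wedge (C 0)) = 0"
  proof (rule upoly_eq_0_mult[of "\<lambda>t. f (wedge (C t))" "\<lambda>t. det (lpart (C t))" 1])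
    show "upoly (\<lambda>t. f (wedge (C t)))" using C by (intro upoly_form[OF f] upoly_wedge)
    show "upoly (\<lambda>t. det (lpart (C t)))" using C by (auto simp: lpart_def)
    show "det (lpart (C 1)) \<noteq> 0" by (simp add: ends)
    show "f (wedge (C t)) = 0" if "det (lpart (C t)) \<noteq> 0" for t
      using wedge_normalize[OF that] form_scale[OF f] zero by auto
  qed
  then show ?thesis by (simp add: ends)
qed

lemma plucker_dim_le: "variety_dim (plucker ` grassmannian 4 :: ('a::field_char_0^quad) set set) \<le> 16"
proof -
  define \<psi> :: "(4 \<times> 4 \<Rightarrow> 'a) \<Rightarrow> 'a^quad" where "\<psi> = (\<lambda>x. wedge (join (mat 1) (\<chi> i j. x (i, j))))"
  have "variety_dim (plucker ` grassmannian 4 :: ('a^quad) set set) \<le> enat (card (UNIV :: (4 \<times> 4) set))"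
    unfolding variety_dim_def
  proof (rule krull_dim_le_parameters[OF plucker_subset, of UNIV \<psi>])
    show "poly_on UNIV (\<lambda>x. \<psi> x $ I)" for I
      unfolding \<psi>_def
    proof (rule poly_on_wedge)
      show "poly_on UNIV (\<lambda>x. join (mat 1) (\<chi> i j. x (i, j)) $ i $ k)" for i k
        by (rule lo_hi_cases[of k]) auto
    qed simp
    fix d and f :: "'a^quad \<Rightarrow> 'a" assume f: "form d f" and zero: "\<And>x. f (\<psi> x) = 0"
    have "f (wedge (join (mat 1) A)) = 0" for A
      using zero[of "\<lambda>(i, j). A $ i $ j"] by (simp add: \<psi>_def vec_lambda_eta)
    then have "f (wedge V) = 0" for V by (rule form_zero_on_all_wedges[OF f])
    then show "vanishes f (plucker ` grassmannian 4)"
      unfolding vanishes_def using form_zero_on_line[OF f] plucker_cases by metis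
  qed simp
  then show ?thesis by (simp add: numeral_eq_enat)
qed

section \<open>Dimension of the secant variety: upper bound\<close>

text \<open>
  The wedges of a pencil \<open>s N + W\<close> trace a rational normal quartic, and a point of its span whose
  coordinate at \<open>wedge W\<close> vanishes has only four degrees of freedom. Lagrange interpolation at the
  nodes \<open>0, 1, 2, 3, 4\<close> exhibits it as a combination of these differences.
\<close>

definition pencil_diff :: "'a::field^8^4 \<Rightarrow> 'a^8^4 \<Rightarrow> 'a \<Rightarrow> 'a^quad" where
  "pencil_diff N W s = wedge (smult_mat s N + W) - wedge W"

text \<open>Each term of the Leibniz expansion is a product of four factors that are linear in
  \<open>s\<close>.\<close>

lemma det_pencil_poly:
  fixes A B :: "'a::field^4^4"
  shows "\<exists>p. degree p \<le> 4 \<and> (\<forall>s. det (\<chi> i j. s * A $ i $ j + B $ i $ j) = poly p s)"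
proof -
  let ?q = "\<lambda>\<sigma>. \<Prod>i\<in>UNIV. [:B $ i $ \<sigma> i, A $ i $ \<sigma> i:]"
  let ?p = "\<Sum>\<sigma> | \<sigma> permutes UNIV. [:of_int (sign \<sigma>):] * ?q \<sigma>"
  have "degree (?q \<sigma>) \<le> 4" for \<sigma>
  proof -
    have "degree (?q \<sigma>) \<le> (\<Sum>i\<in>UNIV. (degree \<circ> (\<lambda>i. [:B $ i $ \<sigma> i, A $ i $ \<sigma> i:])) i)"
      by (intro degree_prod_sum_le) simp
    also have "\<dots> \<le> (\<Sum>i\<in>(UNIV :: 4 set). 1)" by (intro sum_mono) simp
    finally show ?thesis by simp
  qed
  then have "degree ?p \<le> 4"
    by (intro degree_sum_le) (auto intro: order_trans[OF degree_mult_le])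
  moreover have "det (\<chi> i j. s * A $ i $ j + B $ i $ j) = poly ?p s" for s
    by (simp add: det_def poly_sum poly_prod add.commute)
  ultimately show ?thesis by blast
qed

text \<open>The five Lagrange basis polynomials sum to 1, so subtracting \<open>poly p 0\<close>
  throughout removes the node 0. The denominators -6, 4, -6, 24 are the products of the differences
  from a node to the other four.\<close>

lemma quartic_interpolation:
  fixes p :: "'a::field_char_0 poly"
  assumes "degree p \<le> 4"
  shows "poly p s - poly p 0 =
    - (s * (s - 2) * (s - 3) * (s - 4) / 6) * (poly p 1 - poly p 0) +
    s * (s - 1) * (s - 3) * (s - 4) / 4 * (poly p 2 - poly p 0) -
    s * (s - 1) * (s - 2) * (s - 4) / 6 * (poly p 3 - poly p 0) +
    s * (s - 1) * (s - 2) * (s - 3) / 24 * (poly p 4 - poly p 0)"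
proof -
  have "poly p x = (\<Sum>i\<le>4. coeff p i * x ^ i)" for x
    unfolding poly_altdef using assms by (intro sum.mono_neutral_left) (auto intro: coeff_eq_0)
  then have "poly p x = coeff p 0 + coeff p 1 * x + coeff p 2 * x^2 + coeff p 3 * x^3 + coeff p 4 * x^4" for x
    by (simp add: eval_nat_numeral)
  note p = this
  show ?thesis unfolding p by (simp add: field_simps power2_eq_square power3_eq_cube power4_eq_xxxx)
qed

lemma pencil_diff_interpolation:
  fixes N W :: "'a::field_char_0^8^4"
  shows "pencil_diff N W s =
    - (s * (s - 2) * (s - 3) * (s - 4) / 6) *s pencil_diff N W 1 +
    (s * (s - 1) * (s - 3) * (s - 4) / 4) *s pencil_diff N W 2 -
    (s * (s - 1) * (s - 2) * (s - 4) / 6) *s pencil_diff N W 3 +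
    (s * (s - 1) * (s - 2) * (s - 3) / 24) *s pencil_diff N W 4"
proof -
  have "pencil_diff N W s $ I = (- (s * (s - 2) * (s - 3) * (s - 4) / 6) *s pencil_diff N W 1 +
    (s * (s - 1) * (s - 3) * (s - 4) / 4) *s pencil_diff N W 2 -
    (s * (s - 1) * (s - 2) * (s - 4) / 6) *s pencil_diff N W 3 +
    (s * (s - 1) * (s - 2) * (s - 3) / 24) *s pencil_diff N W 4) $ I" for I
  proof -
    obtain p where p: "degree p \<le> 4"
      "\<And>s. det (\<chi> i j. s * (\<chi> i j. N $ i $ quad_fun I j) $ i $ j + (\<chi> i j. W $ i $ quad_fun I j) $ i $ j) = poly p s"
      using det_pencil_poly by blast
    have "wedge (smult_mat s N + W) $ I = poly p s" for s using p(2)[of s] by (simp add: wedge_def)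
    moreover have "wedge W $ I = poly p 0" using p(2)[of 0] by (simp add: wedge_def)
    ultimately have "pencil_diff N W s $ I = poly p s - poly p 0" for s
      by (simp add: pencil_diff_def)
    then show ?thesis using quartic_interpolation[OF p(1), of s] by simp
  qed
  then show ?thesis by (simp add: vec_eq_iff)
qed

definition pencil_combination :: "'a::field^8^4 \<Rightarrow> 'a^8^4 \<Rightarrow> 'a \<Rightarrow> 'a \<Rightarrow> 'a \<Rightarrow> 'a \<Rightarrow> 'a^quad" where
  "pencil_combination N W d1 d2 d3 d4 = d1 *s pencil_diff N W 1 + d2 *s pencil_diff N W 2 +
     d3 *s pencil_diff N W 3 + d4 *s pencil_diff N W 4"

text \<open>The nonvanishing of this polynomial allows normalising \<open>lpart N\<close> to the identity matrix
  and then the first two entries of \<open>W\<close> to \<open>0\<close> and \<open>1\<close>.\<close>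

definition nondeg :: "'a::field^8^4 \<Rightarrow> 'a^8^4 \<Rightarrow> 'a" where
  "nondeg N W = det (lpart N) * det (\<chi> i j. if j = 0 then W $ i $ lo 1 else N $ i $ lo j)"

lemma upoly_nondeg:
  assumes "\<And>i k. upoly (\<lambda>t. N t $ i $ k)" "\<And>i k. upoly (\<lambda>t. W t $ i $ k)"
  shows "upoly (\<lambda>t. nondeg (N t) (W t))"
  unfolding nondeg_def lpart_def
proof (intro upoly_mult upoly_det)
  show "upoly (\<lambda>t. (\<chi> i j. if j = 0 then W t $ i $ lo 1 else N t $ i $ lo j) $ i $ j)" for i j
    using assms by (cases "j = 0") simp_all
qed (use assms in simp)

text \<open>The hypothesis says that \<open>f\<close> vanishes on the family used for the upper
  bound. The lemmas inside drop its normalisations one after another until \<open>f\<close> vanishes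
  on all sums of three wedges.\<close>

locale form_on_parametrization =
  fixes f :: "'a::field_char_0^quad \<Rightarrow> 'a" and d :: nat
  assumes f: "form d f"
    and zero: "\<And>U W d2 d3 d4. W $ 0 $ lo 0 = 0 \<Longrightarrow> W $ 0 $ lo 1 = 1 \<Longrightarrow>
      f (pencil_combination (join (mat 1) U) W 1 d2 d3 d4) = 0"
begin

text \<open>Rescaling achieves \<open>d1 = 1\<close> when \<open>d1\<close> is nonzero; the
  remaining value 0 follows since the expression is polynomial in \<open>d1\<close>.\<close>

lemma zero_pencil_combination:
  assumes W: "W $ 0 $ lo 0 = 0" "W $ 0 $ lo 1 = 1"
  shows "f (pencil_combination (join (mat 1) U) W d1 d2 d3 d4) = 0"
proof (rule upoly_eq_0_mult[of "\<lambda>d1. f (pencil_combination (join (mat 1) U) W d1 d2 d3 d4)" "\<lambda>t. t" 1])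
  show "upoly (\<lambda>d1. f (pencil_combination (join (mat 1) U) W d1 d2 d3 d4))"
    by (intro upoly_form[OF f]) (auto simp: pencil_combination_def intro!: upoly_add upoly_mult)
  show "f (pencil_combination (join (mat 1) U) W t d2 d3 d4) = 0" if "t \<noteq> 0" for t
  proof -
    have "pencil_combination (join (mat 1) U) W t d2 d3 d4 =
        t *s pencil_combination (join (mat 1) U) W 1 (d2 / t) (d3 / t) (d4 / t)"
      using that by (simp add: pencil_combination_def vec_eq_iff field_simps)
    then show ?thesis using zero[OF W] form_scale[OF f] by simp
  qed
qed auto

text \<open>Because the coefficients sum to 0, \<open>wedge W\<close> can be subtracted from each of
  the three wedges. This leaves a combination of \<open>pencil_diff\<close> values, and
  interpolation moves these to the fixed nodes.\<close>

lemma zero_pencil_normalized: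
  assumes W: "W $ 0 $ lo 0 = 0" "W $ 0 $ lo 1 = 1" and sum: "a1 + a2 + a3 = 0"
    and N: "lpart N = mat 1"
  shows "f (a1 *s wedge (smult_mat s1 N + W) + a2 *s wedge (smult_mat s2 N + W) +
    a3 *s wedge (smult_mat s3 N + W)) = 0" (is "f ?x = 0")
proof -
  have N': "N = join (mat 1) (rpart N)" using N by (metis join_parts)
  have a3: "a3 = - a1 - a2" using sum by (simp add: eq_neg_iff_add_eq_0 algebra_simps)
  have "?x = a1 *s pencil_diff N W s1 + a2 *s pencil_diff N W s2 + a3 *s pencil_diff N W s3"
    by (simp add: pencil_diff_def vec_eq_iff a3 algebra_simps)
  also have "\<exists>d1 d2 d3 d4. \<dots> = pencil_combination N W d1 d2 d3 d4"
  proof -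
    obtain l1 l2 l3 l4 where l: "\<And>s. pencil_diff N W s = pencil_combination N W (l1 s) (l2 s) (l3 s) (l4 s)"
    proof
      show "pencil_diff N W s = pencil_combination N W (- (s * (s - 2) * (s - 3) * (s - 4) / 6))
        (s * (s - 1) * (s - 3) * (s - 4) / 4) (- (s * (s - 1) * (s - 2) * (s - 4) / 6))
        (s * (s - 1) * (s - 2) * (s - 3) / 24)" for s
        by (subst pencil_diff_interpolation) (simp add: pencil_combination_def vec_eq_iff)
    qed
    have "a1 *s pencil_diff N W s1 + a2 *s pencil_diff N W s2 + a3 *s pencil_diff N W s3 =
      pencil_combination N W (a1 * l1 s1 + a2 * l1 s2 + a3 * l1 s3) (a1 * l2 s1 + a2 * l2 s2 + a3 * l2 s3)
        (a1 * l3 s1 + a2 * l3 s2 + a3 * l3 s3) (a1 * l4 s1 + a2 * l4 s2 + a3 * l4 s3)"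
      unfolding l[of s1] l[of s2] l[of s3] by (simp add: pencil_combination_def vec_eq_iff algebra_simps)
    then show ?thesis by blast
  qed
  then obtain d1 d2 d3 d4 where "a1 *s pencil_diff N W s1 + a2 *s pencil_diff N W s2 +
    a3 *s pencil_diff N W s3 = pencil_combination N W d1 d2 d3 d4" by blast
  ultimately have "?x = pencil_combination N W d1 d2 d3 d4" by metis
  then show ?thesis using zero_pencil_combination[OF W, of "rpart N"] N' by simp
qed

text \<open>Changing the pencil parameter to \<open>(s + l) / w\<close> replaces \<open>W\<close> by
  \<open>W'\<close>, whose first two entries are 0 and 1. All three wedges pick up the same factor
  \<open>w ^ 4\<close>, so the condition on the coefficients survives.\<close>

lemma zero_pencil_identity:
  assumes w: "W $ 0 $ lo 1 \<noteq> 0" and sum: "a1 + a2 + a3 = 0" and N: "lpart N = mat 1"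
  shows "f (a1 *s wedge (smult_mat s1 N + W) + a2 *s wedge (smult_mat s2 N + W) +
    a3 *s wedge (smult_mat s3 N + W)) = 0"
proof -
  define w where "w = W $ 0 $ lo 1"
  define l where "l = W $ 0 $ lo 0"
  have N0: "N $ 0 $ lo 0 = 1" "N $ 0 $ lo 1 = 0"
    using arg_cong[OF N, of "\<lambda>M. M $ 0 $ 0"] arg_cong[OF N, of "\<lambda>M. M $ 0 $ 1"]
    by (simp_all add: lpart_def mat_def)
  define W' where "W' = smult_mat (1 / w) (W - smult_mat l N)"
  have W': "W' $ 0 $ lo 0 = 0" "W' $ 0 $ lo 1 = 1"
    using w by (simp_all add: W'_def N0 w_def l_def)
  have "smult_mat s N + W = smult_mat w (smult_mat ((s + l) / w) N + W')" for s
    using w by (simp add: W'_def w_def vec_eq_iff field_simps)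
  then have "wedge (smult_mat s N + W) = w ^ 4 *s wedge (smult_mat ((s + l) / w) N + W')" for s
    by (simp only: wedge_smult_mat)
  then have "a1 *s wedge (smult_mat s1 N + W) + a2 *s wedge (smult_mat s2 N + W) +
      a3 *s wedge (smult_mat s3 N + W) =
    w ^ 4 *s (a1 *s wedge (smult_mat ((s1 + l) / w) N + W') + a2 *s wedge (smult_mat ((s2 + l) / w) N + W') +
      a3 *s wedge (smult_mat ((s3 + l) / w) N + W'))"
    by (simp add: vec_eq_iff algebra_simps)
  then show ?thesis
    by (simp only: form_scale[OF f] zero_pencil_normalized[OF W' sum N] mult_zero_right)
qed

lemma zero_pencil:
  assumes nd: "nondeg N W \<noteq> 0" and sum: "a1 + a2 + a3 = 0"
  shows "f (a1 *s wedge (smult_mat s1 N + W) + a2 *s wedge (smult_mat s2 N + W) +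
    a3 *s wedge (smult_mat s3 N + W)) = 0"
proof -
  let ?N = "lpart N"
  have det: "det ?N \<noteq> 0" "det (\<chi> i j. if j = 0 then W $ i $ lo 1 else N $ i $ lo j) \<noteq> 0"
    using nd by (auto simp: nondeg_def)
  obtain B where B: "?N ** B = mat 1" "B ** ?N = mat 1"
    using det(1) by (auto simp: invertible_det_nz[symmetric] invertible_def)
  define N' where "N' = B ** N"
  define W' where "W' = B ** W"
  have eqs: "N = ?N ** N'" "W = ?N ** W'"
    by (simp_all add: N'_def W'_def matrix_mul_assoc B)
  have N': "lpart N' = mat 1" by (simp add: N'_def lpart_mult B)
  have "W' $ 0 $ lo 1 \<noteq> 0"
  proof -
    define x where "x = (\<chi> i. W' $ i $ lo 1)"
    have "?N *v x = (\<chi> i. (?N ** W') $ i $ lo 1)"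
      by (simp add: x_def matrix_vector_mult_def matrix_matrix_mult_def)
    then have "?N *v x = (\<chi> i. W $ i $ lo 1)" by (simp only: eqs(2)[symmetric])
    \<comment> \<open>Cramer's rule for the column \<open>lo 1\<close> of \<open>W\<close>
      identifies the second factor of \<open>nondeg\<close> with \<open>det ?N\<close> times the
      entry of \<open>W'\<close> that has to be nonzero.\<close>
    then have "x $ 0 * det ?N = det (\<chi> i j. if j = 0 then W $ i $ lo 1 else N $ i $ lo j)"
      using cramer_lemma[of 0 ?N x] by (simp add: lpart_def cong: if_cong)
    then show ?thesis using det by (auto simp: x_def)
  qed
  note z = zero_pencil_identity[OF this sum N']
  have "smult_mat s N + W = ?N ** (smult_mat s N' + W')" for s
    by (metis eqs matrix_add_ldistrib mult_smult_mat)
  then have "wedge (smult_mat s N + W) = det ?N *s wedge (smult_mat s N' + W')" for s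
    by (metis wedge_matrix_mult)
  then have "a1 *s wedge (smult_mat s1 N + W) + a2 *s wedge (smult_mat s2 N + W) +
      a3 *s wedge (smult_mat s3 N + W) =
    det ?N *s (a1 *s wedge (smult_mat s1 N' + W') + a2 *s wedge (smult_mat s2 N' + W') +
      a3 *s wedge (smult_mat s3 N' + W'))"
    by (simp add: vec_eq_iff algebra_simps)
  then show ?thesis by (simp only: form_scale[OF f] z mult_zero_right)
qed

text \<open>
  With \<open>N = U - p W\<close> the coordinate at \<open>wedge W\<close> vanishes iff \<open>b = - a p\<^sup>4 - (p + 1)\<^sup>4\<close>; as \<open>p\<close>
  varies this takes infinitely many values.
\<close>

lemma zero_three_wedges_nondeg:
  assumes nd: "nondeg U W \<noteq> 0"
  shows "f (a *s wedge U + b *s wedge W + wedge (U + W)) = 0"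
proof -
  define g where "g = (\<lambda>b. f (a *s wedge U + b *s wedge W + wedge (U + W)))"
  define \<beta> where "\<beta> = (\<lambda>p. - (a * p ^ 4) - (p + 1) ^ 4)"
  define N where "N = (\<lambda>p. U - smult_mat p W)"
  have g: "upoly g"
    unfolding g_def by (intro upoly_form[OF f]) (auto intro!: upoly_add upoly_mult)
  have \<beta>: "upoly \<beta>"
  proof -
    have "upoly (\<lambda>p. (0 - a * p ^ 4) - (p + 1) ^ 4)"
      by (intro upoly_diff upoly_mult upoly_power upoly_add) auto
    then show ?thesis by (simp add: \<beta>_def)
  qed
  have g\<beta>: "upoly (\<lambda>p. g (\<beta> p))"
  proof -
    obtain q r where "\<And>t. g t = poly q t" "\<And>t. \<beta> t = poly r t" using g \<beta> by (auto simp: upoly_def)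
    then have "g (\<beta> t) = poly (pcompose q r) t" for t by (simp add: poly_pcompose)
    then show ?thesis by (auto simp: upoly_def)
  qed
  have h: "upoly (\<lambda>p. nondeg (N p) W)"
    by (intro upoly_nondeg) (auto simp: N_def intro!: upoly_diff upoly_mult)
  have "g (\<beta> p) = 0" if p: "nondeg (N p) W \<noteq> 0" "p \<noteq> 0" "p \<noteq> - 1" for p
  proof -
    have p1: "p + 1 \<noteq> 0" using p(3) by (simp add: eq_neg_iff_add_eq_0)
    \<comment> \<open>Every \<open>N p\<close> generates with \<open>W\<close> the same pencil as
      \<open>U\<close> does. In terms of \<open>N p\<close>, the three members \<open>U\<close>,
      \<open>U + W\<close> and \<open>W\<close> sit at the parameters \<open>1 / p\<close>,
      \<open>1 / (p + 1)\<close> and 0, up to scalars.\<close>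
    have "U = smult_mat p (smult_mat (1 / p) (N p) + W)"
      "U + W = smult_mat (p + 1) (smult_mat (1 / (p + 1)) (N p) + W)"
      "W = smult_mat 0 (N p) + W"
      using p p1 by (simp_all add: N_def vec_eq_iff field_simps)
    then have "wedge U = p ^ 4 *s wedge (smult_mat (1 / p) (N p) + W)"
      "wedge (U + W) = (p + 1) ^ 4 *s wedge (smult_mat (1 / (p + 1)) (N p) + W)"
      "wedge W = wedge (smult_mat 0 (N p) + W)"
      by (metis wedge_smult_mat)+
    then have "a *s wedge U + \<beta> p *s wedge W + wedge (U + W) =
      (a * p ^ 4) *s wedge (smult_mat (1 / p) (N p) + W) + \<beta> p *s wedge (smult_mat 0 (N p) + W) +
      (p + 1) ^ 4 *s wedge (smult_mat (1 / (p + 1)) (N p) + W)"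
      by (metis vector_smult_assoc)
    moreover have "a * p ^ 4 + \<beta> p + (p + 1) ^ 4 = 0" by (simp add: \<beta>_def)
    ultimately show ?thesis unfolding g_def using zero_pencil[OF p(1)] by simp
  qed
  moreover have "infinite ({p. nondeg (N p) W \<noteq> 0} - {0, - 1})"
  proof -
    have "N 0 = U" by (simp add: N_def vec_eq_iff)
    then have "finite {p. nondeg (N p) W = 0}" using upoly_eq_0[OF h, of 0] nd by auto
    then have "finite ({p. nondeg (N p) W = 0} \<union> {0, - 1})" by simp
    then have "infinite (UNIV - ({p. nondeg (N p) W = 0} \<union> {0, - 1}))"
      using infinite_UNIV_char_0[where 'a='a] by (intro Diff_infinite_finite)
    then show ?thesis by (rule contrapos_nn) (erule finite_subset[rotated], auto)
  qed
  ultimately have "infinite {p. g (\<beta> p) = 0}"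
    by (elim contrapos_nn finite_subset[rotated]) auto
  then have zero: "g (\<beta> p) = 0" for p by (rule upoly_eq_0[OF g\<beta>])
  have "infinite (range \<beta>)"
  proof
    assume "finite (range \<beta>)"
    then obtain p0 where "infinite {p \<in> UNIV. \<beta> p = \<beta> p0}"
      using pigeonhole_infinite[of UNIV \<beta>] infinite_UNIV_char_0[where 'a='a] by auto
    then have "infinite {p. \<beta> p - \<beta> p0 = 0}" by simp
    then have const: "\<beta> p - \<beta> p0 = 0" for p
      by (rule upoly_eq_0[rotated]) (use \<beta> in auto)
    \<comment> \<open>The values at 0, 1 and -1 are -1, \<open>- a - 16\<close> and
      \<open>- a\<close>. Equality would force both \<open>a = - 15\<close> and
      \<open>a = 1\<close>.\<close>
    from const[of 0] const[of 1] const[of "- 1"] have "\<beta> 1 = \<beta> 0" "\<beta> (- 1) = \<beta> 0" by auto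
    then show False by (simp add: \<beta>_def)
  qed
  then have "infinite {b. g b = 0}" by (rule contrapos_nn) (erule finite_subset[rotated], use zero in auto)
  then show ?thesis using upoly_eq_0[OF g, of b] by (simp add: g_def)
qed

text \<open>For invertible \<open>P\<close> and \<open>Q\<close>, put \<open>U = P ** V1\<close> and
  \<open>W = Q ** V2\<close>: the first two wedges become multiples of \<open>wedge U\<close> and
  \<open>wedge W\<close>, and the third is \<open>wedge (U + W)\<close>. The rest is deformation to
  a configuration in which \<open>P\<close>, \<open>Q\<close> and \<open>nondeg\<close> cause no
  trouble.\<close>

lemma zero_three_wedges_dependent:
  "f (wedge V1 + wedge V2 + wedge (P ** V1 + Q ** V2)) = 0"
proof -
  define mv where "mv = (\<lambda>(V :: 'a^8^4) W t. \<chi> i k. V $ i $ k + t * (W $ i $ k - V $ i $ k))"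
  define mp where "mp = (\<lambda>(P :: 'a^4^4) t. \<chi> i k. P $ i $ k + t * (mat 1 $ i $ k - P $ i $ k))"
  have mv: "mv V W 0 = V" "mv V W 1 = W" "upoly (\<lambda>t. mv V W t $ i $ k)" for V W i k
    by (auto simp: mv_def vec_eq_iff intro!: upoly_add upoly_mult)
  have mp: "mp P 0 = P" "mp P 1 = mat 1" "upoly (\<lambda>t. mp P t $ i $ k)" for P i k
    by (auto simp: mp_def vec_eq_iff intro!: upoly_add upoly_mult)
  define U where "U = (\<lambda>t. mp P t ** mv V1 (join (mat 1) 0) t)"
  \<comment> \<open>At \<open>t = 1\<close> the column \<open>lo 1\<close> of this matrix is the
    first unit vector, as is the column that it replaces in \<open>nondeg\<close>; both determinants
    there are those of the identity matrix.\<close>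
  define W where "W = (\<lambda>t. mp Q t ** mv V2 (\<chi> i k. if i = 0 then 1 else 0) t)"
  define y where "y = (\<lambda>t. wedge (mv V1 (join (mat 1) 0) t) +
    wedge (mv V2 (\<chi> i k. if i = 0 then 1 else 0) t) + wedge (U t + W t))"
  define h where "h = (\<lambda>t. det (mp P t) * det (mp Q t) * nondeg (U t) (W t))"
  have UW: "upoly (\<lambda>t. U t $ i $ k)" "upoly (\<lambda>t. W t $ i $ k)" for i k
    unfolding U_def W_def matrix_matrix_mult_def using mv(3) mp(3) by (auto intro!: upoly_sum upoly_mult)
  have "f (y 0) = 0"
  proof (rule upoly_eq_0_mult[of "\<lambda>t. f (y t)" h 1])
    show "upoly (\<lambda>t. f (y t))"
      unfolding y_def using mv(3) UW
      by (intro upoly_form[OF f]) (auto intro!: upoly_add upoly_wedge)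
    show "upoly h" unfolding h_def using mp(3) UW by (intro upoly_mult upoly_det upoly_nondeg)
    have "(\<chi> i j. if j = 0 then (if i = 0 then 1 else 0) else join (mat 1) 0 $ i $ lo j) = (mat 1 :: 'a^4^4)"
      by (simp add: vec_eq_iff mat_def)
    then show "h 1 \<noteq> 0"
      by (simp add: h_def mp nondeg_def U_def W_def mv cong: if_cong)
    show "f (y t) = 0" if "h t \<noteq> 0" for t
    proof -
      have nz: "det (mp P t) \<noteq> 0" "det (mp Q t) \<noteq> 0" "nondeg (U t) (W t) \<noteq> 0"
        using that by (auto simp: h_def)
      have "wedge (U t) = det (mp P t) *s wedge (mv V1 (join (mat 1) 0) t)"
        "wedge (W t) = det (mp Q t) *s wedge (mv V2 (\<chi> i k. if i = 0 then 1 else 0) t)"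
        unfolding U_def W_def by (rule wedge_matrix_mult)+
      then have "y t = (1 / det (mp P t)) *s wedge (U t) + (1 / det (mp Q t)) *s wedge (W t) + wedge (U t + W t)"
        using nz by (simp add: y_def)
      then show ?thesis using zero_three_wedges_nondeg[OF nz(3)] by simp
    qed
  qed
  then show ?thesis by (simp add: y_def U_def W_def mv mp)
qed

text \<open>If \<open>V1\<close> and \<open>V2\<close> span complementary subspaces, then expanding
  the rows of \<open>V3\<close> in the basis formed by their rows gives \<open>P\<close> and
  \<open>Q\<close>. Otherwise deform \<open>V1\<close> and \<open>V2\<close> to the two coordinate
  subspaces.\<close>

lemma zero_three_wedges: "f (wedge V1 + wedge V2 + wedge V3) = 0"
proof -
  define mv where "mv = (\<lambda>(V :: 'a^8^4) W t. \<chi> i k. V $ i $ k + t * (W $ i $ k - V $ i $ k))"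
  have mv: "mv V W 0 = V" "mv V W 1 = W" "upoly (\<lambda>t. mv V W t $ i $ k)" for V W i k
    by (auto simp: mv_def vec_eq_iff intro!: upoly_add upoly_mult)
  let ?V1 = "mv V1 (join (mat 1) 0)" and ?V2 = "mv V2 (join 0 (mat 1))"
  have "f (wedge (?V1 0) + wedge (?V2 0) + wedge V3) = 0"
  proof (rule upoly_eq_0_mult[of "\<lambda>t. f (wedge (?V1 t) + wedge (?V2 t) + wedge V3)"
        "\<lambda>t. det (stack (?V1 t) (?V2 t))" 1])
    show "upoly (\<lambda>t. f (wedge (?V1 t) + wedge (?V2 t) + wedge V3))"
      using mv(3) by (intro upoly_form[OF f]) (auto intro!: upoly_add upoly_wedge)
    show "upoly (\<lambda>t. det (stack (?V1 t) (?V2 t)))"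
    proof (rule upoly_det)
      show "upoly (\<lambda>t. stack (?V1 t) (?V2 t) $ r $ k)" for r k
        using mv(3) by (rule_tac k = r in lo_hi_cases) auto
    qed
    show "det (stack (?V1 1) (?V2 1)) \<noteq> 0" by (simp add: mv stack_base)
    show "f (wedge (?V1 t) + wedge (?V2 t) + wedge V3) = 0" if det: "det (stack (?V1 t) (?V2 t)) \<noteq> 0" for t
    proof -
      obtain B where B: "B ** stack (?V1 t) (?V2 t) = mat 1"
        using det by (auto simp: invertible_det_nz[symmetric] invertible_def)
      have "V3 = (V3 ** B) ** stack (?V1 t) (?V2 t)" by (simp add: matrix_mul_assoc[symmetric] B)
      also have "V3 ** B = join (lpart (V3 ** B)) (rpart (V3 ** B))" by simp
      finally have "V3 = lpart (V3 ** B) ** ?V1 t + rpart (V3 ** B) ** ?V2 t"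
        by (simp only: join_mult_stack)
      then show ?thesis using zero_three_wedges_dependent by metis
    qed
  qed
  then show ?thesis by (simp add: mv)
qed

end

lemma form_zero_on_secants:
  fixes f :: "'a::field^quad \<Rightarrow> 'a"
  assumes f: "form d f" and zero: "\<And>V1 V2 V3. f (wedge V1 + wedge V2 + wedge V3) = 0"
  shows "vanishes f (secant_variety 3 (plucker ` grassmannian 4))"
proof -
  let ?X = "plucker ` grassmannian 4 :: ('a^quad) set set"
  let ?U = "\<Union>p \<in> {..<3} \<rightarrow> ?X. linear_hull (p ` {..<3::nat})"
  have "vanishes f ?U"
    unfolding vanishes_def
  proof (intro ballI)
    fix L x assume "L \<in> ?U" and x: "x \<in> L"
    then obtain p where p: "p \<in> {..<3} \<rightarrow> ?X" and L: "L \<in> linear_hull (p ` {..<3::nat})" by blast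
    have "\<exists>V. p i = vec.span {wedge V}" if "i < 3" for i
      using p that plucker_cases[of "p i"] by (metis PiE lessThan_iff)
    then obtain V where V: "\<And>i. i < 3 \<Longrightarrow> p i = vec.span {wedge (V i)}" by metis
    have "{..<3} = {0, 1, 2 :: nat}" by auto
    moreover have "vec.span {wedge (V i)} \<subseteq> vec.span {wedge (V 0), wedge (V 1), wedge (V 2)}"
      if "i \<in> {0, 1, 2}" for i using that by (intro vec.span_mono) auto
    ultimately have "\<Union>(p ` {..<3}) \<subseteq> vec.span {wedge (V 0), wedge (V 1), wedge (V 2)}"
      using V[of 0] V[of 1] V[of 2] by simp
    then have "vec.span (\<Union>(p ` {..<3})) \<subseteq> vec.span {wedge (V 0), wedge (V 1), wedge (V 2)}"
      by (simp add: vec.span_minimal)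
    then have "x \<in> vec.span {wedge (V 0), wedge (V 1), wedge (V 2)}"
      using x L by (auto simp: linear_hull_def)
    then obtain a b c where "x - a *s wedge (V 0) - b *s wedge (V 1) = c *s wedge (V 2)"
      by (auto simp: vec.span_breakdown_eq vec.span_singleton)
    then have "x = a *s wedge (V 0) + b *s wedge (V 1) + c *s wedge (V 2)"
      by (simp add: algebra_simps)
    then show "f x = 0" using zero smult_wedge by metis
  qed
  moreover have "?U \<subseteq> proj_space" by (auto simp: linear_hull_def)
  ultimately have "?U \<subseteq> proj_zeros {f}" unfolding proj_zeros_def vanishes_def by blast
  moreover have "closedin zariski (proj_zeros {f})"
    unfolding closedin_zariski using f by (intro exI[of _ "{f}"]) auto
  ultimately have "secant_variety 3 ?X \<subseteq> proj_zeros {f}"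
    unfolding secant_variety_def by (rule closure_of_minimal)
  then show ?thesis by (auto simp: vanishes_def proj_zeros_def)
qed

lemma secant_variety_subset: "secant_variety s X \<subseteq> proj_space"
  unfolding secant_variety_def using closure_of_subset_topspace[of zariski] by (auto simp: topspace_zariski)

text \<open>The index type has 32 + 16 + 3 elements, for \<open>W\<close>, the right block of
  \<open>N\<close> and the last three coefficients; \<open>J\<close> omits the two entries of
  \<open>W\<close> that are fixed at 0 and 1.\<close>

lemma secant_dim_le:
  "variety_dim (secant_variety 3 (plucker ` grassmannian 4 :: ('a::field_char_0^quad) set set)) \<le> 49"
proof -
  define W :: "((4 \<times> 8) + (4 \<times> 4) + 3 \<Rightarrow> 'a) \<Rightarrow> 'a^8^4" where
    "W = (\<lambda>x. \<chi> i k. if i = 0 \<and> k = lo 0 then 0 else if i = 0 \<and> k = lo 1 then 1 else x (Inl (i, k)))"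
  define N :: "((4 \<times> 8) + (4 \<times> 4) + 3 \<Rightarrow> 'a) \<Rightarrow> 'a^8^4" where
    "N = (\<lambda>x. join (mat 1) (\<chi> i j. x (Inr (Inl (i, j)))))"
  define \<psi> where "\<psi> = (\<lambda>x. pencil_combination (N x) (W x) 1 (x (Inr (Inr 0))) (x (Inr (Inr 1))) (x (Inr (Inr 2))))"
  define J :: "((4 \<times> 8) + (4 \<times> 4) + 3) set" where "J = UNIV - {Inl (0, lo 0), Inl (0, lo 1)}"
  let ?S = "secant_variety 3 (plucker ` grassmannian 4 :: ('a^quad) set set)"
  have J: "finite J" by simp
  have "card J = 49"
    unfolding J_def by (subst card_Diff_subset) (simp_all add: card_UNIV_sum card_insert_if)
  have NW: "poly_on J (\<lambda>x. N x $ i $ k)" "poly_on J (\<lambda>x. W x $ i $ k)" for i k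
  proof -
    show "poly_on J (\<lambda>x. N x $ i $ k)"
      unfolding N_def by (rule lo_hi_cases[of k]) (auto simp: J_def)
    show "poly_on J (\<lambda>x. W x $ i $ k)"
      unfolding W_def
      by (cases "i = 0 \<and> k = lo 0"; cases "i = 0 \<and> k = lo 1") (auto simp: J_def intro!: poly_on_var)
  qed
  have "variety_dim ?S \<le> enat (card J)"
    unfolding variety_dim_def
  proof (rule krull_dim_le_parameters[OF secant_variety_subset J, of \<psi>])
    have diff: "poly_on J (\<lambda>x. pencil_diff (N x) (W x) s $ I)" for s I
      unfolding pencil_diff_def vector_minus_component using NW
      by (intro poly_on_diff poly_on_wedge J) (auto intro!: poly_on_add poly_on_mult J)
    show "poly_on J (\<lambda>x. \<psi> x $ I)" for I
      unfolding \<psi>_def pencil_combination_def vector_add_component vector_smult_component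
      by (intro poly_on_add poly_on_mult diff poly_on_const poly_on_var J) (auto simp: J_def)
    fix d and f :: "'a^quad \<Rightarrow> 'a" assume f: "form d f" and zero: "\<And>x. f (\<psi> x) = 0"
    interpret form_on_parametrization f d
    proof
      fix U :: "'a^4^4" and V :: "'a^8^4" and d2 d3 d4
      assume V: "V $ 0 $ lo 0 = 0" "V $ 0 $ lo 1 = 1"
      define x where "x = case_sum (\<lambda>(i, k). V $ i $ k)
        (case_sum (\<lambda>(i, j). U $ i $ j) (\<lambda>s :: 3. if s = 0 then d2 else if s = 1 then d3 else d4))"
      have "W x = V" using V by (auto simp: W_def x_def vec_eq_iff)
      moreover have "N x = join (mat 1) U" by (simp add: N_def x_def vec_lambda_eta)
      ultimately show "f (pencil_combination (join (mat 1) U) V 1 d2 d3 d4) = 0"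
        using zero[of x] by (simp add: \<psi>_def x_def)
    qed (rule f)
    show "vanishes f ?S" by (rule form_zero_on_secants[OF f zero_three_wedges])
  qed
  with \<open>card J = 49\<close> show ?thesis by (simp add: numeral_eq_enat)
qed

section \<open>First-order expansions\<close>

text \<open>\<open>a\<close> and \<open>b\<close> are the value and the derivative at 0 of a
  polynomial function. The rules below are the arithmetic of dual numbers and compute expansions by
  following the shape of a term.\<close>

definition jet :: "('a::field \<Rightarrow> 'a) \<Rightarrow> 'a \<Rightarrow> 'a \<Rightarrow> bool" where
  "jet f a b \<longleftrightarrow> (\<exists>p. (\<forall>t. f t = poly p t) \<and> coeff p 0 = a \<and> coeff p 1 = b)"

lemma jet_const: "jet (\<lambda>t. c) c 0"
  unfolding jet_def by (intro exI[of _ "[:c:]"]) simp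

lemma jet_id: "jet (\<lambda>t. t) 0 1"
  unfolding jet_def by (intro exI[of _ "[:0, 1:]"]) simp

lemma jet_add: "jet f a b \<Longrightarrow> jet g a' b' \<Longrightarrow> jet (\<lambda>t. f t + g t) (a + a') (b + b')"
  unfolding jet_def by (metis poly_add coeff_add)

lemma jet_diff: "jet f a b \<Longrightarrow> jet g a' b' \<Longrightarrow> jet (\<lambda>t. f t - g t) (a - a') (b - b')"
  unfolding jet_def by (metis poly_diff coeff_diff)

lemma jet_minus: "jet f a b \<Longrightarrow> jet (\<lambda>t. - f t) (- a) (- b)"
  unfolding jet_def by (metis poly_minus coeff_minus)

lemma jet_mult:
  assumes "jet f a b" "jet g a' b'"
  shows "jet (\<lambda>t. f t * g t) (a * a') (a * b' + b * a')"
proof -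
  obtain p where p: "\<forall>t. f t = poly p t" "coeff p 0 = a" "coeff p 1 = b"
    using assms(1) by (auto simp: jet_def)
  obtain q where q: "\<forall>t. g t = poly q t" "coeff q 0 = a'" "coeff q 1 = b'"
    using assms(2) by (auto simp: jet_def)
  show ?thesis
    unfolding jet_def using p q by (intro exI[of _ "p * q"]) (simp add: coeff_mult)
qed

lemma jet_eq: "jet f a b \<Longrightarrow> a = a' \<Longrightarrow> b = b' \<Longrightarrow> jet f a' b'"
  by simp

lemmas jet_rules = jet_const jet_id jet_add jet_diff jet_minus jet_mult

section \<open>Explicit Pluecker coordinates\<close>

lemma det_4:
  fixes A :: "'a::comm_ring_1^4^4"
  shows "det A =
    A$0$0 * A$1$1 * A$2$2 * A$3$3 - A$0$0 * A$1$1 * A$2$3 * A$3$2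
     - A$0$0 * A$1$2 * A$2$1 * A$3$3 + A$0$0 * A$1$2 * A$2$3 * A$3$1
     + A$0$0 * A$1$3 * A$2$1 * A$3$2 - A$0$0 * A$1$3 * A$2$2 * A$3$1
     - A$0$1 * A$1$0 * A$2$2 * A$3$3 + A$0$1 * A$1$0 * A$2$3 * A$3$2
     + A$0$1 * A$1$2 * A$2$0 * A$3$3 - A$0$1 * A$1$2 * A$2$3 * A$3$0
     - A$0$1 * A$1$3 * A$2$0 * A$3$2 + A$0$1 * A$1$3 * A$2$2 * A$3$0
     + A$0$2 * A$1$0 * A$2$1 * A$3$3 - A$0$2 * A$1$0 * A$2$3 * A$3$1
     - A$0$2 * A$1$1 * A$2$0 * A$3$3 + A$0$2 * A$1$1 * A$2$3 * A$3$0
     + A$0$2 * A$1$3 * A$2$0 * A$3$1 - A$0$2 * A$1$3 * A$2$1 * A$3$0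
     - A$0$3 * A$1$0 * A$2$1 * A$3$2 + A$0$3 * A$1$0 * A$2$2 * A$3$1
     + A$0$3 * A$1$1 * A$2$0 * A$3$2 - A$0$3 * A$1$1 * A$2$2 * A$3$0
     - A$0$3 * A$1$2 * A$2$0 * A$3$1 + A$0$3 * A$1$2 * A$2$1 * A$3$0"
proof -
  have UNIV_4': "(UNIV :: 4 set) = {0, 1, 2, 3}" using exhaust_4_zero by auto
  have ins: "finite {1, 2, 3 :: 4}" "0 \<notin> {1, 2, 3 :: 4}" "finite {2, 3 :: 4}" "1 \<notin> {2, 3 :: 4}"
    "finite {3 :: 4}" "2 \<notin> {3 :: 4}"
    by auto
  show ?thesis
    unfolding det_def UNIV_4'
    unfolding sum_over_permutations_insert[OF ins(1,2)]
    unfolding sum_over_permutations_insert[OF ins(3,4)]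
    unfolding sum_over_permutations_insert[OF ins(5,6)]
    unfolding permutes_sing
    by (simp add: sign_swap_id permutation_swap_id permutation_compose sign_compose sign_id swap_id_eq algebra_simps)
qed

text \<open>Meaningful only for increasing arguments; otherwise \<open>Quad\<close> is applied
  outside its domain.\<close>

definition quad_of :: "8 \<Rightarrow> 8 \<Rightarrow> 8 \<Rightarrow> 8 \<Rightarrow> quad" where
  "quad_of a b c d = Quad (\<lambda>j. if j = 0 then a else if j = 1 then b else if j = 2 then c else d)"

lemmas less_8 = less_bit0_def bit0.Rep_0 bit0.Rep_1 bit0.Rep_numeral

lemma wedge_quad_of:
  fixes V :: "'a::field^8^4"
  assumes "a < b" "b < c" "c < d"
  shows "wedge V $ quad_of a b c d =
    V$0$a * V$1$b * V$2$c * V$3$d - V$0$a * V$1$b * V$2$d * V$3$c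
     - V$0$a * V$1$c * V$2$b * V$3$d + V$0$a * V$1$c * V$2$d * V$3$b
     + V$0$a * V$1$d * V$2$b * V$3$c - V$0$a * V$1$d * V$2$c * V$3$b
     - V$0$b * V$1$a * V$2$c * V$3$d + V$0$b * V$1$a * V$2$d * V$3$c
     + V$0$b * V$1$c * V$2$a * V$3$d - V$0$b * V$1$c * V$2$d * V$3$a
     - V$0$b * V$1$d * V$2$a * V$3$c + V$0$b * V$1$d * V$2$c * V$3$a
     + V$0$c * V$1$a * V$2$b * V$3$d - V$0$c * V$1$a * V$2$d * V$3$b
     - V$0$c * V$1$b * V$2$a * V$3$d + V$0$c * V$1$b * V$2$d * V$3$a
     + V$0$c * V$1$d * V$2$a * V$3$b - V$0$c * V$1$d * V$2$b * V$3$a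
     - V$0$d * V$1$a * V$2$b * V$3$c + V$0$d * V$1$a * V$2$c * V$3$b
     + V$0$d * V$1$b * V$2$a * V$3$c - V$0$d * V$1$b * V$2$c * V$3$a
     - V$0$d * V$1$c * V$2$a * V$3$b + V$0$d * V$1$c * V$2$b * V$3$a"
proof -
  let ?f = "\<lambda>j :: 4. if j = 0 then a else if j = 1 then b else if j = 2 then c else d"
  have "strict_mono ?f"
  proof (rule strict_monoI)
    fix i j :: 4 assume "i < j"
    then show "?f i < ?f j"
      using assms exhaust_4_zero[of i] exhaust_4_zero[of j]
      by (elim disjE) (auto simp: less_8)
  qed
  then have "quad_fun (quad_of a b c d) = ?f" by (simp add: quad_of_def Quad_inverse)
  then show ?thesis by (simp add: wedge_def det_4)
qed

lemma join_nth:
  "join A B $ i $ 0 = A $ i $ 0" "join A B $ i $ 1 = A $ i $ 1"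
  "join A B $ i $ 2 = A $ i $ 2" "join A B $ i $ 3 = A $ i $ 3"
  "join A B $ i $ 4 = B $ i $ 0" "join A B $ i $ 5 = B $ i $ 1"
  "join A B $ i $ 6 = B $ i $ 2" "join A B $ i $ 7 = B $ i $ 3"
  using join_lo_hi(1)[of A B i 0] join_lo_hi(1)[of A B i 1] join_lo_hi(1)[of A B i 2]
    join_lo_hi(1)[of A B i 3] join_lo_hi(2)[of A B i 0] join_lo_hi(2)[of A B i 1]
    join_lo_hi(2)[of A B i 2] join_lo_hi(2)[of A B i 3]
  by (simp_all add: lo_def hi_def)

lemma mat_1_nth: "(mat 1 :: 'a::zero_neq_one^'n^'n) $ i $ j = (if i = j then 1 else 0)"
  by (simp add: mat_def)

lemma wedge_join_first: "wedge (join A B) $ quad_of 0 1 2 3 = det A" for A :: "'a::field^4^4"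
  by (simp add: wedge_quad_of less_8 join_nth det_4)

section \<open>Dimension of the Grassmannian: lower bound\<close>

text \<open>The sign is that of moving the last column to position \<open>i\<close>.\<close>

definition exchange_coordinate :: "4 \<Rightarrow> 4 \<Rightarrow> 'a::field^quad \<Rightarrow> 'a" where
  "exchange_coordinate i j x = (if i = 0 then - (x $ quad_of 1 2 3 (hi j)) else
     if i = 1 then x $ quad_of 0 2 3 (hi j) else
     if i = 2 then - (x $ quad_of 0 1 3 (hi j)) else x $ quad_of 0 1 2 (hi j))"

lemma form_exchange_coordinate: "form 1 (exchange_coordinate i j :: 'a::field^quad \<Rightarrow> 'a)"
  using form_coordinate[where 'a='a] form_cmult[OF form_coordinate, where k = "- 1 :: 'a"]
  unfolding exchange_coordinate_def by (cases "i = 0"; cases "i = 1"; cases "i = 2") simp_all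

lemma exchange_coordinate_wedge: "exchange_coordinate i j (wedge (join (mat 1) A)) = A $ i $ j"
  for A :: "'a::field^4^4"
  using exhaust_4_zero[of i] exhaust_4_zero[of j]
  by (elim disjE) (simp_all add: exchange_coordinate_def wedge_quad_of less_8 hi_def join_nth mat_1_nth)

lemma plucker_dim_ge:
  "16 \<le> variety_dim (plucker ` grassmannian 4 :: ('a::field_char_0^quad) set set)"
proof -
  define \<psi> :: "(4 \<times> 4 \<Rightarrow> 'a) \<Rightarrow> 'a^quad" where "\<psi> = (\<lambda>x. wedge (join (mat 1) (\<chi> i j. x (i, j))))"
  have "enat (card (UNIV :: (4 \<times> 4) set)) \<le> variety_dim (plucker ` grassmannian 4 :: ('a^quad) set set)"
    unfolding variety_dim_def
  proof (rule krull_dim_ge_parameters[OF plucker_subset,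
        where \<psi> = \<psi> and q = "\<lambda>(i, j). exchange_coordinate i j"])
    show "poly_on UNIV (\<lambda>x. \<psi> x $ I)" for I
      unfolding \<psi>_def
    proof (rule poly_on_wedge)
      show "poly_on UNIV (\<lambda>x. join (mat 1) (\<chi> i j. x (i, j)) $ i $ k)" for i k
        by (rule lo_hi_cases[of k]) auto
    qed simp
    show "vec.span {\<psi> x} \<in> plucker ` grassmannian 4" for x
      unfolding \<psi>_def by (rule wedge_in_plucker) simp
    show "\<psi> x $ quad_of 0 1 2 3 = 1" for x by (simp add: \<psi>_def wedge_join_first)
    show "form 1 ((\<lambda>(i, j). exchange_coordinate i j) p :: 'a^quad \<Rightarrow> 'a)" for p
      by (cases p) (simp add: form_exchange_coordinate del: One_nat_def)
    show "\<exists>p. (\<forall>t. (\<lambda>(i, j). exchange_coordinate i j) k (\<psi> (\<lambda>i. t * v i)) = poly p t) \<and>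
      coeff p 0 = 0 \<and> coeff p 1 = v k" for v k
      by (cases k) (auto simp: \<psi>_def exchange_coordinate_wedge intro!: exI[of _ "[:0, v k:]"])
  qed simp
  then show ?thesis by (simp add: numeral_eq_enat)
qed

section \<open>Dimension of the secant variety: lower bound\<close>

text \<open>
  Near the sum of \<open>2 e\<^sub>0 \<and> \<dots> \<and> e\<^sub>3\<close>, \<open>e\<^sub>4 \<and> \<dots> \<and> e\<^sub>7\<close> and \<open>- (e\<^sub>0 + e\<^sub>4) \<and> \<dots> \<and> (e\<^sub>3 + e\<^sub>7)\<close>; the first
  coefficient is chosen so that the coordinate at \<open>0, 1, 2, 3\<close> is constantly \<open>1\<close>.
\<close>

definition summand_matrix :: "3 \<Rightarrow> ((3 \<times> 4 \<times> 4) option \<Rightarrow> 'a) \<Rightarrow> 'a^4^4" where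
  "summand_matrix s x = (\<chi> i j. x (Some (s, i, j)))"

definition first_coeff :: "((3 \<times> 4 \<times> 4) option \<Rightarrow> 'a::field) \<Rightarrow> 'a" where
  "first_coeff x = 2 - (1 + x None) * det (summand_matrix 1 x)"

text \<open>The 48 matrix entries deform the three subspaces and \<open>None\<close> deforms the
  second coefficient. The third coefficient stays at -1 and the first one fixes the scale. The
  middle summand uses the opposite chart because its base point has a zero left block.\<close>

definition secant_point :: "((3 \<times> 4 \<times> 4) option \<Rightarrow> 'a::field) \<Rightarrow> 'a^quad" where
  "secant_point x = first_coeff x *s wedge (join (mat 1) (summand_matrix 0 x)) +
     (1 + x None) *s wedge (join (summand_matrix 1 x) (mat 1)) -
     wedge (join (mat 1) (mat 1 + summand_matrix 2 x))"

lemma secant_point_first: "secant_point x $ quad_of 0 1 2 3 = 1"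
  by (simp add: secant_point_def wedge_join_first first_coeff_def algebra_simps)

lemma secant_point_in_secant_variety:
  fixes x :: "(3 \<times> 4 \<times> 4) option \<Rightarrow> 'a::field"
  shows "vec.span {secant_point x} \<in> secant_variety 3 (plucker ` grassmannian 4)"
proof -
  let ?X = "plucker ` grassmannian 4 :: ('a^quad) set set"
  let ?U = "\<Union>p \<in> {..<3} \<rightarrow> ?X. linear_hull (p ` {..<3::nat})"
  define w where "w = (\<lambda>i :: nat. if i = 0 then wedge (join (mat 1) (summand_matrix 0 x))
    else if i = 1 then wedge (join (summand_matrix 1 x) (mat 1))
    else wedge (join (mat 1) (mat 1 + summand_matrix 2 x)))"
  define p where "p = (\<lambda>i. vec.span {w i})"
  have "p i \<in> ?X" for i unfolding p_def w_def by (auto intro!: wedge_in_plucker)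
  then have p: "p \<in> {..<3} \<rightarrow> ?X" by blast
  have "w i \<in> vec.span (\<Union>(p ` {..<3}))" if "i < 3" for i
    using that by (intro vec.span_base) (auto simp: p_def intro: vec.span_base)
  then have "first_coeff x *s w 0 + (1 + x None) *s w 1 - w 2 \<in> vec.span (\<Union>(p ` {..<3}))"
    by (intro vec.span_add vec.span_diff vec.span_scale) auto
  then have "secant_point x \<in> vec.span (\<Union>(p ` {..<3}))"
    by (simp add: w_def secant_point_def)
  then have "vec.span {secant_point x} \<subseteq> vec.span (\<Union>(p ` {..<3}))"
    by (intro vec.span_minimal vec.subspace_span) simp
  moreover have "secant_point x \<noteq> 0" using secant_point_first[of x] by auto
  ultimately have "vec.span {secant_point x} \<in> linear_hull (p ` {..<3})"
    by (auto simp: linear_hull_def proj_space_iff simp del: One_nat_def)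
  then have "vec.span {secant_point x} \<in> ?U" using p by blast
  moreover have "?U \<subseteq> topspace zariski" by (auto simp: linear_hull_def topspace_zariski)
  then have "?U \<subseteq> secant_variety 3 ?X" unfolding secant_variety_def by (rule closure_of_subset)
  ultimately show ?thesis by (rule subsetD[rotated])
qed

lemma poly_on_secant_point:
  "poly_on UNIV (\<lambda>x :: (3 \<times> 4 \<times> 4) option \<Rightarrow> 'a::field. secant_point x $ I)"
proof -
  have fin: "finite (UNIV :: (3 \<times> 4 \<times> 4) option set)" by simp
  have M: "poly_on UNIV (\<lambda>x. summand_matrix s x $ i $ j)" for s i j
    unfolding summand_matrix_def by (simp add: poly_on_var)
  have J: "poly_on UNIV (\<lambda>x. join (A x) (B x) $ i $ k)"
    if "\<And>i j. poly_on UNIV (\<lambda>x. A x $ i $ j)" "\<And>i j. poly_on UNIV (\<lambda>x. B x $ i $ j)"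
    for i k and A B :: "((3 \<times> 4 \<times> 4) option \<Rightarrow> 'a) \<Rightarrow> 'a^4^4"
    using that by (rule_tac k = k in lo_hi_cases) simp_all
  have M': "poly_on UNIV (\<lambda>x. (mat 1 + summand_matrix 2 x) $ i $ j)" for i j
    unfolding vector_add_component by (intro poly_on_add poly_on_const M fin)
  show ?thesis
    unfolding secant_point_def first_coeff_def vector_add_component vector_minus_component
      vector_smult_component
    by (intro poly_on_add poly_on_diff poly_on_mult poly_on_wedge poly_on_det poly_on_const
        poly_on_var J M M' fin UNIV_I)
qed

text \<open>The determinant of a 4 by 4 matrix is homogeneous of degree 4, so it contributes nothing
  to first order.\<close>

lemma jet_first_coeff: "jet (\<lambda>t. first_coeff (\<lambda>i. t * v i)) 2 0"
proof -
  have "first_coeff (\<lambda>i. t * v i) = 2 - (1 + t * v None) * (t * t * (t * t * det (summand_matrix 1 v)))" for t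
  proof -
    have "summand_matrix 1 (\<lambda>i. t * v i) = (\<chi> i. t *s (summand_matrix 1 v $ i))"
      by (simp add: summand_matrix_def vec_eq_iff)
    then show ?thesis
      using det_rows_mul[of "\<lambda>_. t" "\<lambda>i. summand_matrix 1 v $ i"]
      by (simp add: first_coeff_def vec_lambda_eta power4_eq_xxxx mult.assoc)
  qed
  moreover have "jet (\<lambda>t. 2 - (1 + t * v None) * (t * t * (t * t * det (summand_matrix 1 v)))) 2 0"
    by (rule jet_eq, (rule jet_rules)+) simp_all
  ultimately show ?thesis by simp
qed

section \<open>Recovering the 49 parameters to first order\<close>

definition expands :: "8 \<Rightarrow> 8 \<Rightarrow> 8 \<Rightarrow> 8 \<Rightarrow> 'a::field \<Rightarrow> (((3 \<times> 4 \<times> 4) option \<Rightarrow> 'a) \<Rightarrow> 'a) \<Rightarrow> bool" where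
  "expands a b c d k l \<longleftrightarrow> (\<forall>v. jet (\<lambda>t. secant_point (\<lambda>i. t * v i) $ quad_of a b c d) k (l v))"

text \<open>Only the jet of the first coefficient matters, so it is abstracted to \<open>C\<close>;
  this keeps its determinant out of the computation.\<close>

lemma expandsI:
  assumes "a < b" "b < c" "c < d"
    and "\<And>v C. jet C 2 0 \<Longrightarrow> jet (\<lambda>t.
      C t * wedge (join (mat 1) (\<chi> i j. t * v (Some (0, i, j)))) $ quad_of a b c d +
      (1 + t * v None) * wedge (join (\<chi> i j. t * v (Some (1, i, j))) (mat 1)) $ quad_of a b c d -
      wedge (join (mat 1) (mat 1 + (\<chi> i j. t * v (Some (2, i, j))))) $ quad_of a b c d) k (l v)"
  shows "expands a b c d k l"
  unfolding expands_def
proof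
  fix v
  show "jet (\<lambda>t. secant_point (\<lambda>i. t * v i) $ quad_of a b c d) k (l v)"
    using assms(4)[OF jet_first_coeff[of v], of v]
    by (simp only: secant_point_def summand_matrix_def vector_add_component
        vector_minus_component vector_smult_component)
qed

text \<open>The number of indices from 4 to 7 decides what a coordinate sees to first order. With
  one such index it sees matrices 0 and 2, with two only matrix 2, with three matrices 1 and 2, and
  with four the parameter \<open>None\<close> and the trace of matrix 2. The listed coordinates
  suffice to solve for all parameters.\<close>

lemma secant_point_expands:
    "expands 0 1 2 4 (0 :: 'a::field) (\<lambda>v. 2 * v (Some (0, 3, 0)) - v (Some (2, 3, 0)))"
    "expands 0 1 2 5 (0 :: 'a::field) (\<lambda>v. 2 * v (Some (0, 3, 1)) - v (Some (2, 3, 1)))"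
    "expands 0 1 2 6 (0 :: 'a::field) (\<lambda>v. 2 * v (Some (0, 3, 2)) - v (Some (2, 3, 2)))"
    "expands 0 1 2 7 (- 1 :: 'a::field) (\<lambda>v. 2 * v (Some (0, 3, 3)) - v (Some (2, 3, 3)))"
    "expands 0 1 3 4 (0 :: 'a::field) (\<lambda>v. - 2 * v (Some (0, 2, 0)) + v (Some (2, 2, 0)))"
    "expands 0 1 3 5 (0 :: 'a::field) (\<lambda>v. - 2 * v (Some (0, 2, 1)) + v (Some (2, 2, 1)))"
    "expands 0 1 3 6 (1 :: 'a::field) (\<lambda>v. - 2 * v (Some (0, 2, 2)) + v (Some (2, 2, 2)))"
    "expands 0 1 3 7 (0 :: 'a::field) (\<lambda>v. - 2 * v (Some (0, 2, 3)) + v (Some (2, 2, 3)))"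
    "expands 0 1 4 6 (0 :: 'a::field) (\<lambda>v. v (Some (2, 3, 0)))"
    "expands 0 1 4 7 (0 :: 'a::field) (\<lambda>v. - v (Some (2, 2, 0)))"
    "expands 0 1 5 6 (0 :: 'a::field) (\<lambda>v. v (Some (2, 3, 1)))"
    "expands 0 1 5 7 (0 :: 'a::field) (\<lambda>v. - v (Some (2, 2, 1)))"
    "expands 0 2 3 4 (0 :: 'a::field) (\<lambda>v. 2 * v (Some (0, 1, 0)) - v (Some (2, 1, 0)))"
    "expands 0 2 3 5 (- 1 :: 'a::field) (\<lambda>v. 2 * v (Some (0, 1, 1)) - v (Some (2, 1, 1)))"
    "expands 0 2 3 6 (0 :: 'a::field) (\<lambda>v. 2 * v (Some (0, 1, 2)) - v (Some (2, 1, 2)))"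
    "expands 0 2 3 7 (0 :: 'a::field) (\<lambda>v. 2 * v (Some (0, 1, 3)) - v (Some (2, 1, 3)))"
    "expands 0 2 4 7 (0 :: 'a::field) (\<lambda>v. v (Some (2, 1, 0)))"
    "expands 0 2 5 6 (0 :: 'a::field) (\<lambda>v. v (Some (2, 3, 2)))"
    "expands 0 2 5 7 (1 :: 'a::field) (\<lambda>v. v (Some (2, 1, 1)) + v (Some (2, 3, 3)))"
    "expands 0 2 6 7 (0 :: 'a::field) (\<lambda>v. v (Some (2, 1, 2)))"
    "expands 0 3 5 6 (- 1 :: 'a::field) (\<lambda>v. - v (Some (2, 1, 1)) - v (Some (2, 2, 2)))"
    "expands 0 3 5 7 (0 :: 'a::field) (\<lambda>v. - v (Some (2, 2, 3)))"
    "expands 0 3 6 7 (0 :: 'a::field) (\<lambda>v. v (Some (2, 1, 3)))"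
    "expands 0 4 5 6 (0 :: 'a::field) (\<lambda>v. - v (Some (1, 3, 0)) - v (Some (2, 3, 0)))"
    "expands 0 4 5 7 (0 :: 'a::field) (\<lambda>v. v (Some (1, 2, 0)) + v (Some (2, 2, 0)))"
    "expands 0 4 6 7 (0 :: 'a::field) (\<lambda>v. - v (Some (1, 1, 0)) - v (Some (2, 1, 0)))"
    "expands 0 5 6 7 (- 1 :: 'a::field) (\<lambda>v. v (Some (1, 0, 0)) - v (Some (2, 1, 1)) - v (Some (2, 2, 2)) - v (Some (2, 3, 3)))"
    "expands 1 2 3 4 (1 :: 'a::field) (\<lambda>v. - 2 * v (Some (0, 0, 0)) + v (Some (2, 0, 0)))"
    "expands 1 2 3 5 (0 :: 'a::field) (\<lambda>v. - 2 * v (Some (0, 0, 1)) + v (Some (2, 0, 1)))"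
    "expands 1 2 3 6 (0 :: 'a::field) (\<lambda>v. - 2 * v (Some (0, 0, 2)) + v (Some (2, 0, 2)))"
    "expands 1 2 3 7 (0 :: 'a::field) (\<lambda>v. - 2 * v (Some (0, 0, 3)) + v (Some (2, 0, 3)))"
    "expands 1 2 4 7 (- 1 :: 'a::field) (\<lambda>v. - v (Some (2, 0, 0)) - v (Some (2, 3, 3)))"
    "expands 1 2 5 7 (0 :: 'a::field) (\<lambda>v. - v (Some (2, 0, 1)))"
    "expands 1 2 6 7 (0 :: 'a::field) (\<lambda>v. - v (Some (2, 0, 2)))"
    "expands 1 3 4 6 (1 :: 'a::field) (\<lambda>v. v (Some (2, 0, 0)) + v (Some (2, 2, 2)))"
    "expands 1 3 6 7 (0 :: 'a::field) (\<lambda>v. - v (Some (2, 0, 3)))"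
    "expands 1 4 5 6 (0 :: 'a::field) (\<lambda>v. - v (Some (1, 3, 1)) - v (Some (2, 3, 1)))"
    "expands 1 4 5 7 (0 :: 'a::field) (\<lambda>v. v (Some (1, 2, 1)) + v (Some (2, 2, 1)))"
    "expands 1 4 6 7 (1 :: 'a::field) (\<lambda>v. - v (Some (1, 1, 1)) + v (Some (2, 0, 0)) + v (Some (2, 2, 2)) + v (Some (2, 3, 3)))"
    "expands 1 5 6 7 (0 :: 'a::field) (\<lambda>v. v (Some (1, 0, 1)) + v (Some (2, 0, 1)))"
    "expands 2 3 4 5 (- 1 :: 'a::field) (\<lambda>v. - v (Some (2, 0, 0)) - v (Some (2, 1, 1)))"
    "expands 2 4 5 6 (0 :: 'a::field) (\<lambda>v. - v (Some (1, 3, 2)) - v (Some (2, 3, 2)))"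
    "expands 2 4 5 7 (- 1 :: 'a::field) (\<lambda>v. v (Some (1, 2, 2)) - v (Some (2, 0, 0)) - v (Some (2, 1, 1)) - v (Some (2, 3, 3)))"
    "expands 2 4 6 7 (0 :: 'a::field) (\<lambda>v. - v (Some (1, 1, 2)) - v (Some (2, 1, 2)))"
    "expands 2 5 6 7 (0 :: 'a::field) (\<lambda>v. v (Some (1, 0, 2)) + v (Some (2, 0, 2)))"
    "expands 3 4 5 6 (1 :: 'a::field) (\<lambda>v. - v (Some (1, 3, 3)) + v (Some (2, 0, 0)) + v (Some (2, 1, 1)) + v (Some (2, 2, 2)))"
    "expands 3 4 5 7 (0 :: 'a::field) (\<lambda>v. v (Some (1, 2, 3)) + v (Some (2, 2, 3)))"
    "expands 3 4 6 7 (0 :: 'a::field) (\<lambda>v. - v (Some (1, 1, 3)) - v (Some (2, 1, 3)))"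
    "expands 3 5 6 7 (0 :: 'a::field) (\<lambda>v. v (Some (1, 0, 3)) + v (Some (2, 0, 3)))"
    "expands 4 5 6 7 (0 :: 'a::field) (\<lambda>v. v None - v (Some (2, 0, 0)) - v (Some (2, 1, 1)) - v (Some (2, 2, 2)) - v (Some (2, 3, 3)))"
  by ((rule expandsI, simp add: less_8, simp add: less_8, simp add: less_8,
      simp add: wedge_quad_of less_8 join_nth mat_1_nth,
      rule jet_eq, (assumption | rule jet_rules)+, simp, simp)[1])+


text \<open>\<open>l\<close> is the differential at the base point of some linear form along
  \<open>secant_point\<close>, with no constant term. Such functionals form a vector space, so
  recovering the parameters is linear algebra.\<close>

definition recoverable :: "(((3 \<times> 4 \<times> 4) option \<Rightarrow> 'a::field) \<Rightarrow> 'a) \<Rightarrow> bool" where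
  "recoverable l \<longleftrightarrow> (\<exists>q. form 1 q \<and> (\<forall>v. jet (\<lambda>t. q (secant_point (\<lambda>i. t * v i))) 0 (l v)))"

text \<open>The constant term \<open>k\<close> is removed homogeneously, by subtracting
  \<open>k\<close> times the coordinate that is constantly 1.\<close>

lemma recoverable_expands:
  assumes "expands a b c d k l"
  shows "recoverable l"
proof -
  let ?q = "\<lambda>x. x $ quad_of a b c d + - k * x $ quad_of 0 1 2 3"
  have "form 1 ?q" by (intro form_add form_cmult form_coordinate)
  moreover have "jet (\<lambda>t. ?q (secant_point (\<lambda>i. t * v i))) 0 (l v)" for v
    using jet_add[OF assms[unfolded expands_def, rule_format, of v] jet_const[of "- k"]]
    by (simp add: secant_point_first)
  ultimately show ?thesis unfolding recoverable_def by blast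
qed

lemma recoverable_add:
  assumes "recoverable l" "recoverable m"
  shows "recoverable (\<lambda>v. l v + m v)"
proof -
  obtain q where q: "form 1 q" "\<And>v. jet (\<lambda>t. q (secant_point (\<lambda>i. t * v i))) 0 (l v)"
    using assms(1) by (auto simp: recoverable_def simp del: One_nat_def)
  obtain r where r: "form 1 r" "\<And>v. jet (\<lambda>t. r (secant_point (\<lambda>i. t * v i))) 0 (m v)"
    using assms(2) by (auto simp: recoverable_def simp del: One_nat_def)
  have "jet (\<lambda>t. q (secant_point (\<lambda>i. t * v i)) + r (secant_point (\<lambda>i. t * v i))) 0 (l v + m v)" for v
    using jet_add[OF q(2) r(2)] by simp
  then show ?thesis
    unfolding recoverable_def using form_add[OF q(1) r(1)] by blast
qed

lemma recoverable_cmult: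
  assumes "recoverable l"
  shows "recoverable (\<lambda>v. k * l v)"
proof -
  obtain q where q: "form 1 q" "\<And>v. jet (\<lambda>t. q (secant_point (\<lambda>i. t * v i))) 0 (l v)"
    using assms by (auto simp: recoverable_def simp del: One_nat_def)
  have "jet (\<lambda>t. k * q (secant_point (\<lambda>i. t * v i))) 0 (k * l v)" for v
    using jet_mult[OF jet_const[of k] q(2)] by simp
  then show ?thesis
    unfolding recoverable_def using form_cmult[OF q(1)] by blast
qed

lemma recoverable_eq: "recoverable l \<Longrightarrow> (\<And>v. m v = l v) \<Longrightarrow> recoverable m"
  by presburger

text \<open>The linear system is triangular by blocks: first the entries \<open>c\<close> of matrix
  2, then with their help the entries \<open>a\<close> of matrix 0, the entries \<open>b\<close> of
  matrix 1, and finally \<open>None\<close>.\<close>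

lemma recoverable_parameter:
  fixes j :: "(3 \<times> 4 \<times> 4) option"
  shows "recoverable (\<lambda>v :: (3 \<times> 4 \<times> 4) option \<Rightarrow> 'a::field_char_0. v j)"
proof -
  note E = secant_point_expands[where 'a = 'a, THEN recoverable_expands]
  note scale = recoverable_cmult and plus = recoverable_add
  have c01: "recoverable (\<lambda>v :: (3 \<times> 4 \<times> 4) option \<Rightarrow> 'a. v (Some (2, 0, 1)))"
    by (rule recoverable_eq[OF scale[OF E(33), of "-1"]]) (simp add: field_simps)
  have c02: "recoverable (\<lambda>v :: (3 \<times> 4 \<times> 4) option \<Rightarrow> 'a. v (Some (2, 0, 2)))"
    by (rule recoverable_eq[OF scale[OF E(34), of "-1"]]) (simp add: field_simps)
  have c03: "recoverable (\<lambda>v :: (3 \<times> 4 \<times> 4) option \<Rightarrow> 'a. v (Some (2, 0, 3)))"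
    by (rule recoverable_eq[OF scale[OF E(36), of "-1"]]) (simp add: field_simps)
  have c10: "recoverable (\<lambda>v :: (3 \<times> 4 \<times> 4) option \<Rightarrow> 'a. v (Some (2, 1, 0)))"
    by (rule recoverable_eq[OF E(17)]) (simp add: field_simps)
  have c12: "recoverable (\<lambda>v :: (3 \<times> 4 \<times> 4) option \<Rightarrow> 'a. v (Some (2, 1, 2)))"
    by (rule recoverable_eq[OF E(20)]) (simp add: field_simps)
  have c13: "recoverable (\<lambda>v :: (3 \<times> 4 \<times> 4) option \<Rightarrow> 'a. v (Some (2, 1, 3)))"
    by (rule recoverable_eq[OF E(23)]) (simp add: field_simps)
  have c20: "recoverable (\<lambda>v :: (3 \<times> 4 \<times> 4) option \<Rightarrow> 'a. v (Some (2, 2, 0)))"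
    by (rule recoverable_eq[OF scale[OF E(10), of "-1"]]) (simp add: field_simps)
  have c21: "recoverable (\<lambda>v :: (3 \<times> 4 \<times> 4) option \<Rightarrow> 'a. v (Some (2, 2, 1)))"
    by (rule recoverable_eq[OF scale[OF E(12), of "-1"]]) (simp add: field_simps)
  have c23: "recoverable (\<lambda>v :: (3 \<times> 4 \<times> 4) option \<Rightarrow> 'a. v (Some (2, 2, 3)))"
    by (rule recoverable_eq[OF scale[OF E(22), of "-1"]]) (simp add: field_simps)
  have c30: "recoverable (\<lambda>v :: (3 \<times> 4 \<times> 4) option \<Rightarrow> 'a. v (Some (2, 3, 0)))"
    by (rule recoverable_eq[OF E(9)]) (simp add: field_simps)
  have c31: "recoverable (\<lambda>v :: (3 \<times> 4 \<times> 4) option \<Rightarrow> 'a. v (Some (2, 3, 1)))"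
    by (rule recoverable_eq[OF E(11)]) (simp add: field_simps)
  have c32: "recoverable (\<lambda>v :: (3 \<times> 4 \<times> 4) option \<Rightarrow> 'a. v (Some (2, 3, 2)))"
    by (rule recoverable_eq[OF E(18)]) (simp add: field_simps)
  \<comment> \<open>The diagonal entries of matrix 2 occur only in sums of two. Three such sums
    around a triangle determine each entry, as half of two sums minus the third.\<close>
  have c00: "recoverable (\<lambda>v :: (3 \<times> 4 \<times> 4) option \<Rightarrow> 'a. v (Some (2, 0, 0)))"
    by (rule recoverable_eq[OF plus[OF plus[OF scale[OF E(41), of "-1 / 2"] scale[OF E(35), of "1 / 2"]] scale[OF E(21), of "1 / 2"]]]) (simp add: field_simps)
  have c11: "recoverable (\<lambda>v :: (3 \<times> 4 \<times> 4) option \<Rightarrow> 'a. v (Some (2, 1, 1)))"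
    by (rule recoverable_eq[OF plus[OF plus[OF scale[OF E(41), of "-1 / 2"] scale[OF E(21), of "-1 / 2"]] scale[OF E(35), of "-1 / 2"]]]) (simp add: field_simps)
  have c22: "recoverable (\<lambda>v :: (3 \<times> 4 \<times> 4) option \<Rightarrow> 'a. v (Some (2, 2, 2)))"
    by (rule recoverable_eq[OF plus[OF plus[OF scale[OF E(35), of "1 / 2"] scale[OF E(21), of "-1 / 2"]] scale[OF E(41), of "1 / 2"]]]) (simp add: field_simps)
  have c33: "recoverable (\<lambda>v :: (3 \<times> 4 \<times> 4) option \<Rightarrow> 'a. v (Some (2, 3, 3)))"
    by (rule recoverable_eq[OF plus[OF plus[OF scale[OF E(32), of "-1 / 2"] scale[OF E(19), of "1 / 2"]] scale[OF E(41), of "1 / 2"]]]) (simp add: field_simps)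
  have a00: "recoverable (\<lambda>v :: (3 \<times> 4 \<times> 4) option \<Rightarrow> 'a. v (Some (0, 0, 0)))"
    by (rule recoverable_eq[OF plus[OF scale[OF E(28), of "-1 / 2"] scale[OF c00, of "1 / 2"]]]) (simp add: field_simps)
  have a01: "recoverable (\<lambda>v :: (3 \<times> 4 \<times> 4) option \<Rightarrow> 'a. v (Some (0, 0, 1)))"
    by (rule recoverable_eq[OF plus[OF scale[OF E(29), of "-1 / 2"] scale[OF c01, of "1 / 2"]]]) (simp add: field_simps)
  have a02: "recoverable (\<lambda>v :: (3 \<times> 4 \<times> 4) option \<Rightarrow> 'a. v (Some (0, 0, 2)))"
    by (rule recoverable_eq[OF plus[OF scale[OF E(30), of "-1 / 2"] scale[OF c02, of "1 / 2"]]]) (simp add: field_simps)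
  have a03: "recoverable (\<lambda>v :: (3 \<times> 4 \<times> 4) option \<Rightarrow> 'a. v (Some (0, 0, 3)))"
    by (rule recoverable_eq[OF plus[OF scale[OF E(31), of "-1 / 2"] scale[OF c03, of "1 / 2"]]]) (simp add: field_simps)
  have a10: "recoverable (\<lambda>v :: (3 \<times> 4 \<times> 4) option \<Rightarrow> 'a. v (Some (0, 1, 0)))"
    by (rule recoverable_eq[OF plus[OF scale[OF E(13), of "1 / 2"] scale[OF c10, of "1 / 2"]]]) (simp add: field_simps)
  have a11: "recoverable (\<lambda>v :: (3 \<times> 4 \<times> 4) option \<Rightarrow> 'a. v (Some (0, 1, 1)))"
    by (rule recoverable_eq[OF plus[OF scale[OF E(14), of "1 / 2"] scale[OF c11, of "1 / 2"]]]) (simp add: field_simps)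
  have a12: "recoverable (\<lambda>v :: (3 \<times> 4 \<times> 4) option \<Rightarrow> 'a. v (Some (0, 1, 2)))"
    by (rule recoverable_eq[OF plus[OF scale[OF E(15), of "1 / 2"] scale[OF c12, of "1 / 2"]]]) (simp add: field_simps)
  have a13: "recoverable (\<lambda>v :: (3 \<times> 4 \<times> 4) option \<Rightarrow> 'a. v (Some (0, 1, 3)))"
    by (rule recoverable_eq[OF plus[OF scale[OF E(16), of "1 / 2"] scale[OF c13, of "1 / 2"]]]) (simp add: field_simps)
  have a20: "recoverable (\<lambda>v :: (3 \<times> 4 \<times> 4) option \<Rightarrow> 'a. v (Some (0, 2, 0)))"
    by (rule recoverable_eq[OF plus[OF scale[OF E(5), of "-1 / 2"] scale[OF c20, of "1 / 2"]]]) (simp add: field_simps)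
  have a21: "recoverable (\<lambda>v :: (3 \<times> 4 \<times> 4) option \<Rightarrow> 'a. v (Some (0, 2, 1)))"
    by (rule recoverable_eq[OF plus[OF scale[OF E(6), of "-1 / 2"] scale[OF c21, of "1 / 2"]]]) (simp add: field_simps)
  have a22: "recoverable (\<lambda>v :: (3 \<times> 4 \<times> 4) option \<Rightarrow> 'a. v (Some (0, 2, 2)))"
    by (rule recoverable_eq[OF plus[OF scale[OF E(7), of "-1 / 2"] scale[OF c22, of "1 / 2"]]]) (simp add: field_simps)
  have a23: "recoverable (\<lambda>v :: (3 \<times> 4 \<times> 4) option \<Rightarrow> 'a. v (Some (0, 2, 3)))"
    by (rule recoverable_eq[OF plus[OF scale[OF E(8), of "-1 / 2"] scale[OF c23, of "1 / 2"]]]) (simp add: field_simps)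
  have a30: "recoverable (\<lambda>v :: (3 \<times> 4 \<times> 4) option \<Rightarrow> 'a. v (Some (0, 3, 0)))"
    by (rule recoverable_eq[OF plus[OF scale[OF E(1), of "1 / 2"] scale[OF c30, of "1 / 2"]]]) (simp add: field_simps)
  have a31: "recoverable (\<lambda>v :: (3 \<times> 4 \<times> 4) option \<Rightarrow> 'a. v (Some (0, 3, 1)))"
    by (rule recoverable_eq[OF plus[OF scale[OF E(2), of "1 / 2"] scale[OF c31, of "1 / 2"]]]) (simp add: field_simps)
  have a32: "recoverable (\<lambda>v :: (3 \<times> 4 \<times> 4) option \<Rightarrow> 'a. v (Some (0, 3, 2)))"
    by (rule recoverable_eq[OF plus[OF scale[OF E(3), of "1 / 2"] scale[OF c32, of "1 / 2"]]]) (simp add: field_simps)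
  have a33: "recoverable (\<lambda>v :: (3 \<times> 4 \<times> 4) option \<Rightarrow> 'a. v (Some (0, 3, 3)))"
    by (rule recoverable_eq[OF plus[OF scale[OF E(4), of "1 / 2"] scale[OF c33, of "1 / 2"]]]) (simp add: field_simps)
  have b00: "recoverable (\<lambda>v :: (3 \<times> 4 \<times> 4) option \<Rightarrow> 'a. v (Some (1, 0, 0)))"
    by (rule recoverable_eq[OF plus[OF plus[OF plus[OF E(27) c33] c22] c11]]) (simp add: field_simps)
  have b01: "recoverable (\<lambda>v :: (3 \<times> 4 \<times> 4) option \<Rightarrow> 'a. v (Some (1, 0, 1)))"
    by (rule recoverable_eq[OF plus[OF E(40) scale[OF c01, of "-1"]]]) (simp add: field_simps)
  have b02: "recoverable (\<lambda>v :: (3 \<times> 4 \<times> 4) option \<Rightarrow> 'a. v (Some (1, 0, 2)))"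
    by (rule recoverable_eq[OF plus[OF E(45) scale[OF c02, of "-1"]]]) (simp add: field_simps)
  have b03: "recoverable (\<lambda>v :: (3 \<times> 4 \<times> 4) option \<Rightarrow> 'a. v (Some (1, 0, 3)))"
    by (rule recoverable_eq[OF plus[OF E(49) scale[OF c03, of "-1"]]]) (simp add: field_simps)
  have b10: "recoverable (\<lambda>v :: (3 \<times> 4 \<times> 4) option \<Rightarrow> 'a. v (Some (1, 1, 0)))"
    by (rule recoverable_eq[OF plus[OF scale[OF E(26), of "-1"] scale[OF c10, of "-1"]]]) (simp add: field_simps)
  have b11: "recoverable (\<lambda>v :: (3 \<times> 4 \<times> 4) option \<Rightarrow> 'a. v (Some (1, 1, 1)))"
    by (rule recoverable_eq[OF plus[OF plus[OF plus[OF scale[OF E(39), of "-1"] c33] c22] c00]]) (simp add: field_simps)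
  have b12: "recoverable (\<lambda>v :: (3 \<times> 4 \<times> 4) option \<Rightarrow> 'a. v (Some (1, 1, 2)))"
    by (rule recoverable_eq[OF plus[OF scale[OF E(44), of "-1"] scale[OF c12, of "-1"]]]) (simp add: field_simps)
  have b13: "recoverable (\<lambda>v :: (3 \<times> 4 \<times> 4) option \<Rightarrow> 'a. v (Some (1, 1, 3)))"
    by (rule recoverable_eq[OF plus[OF scale[OF E(48), of "-1"] scale[OF c13, of "-1"]]]) (simp add: field_simps)
  have b20: "recoverable (\<lambda>v :: (3 \<times> 4 \<times> 4) option \<Rightarrow> 'a. v (Some (1, 2, 0)))"
    by (rule recoverable_eq[OF plus[OF E(25) scale[OF c20, of "-1"]]]) (simp add: field_simps)
  have b21: "recoverable (\<lambda>v :: (3 \<times> 4 \<times> 4) option \<Rightarrow> 'a. v (Some (1, 2, 1)))"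
    by (rule recoverable_eq[OF plus[OF E(38) scale[OF c21, of "-1"]]]) (simp add: field_simps)
  have b22: "recoverable (\<lambda>v :: (3 \<times> 4 \<times> 4) option \<Rightarrow> 'a. v (Some (1, 2, 2)))"
    by (rule recoverable_eq[OF plus[OF plus[OF plus[OF E(43) c33] c11] c00]]) (simp add: field_simps)
  have b23: "recoverable (\<lambda>v :: (3 \<times> 4 \<times> 4) option \<Rightarrow> 'a. v (Some (1, 2, 3)))"
    by (rule recoverable_eq[OF plus[OF E(47) scale[OF c23, of "-1"]]]) (simp add: field_simps)
  have b30: "recoverable (\<lambda>v :: (3 \<times> 4 \<times> 4) option \<Rightarrow> 'a. v (Some (1, 3, 0)))"
    by (rule recoverable_eq[OF plus[OF scale[OF E(24), of "-1"] scale[OF c30, of "-1"]]]) (simp add: field_simps)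
  have b31: "recoverable (\<lambda>v :: (3 \<times> 4 \<times> 4) option \<Rightarrow> 'a. v (Some (1, 3, 1)))"
    by (rule recoverable_eq[OF plus[OF scale[OF E(37), of "-1"] scale[OF c31, of "-1"]]]) (simp add: field_simps)
  have b32: "recoverable (\<lambda>v :: (3 \<times> 4 \<times> 4) option \<Rightarrow> 'a. v (Some (1, 3, 2)))"
    by (rule recoverable_eq[OF plus[OF scale[OF E(42), of "-1"] scale[OF c32, of "-1"]]]) (simp add: field_simps)
  have b33: "recoverable (\<lambda>v :: (3 \<times> 4 \<times> 4) option \<Rightarrow> 'a. v (Some (1, 3, 3)))"
    by (rule recoverable_eq[OF plus[OF plus[OF plus[OF scale[OF E(46), of "-1"] c22] c11] c00]]) (simp add: field_simps)
  have cN: "recoverable (\<lambda>v :: (3 \<times> 4 \<times> 4) option \<Rightarrow> 'a. v None)"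
    by (rule recoverable_eq[OF plus[OF plus[OF plus[OF plus[OF E(50) c33] c22] c11] c00]]) (simp add: field_simps)
  show ?thesis
  proof (cases j)
    case None
    then show ?thesis using cN by simp
  next
    case (Some p)
    obtain s i k where "p = (s, i, k)" by (cases p)
    moreover have "s = 0 \<or> s = 1 \<or> s = 2" using exhaust_3[of s] by auto
    ultimately show ?thesis
      using Some exhaust_4_zero[of i] exhaust_4_zero[of k]
      by (elim disjE) (simp_all only: c01 c02 c03 c10 c12 c13 c20 c21 c23 c30 c31 c32 c00 c11 c22 c33 a00 a01 a02 a03 a10 a11 a12 a13 a20 a21 a22 a23 a30 a31 a32 a33 b00 b01 b02 b03 b10 b11 b12 b13 b20 b21 b22 b23 b30 b31 b32 b33 cN)
  qed
qed

lemma secant_dim_ge: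
  "49 \<le> variety_dim (secant_variety 3 (plucker ` grassmannian 4 :: ('a::field_char_0^quad) set set))"
proof -
  let ?S = "secant_variety 3 (plucker ` grassmannian 4 :: ('a^quad) set set)"
  have "\<exists>q. form 1 q \<and> (\<forall>v :: _ \<Rightarrow> 'a. jet (\<lambda>t. q (secant_point (\<lambda>i. t * v i))) 0 (v j))" for j
    using recoverable_parameter[of j] unfolding recoverable_def .
  then obtain q where q: "\<And>j. form 1 (q j)"
    "\<And>j v :: _ \<Rightarrow> 'a. jet (\<lambda>t. q j (secant_point (\<lambda>i. t * v i))) 0 (v j)" by metis
  have "enat (card (UNIV :: (3 \<times> 4 \<times> 4) option set)) \<le> variety_dim ?S"
    unfolding variety_dim_def
  proof (rule krull_dim_ge_parameters[OF secant_variety_subset, where \<psi> = secant_point and q = q])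
    show "\<exists>p. (\<forall>t. q j (secant_point (\<lambda>i. t * v i)) = poly p t) \<and> coeff p 0 = 0 \<and> coeff p 1 = v j" for v j
      using q(2)[of j v] unfolding jet_def .
  qed (use q(1) poly_on_secant_point secant_point_first secant_point_in_secant_variety in
      \<open>simp_all del: One_nat_def\<close>)
  then show ?thesis by (simp add: numeral_eq_enat card_UNIV_option)
qed

theorem mainTheorem3:
  fixes X :: "('a::{alg_closed_field,field_char_0}^quad) set set"
  assumes "X = plucker ` grassmannian 4"
  shows "variety_dim X = 16 \<and>
         variety_dim (secant_variety 3 X) = 49 \<and>
         expected_secant_dim 3 X = 50 \<and>
         secant_defective 3 X \<and>
         secant_defectiveness 3 X = 1"
proof -
  have X: "variety_dim X = 16"
    unfolding assms by (rule antisym[OF plucker_dim_le plucker_dim_ge])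
  have S: "variety_dim (secant_variety 3 X) = 49"
    unfolding assms by (rule antisym[OF secant_dim_le secant_dim_ge])
  \<comment> \<open>The minimum of 70 - 1 = 69 and 3 * 16 + 3 - 1 = 50.\<close>
  have E: "expected_secant_dim 3 X = 50"
    by (simp add: expected_secant_dim_def X card_quad numeral_eq_enat one_enat_def)
  show ?thesis
    using X S E
    by (simp add: secant_defective_def secant_defectiveness_def numeral_eq_enat one_enat_def)
qed

end
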